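(* Let $X=(x_0,x_1)$ be a bounded interval. The mapping $g:\mathrm{Reg}_+(X)\to K^{\mathbb{R}}$, $\zeta\mapsto g_\zeta$, is continuous; that is, if $\zeta,\zeta_n\in\mathrm{Reg}_+(X)$ $(n\ge1)$ and $\zeta_n\to\zeta$ in $L^\infty(X)$, then for almost every $\omega\in\mathbb{R}$, $g_{\zeta_n}^\omega\to g_\zeta^\omega$ in $K$, i.e. uniformly on compact subsets of $\mathbb{D}$.
   Context: $\mathbb{D}$ is the open unit disk, $S^1$ the unit circle. $K$ is the set of all holomorphic bijections $\varphi_{\mu,\rho}(\xi)=\mu\frac{\xi+\rho}{1+\bar\rho\xi}$ of $\mathbb{D}$ ($\mu\in S^1$, $\rho\in\mathbb{D}$) together with all constant maps $\mathbb{D}\to S^1$, with the topology of uniform convergence on compact subsets of $\mathbb{D}$. $K^{\mathbb{R}}$ is the set of functions $\mathbb{R}\to K$ defined almost everywhere, with the convergence structure of almost-everywhere pointwise convergence; a map from a metric space into $K^{\mathbb R}$ is called continuous if the image of every convergent sequence converges pointwise almost everywhere (to the image of the limit). $\mathrm{Step}(X)$ is the set of piecewise-constant complex-valued functions on $X$ with finitely many discontinuities; $\mathrm{Reg}(X)$ is its closure in $L^\infty(X)$; $\mathrm{Reg}_+(X)=\{f\in\mathrm{Reg}(X): \exists\varepsilon>0,\ f(x)>\varepsilon\ \forall x\in X\}$, with the $L^\infty$ metric. One-sided limits are written $f(x\pm)$. For $\omega\in\mathbb{R}\setminus\{0\}$ put $u^{\ell}=\frac12\bigl(u-\frac{1}{i\omega}u'\bigr)$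 and $u^{\rm r}=\frac12\bigl(u+\frac{1}{i\omega}u'\bigr)$. For each $\zeta\in\mathrm{Reg}_+(X)$ there is a countable set $\Sigma_\zeta\ni0$ such that for $\omega\in\mathbb{R}\setminus\Sigma_\zeta$ and every $\xi\in\mathbb{D}$ the problem $(\zeta u')'+\omega^2\zeta u=0$ on $X$, $u^{\rm r}(x_0+)=1$, $u^{\ell}(x_1-)=\xi u^{\rm r}(x_1-)$ has a unique solution $u$ with $u$ and $\zeta u'$ absolutely continuous (equation holding a.e.); one defines $g_\zeta^\omega(\xi)=u^{\ell}(x_0+)$. It is known that $g_\zeta^\omega\in K$ for $\omega\in\mathbb{R}\setminus\Sigma_\zeta$, and $g_\zeta$ denotes the map $\omega\mapsto g_\zeta^\omega$. *)

theory Defs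
  imports "HOL-Probability.Essential_Supremum"
begin

text \<open>
  Elements of \<open>L\<^sup>\<infinity>(X)\<close> with \<open>X = (x0, x1)\<close> are represented by functions on the whole
  real line. Every notion below depends only on their restriction to \<open>X\<close>, and only up to
  null sets; in particular pointwise conditions on such an element are read almost everywhere
  on \<open>X\<close>.
\<close>

definition Linf_norm :: "real \<Rightarrow> real \<Rightarrow> (real \<Rightarrow> complex) \<Rightarrow> ereal" where
  "Linf_norm x0 x1 f = esssup (lebesgue_on {x0<..<x1}) (\<lambda>x. ereal (norm (f x)))"

definition Linf :: "real \<Rightarrow> real \<Rightarrow> (real \<Rightarrow> complex) set" where
  "Linf x0 x1 = {f. f \<in> borel_measurable (lebesgue_on {x0<..<x1}) \<and> Linf_norm x0 x1 f < \<infinity>}"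

definition Step :: "real \<Rightarrow> real \<Rightarrow> (real \<Rightarrow> complex) set" where
  "Step x0 x1 =
     {s. \<exists>D. finite D \<and> (\<forall>C \<in> components ({x0<..<x1} - D). s constant_on C)}"

definition Reg :: "real \<Rightarrow> real \<Rightarrow> (real \<Rightarrow> complex) set" where
  "Reg x0 x1 =
     {f \<in> Linf x0 x1. \<forall>\<epsilon>>0. \<exists>s \<in> Step x0 x1. Linf_norm x0 x1 (\<lambda>x. f x - s x) < ereal \<epsilon>}"

text \<open>The condition \<open>f x > \<epsilon>\<close> forces \<open>f\<close> to be real, so members are taken real-valued.\<close>

definition Reg_plus :: "real \<Rightarrow> real \<Rightarrow> (real \<Rightarrow> real) set" where
  "Reg_plus x0 x1 =
     {f. (\<lambda>x. complex_of_real (f x)) \<in> Reg x0 x1 \<and>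
         (\<exists>\<epsilon>>0. AE x in lebesgue_on {x0<..<x1}. f x > \<epsilon>)}"

definition Linf_tendsto ::
    "real \<Rightarrow> real \<Rightarrow> (nat \<Rightarrow> real \<Rightarrow> real) \<Rightarrow> (real \<Rightarrow> real) \<Rightarrow> bool" where
  "Linf_tendsto x0 x1 fs f \<longleftrightarrow>
     (\<lambda>n. Linf_norm x0 x1 (\<lambda>x. complex_of_real (fs n x - f x))) \<longlonglongrightarrow> 0"

definition abs_continuous_on :: "real set \<Rightarrow> (real \<Rightarrow> complex) \<Rightarrow> bool" where
  "abs_continuous_on S f \<longleftrightarrow>
     (\<forall>\<epsilon>>0. \<exists>\<delta>>0. \<forall>I. finite I \<longrightarrow> (\<forall>(a, b) \<in> I. a \<le> b \<and> {a..b} \<subseteq> S) \<longrightarrow>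
        disjoint_family_on (\<lambda>(a, b). {a<..<b}) I \<longrightarrow>
        (\<Sum>(a, b) \<in> I. b - a) < \<delta> \<longrightarrow> (\<Sum>(a, b) \<in> I. norm (f b - f a)) < \<epsilon>)"

text \<open>
  \<open>u'\<close> is only defined almost everywhere, so the one-sided limits \<open>f(x+)\<close> and \<open>f(x-)\<close> are
  limits along the following filters, i.e. one-sided limits up to a null set.
\<close>

definition ess_at_right :: "real \<Rightarrow> real filter" where
  "ess_at_right x = inf (at_right x) (ae_filter lebesgue)"

definition ess_at_left :: "real \<Rightarrow> real filter" where
  "ess_at_left x = inf (at_left x) (ae_filter lebesgue)"

definition left_part :: "real \<Rightarrow> (real \<Rightarrow> complex) \<Rightarrow> real \<Rightarrow> complex" where
  "left_part \<omega> u x = 1/2 * (u x - 1 / (\<i> * of_real \<omega>) * vector_derivative u (at x))"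

definition right_part :: "real \<Rightarrow> (real \<Rightarrow> complex) \<Rightarrow> real \<Rightarrow> complex" where
  "right_part \<omega> u x = 1/2 * (u x + 1 / (\<i> * of_real \<omega>) * vector_derivative u (at x))"

text \<open>\<open>w\<close> is the absolutely continuous representative of \<open>\<zeta> u'\<close>.\<close>

definition is_solution ::
    "real \<Rightarrow> real \<Rightarrow> (real \<Rightarrow> real) \<Rightarrow> real \<Rightarrow> complex \<Rightarrow> (real \<Rightarrow> complex) \<Rightarrow> bool" where
  "is_solution x0 x1 \<zeta> \<omega> \<xi> u \<longleftrightarrow>
     abs_continuous_on {x0<..<x1} u \<and>
     (\<exists>w. abs_continuous_on {x0<..<x1} w \<and>
        (AE x in lebesgue_on {x0<..<x1}. w x = of_real (\<zeta> x) * vector_derivative u (at x)) \<and>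
        (AE x in lebesgue_on {x0<..<x1}.
           (w has_vector_derivative - (of_real (\<omega>\<^sup>2 * \<zeta> x) * u x)) (at x))) \<and>
     (right_part \<omega> u \<longlongrightarrow> 1) (ess_at_right x0) \<and>
     (\<exists>a b. (left_part \<omega> u \<longlongrightarrow> a) (ess_at_left x1) \<and>
            (right_part \<omega> u \<longlongrightarrow> b) (ess_at_left x1) \<and> a = \<xi> * b)"

text \<open>
  The solution is unique only as a function on \<open>X\<close>, hence the description ranges over the
  value \<open>u\<^sup>l(x0+)\<close> and not over \<open>u\<close>. Where the problem is not uniquely solvable, the value
  of \<open>g\<close> is immaterial.
\<close>

definition g :: "real \<Rightarrow> real \<Rightarrow> (real \<Rightarrow> real) \<Rightarrow> real \<Rightarrow> complex \<Rightarrow> complex" where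
  "g x0 x1 \<zeta> \<omega> \<xi> =
     (THE c. \<exists>u. is_solution x0 x1 \<zeta> \<omega> \<xi> u \<and> (left_part \<omega> u \<longlongrightarrow> c) (ess_at_right x0))"

text \<open>Maps on the open unit disk are represented by functions on the whole plane.\<close>

definition K :: "(complex \<Rightarrow> complex) set" where
  "K = {f. (\<exists>\<mu> \<rho>. norm \<mu> = 1 \<and> norm \<rho> < 1 \<and>
              (\<forall>\<xi> \<in> ball 0 1. f \<xi> = \<mu> * ((\<xi> + \<rho>) / (1 + cnj \<rho> * \<xi>)))) \<or>
           (\<exists>c. norm c = 1 \<and> (\<forall>\<xi> \<in> ball 0 1. f \<xi> = c))}"

definition K_tendsto :: "(nat \<Rightarrow> complex \<Rightarrow> complex) \<Rightarrow> (complex \<Rightarrow> complex) \<Rightarrow> bool" where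
  "K_tendsto fs f \<longleftrightarrow>
     (\<forall>n. fs n \<in> K) \<and> f \<in> K \<and>
     (\<forall>C. compact C \<and> C \<subseteq> ball 0 1 \<longrightarrow> uniform_limit C fs f sequentially)"

end

theory Submission
  imports Defs
begin

text \<open>
  For \<open>\<omega> \<noteq> 0\<close> the pair \<open>(u, w)\<close> with \<open>w = \<zeta> u'\<close> solves the linear system \<open>u' = w / \<zeta>\<close>,
  \<open>w' = - \<omega>\<^sup>2 \<zeta> u\<close> with bounded measurable coefficients, so that the problem is uniquely solvable for
  every \<open>\<omega> \<noteq> 0\<close>. The propagator of the system is real with determinant 1 (the Wronskian is constant), and
  by a Gronwall estimate it depends continuously on \<open>\<zeta>\<close> in \<open>L\<^sup>\<infinity>\<close>, as do the limits of \<open>\<zeta>\<close> at both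
  ends. In the coordinates \<open>u\<^sup>r, u\<^sup>l\<close> it becomes a matrix with rows \<open>(A, B)\<close>, \<open>(cnj B, cnj A)\<close> and
  \<open>norm B < norm A\<close>. Hence \<open>g\<close> is a disk automorphism depending continuously on \<open>A\<close> and \<open>B\<close>, and
  convergence is even uniform on the whole disk.

  The delicate point is uniqueness: \<open>vector_derivative\<close> has a junk value where \<open>u\<close> is not
  differentiable, so one needs that absolutely continuous functions are differentiable almost
  everywhere. They are differences of monotone absolutely continuous functions, whose
  Lebesgue-Stieltjes measures have a density by Radon-Nikodym.
\<close>

section \<open>Absolutely continuous functions\<close>

text \<open>The system is treated as a pair of integral equations on the closed interval. There
  existence, uniqueness and stability involve no differentiation, so null sets matter only in the
  passage to and from \<open>is_solution\<close>. That passage is asymmetric: integral equations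
  yield derivatives almost everywhere by Lebesgue differentiation, while the way back needs the
  fundamental theorem for absolutely continuous functions. Approximation by step functions provides
  the traces of \<open>\<zeta>\<close> at the two ends. They turn the end values of \<open>w\<close>
  into one-sided limits of \<open>u'\<close>, and enter the transfer matrix as the numbers
  \<open>l0\<close>, \<open>l1\<close>. The two fundamental solutions always start from the data (1,
  0) and (0, 1), so initial data do not move with \<open>\<zeta>\<close>. Solutions with u^r = 1 at
  \<open>x0\<close> form a family with one parameter, the value of u^l there. The condition at
  \<open>x1\<close> is a linear equation for it, with nonzero leading coefficient by
  \<open>norm B < norm A\<close> and \<open>norm \<xi> < 1\<close>. Bounds on \<open>\<zeta>\<close>
  hold only almost everywhere. All coefficients are therefore altered off one common set of full
  measure, after which bounds and closeness hold at every point.\<close>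

definition packing :: "real set \<Rightarrow> (real \<times> real) set \<Rightarrow> bool" where
  "packing S I \<longleftrightarrow> finite I \<and> (\<forall>(a, b) \<in> I. a \<le> b \<and> {a..b} \<subseteq> S) \<and>
     disjoint_family_on (\<lambda>(a, b). {a<..<b}) I"

text \<open>A family of intervals may contain the same degenerate interval several times, which is harmless
  for sums of functions vanishing on degenerate intervals.\<close>
lemma packing_of_family:
  fixes a b :: "'i \<Rightarrow> real"
  assumes J: "finite J" and ab: "\<And>j. j \<in> J \<Longrightarrow> a j \<le> b j \<and> {a j..b j} \<subseteq> S"
    and dis: "disjoint_family_on (\<lambda>j. {a j<..<b j}) J"
  obtains I where "packing S I"
    "\<And>F :: real \<Rightarrow> real \<Rightarrow> real. (\<And>x. F x x = 0) \<Longrightarrow> (\<Sum>j\<in>J. F (a j) (b j)) = (\<Sum>(x, y)\<in>I. F x y)"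
proof
  define J' where "J' = {j\<in>J. a j < b j}"
  define h where "h = (\<lambda>j. (a j, b j))"
  have fin: "finite J'" using J by (simp add: J'_def)
  have inj: "inj_on h J'"
  proof (rule inj_onI, rule ccontr)
    fix i j assume "i \<in> J'" "j \<in> J'" "h i = h j" "i \<noteq> j"
    then show False
      using dis unfolding disjoint_family_on_def J'_def h_def by fastforce
  qed
  have "disjoint_family_on (\<lambda>(a, b). {a<..<b}) (h ` J')"
    using dis unfolding disjoint_family_on_def J'_def h_def by fastforce
  then show "packing S (h ` J')"
    using fin ab by (auto simp: packing_def J'_def h_def)
  show "(\<Sum>j\<in>J. F (a j) (b j)) = (\<Sum>(x, y)\<in>h ` J'. F x y)"
    if "\<And>x. F x x = 0" for F :: "real \<Rightarrow> real \<Rightarrow> real"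
  proof -
    have "(\<Sum>j\<in>J. F (a j) (b j)) = (\<Sum>j\<in>J'. F (a j) (b j))"
      by (rule sum.mono_neutral_right) (use J ab that in \<open>force simp: J'_def\<close>)+
    then show ?thesis
      using sum.reindex[OF inj, of "\<lambda>(x, y). F x y"] by (simp add: h_def)
  qed
qed

text \<open>The free index type suits the families met later, which are indexed by cells of a cover,
  by tagged cells or by pairs of intervals, and in which distinct indices may carry the same
  degenerate interval.\<close>

lemma abs_continuous_onD:
  assumes f: "abs_continuous_on S f" and "0 < \<epsilon>"
  obtains \<delta> where "0 < \<delta>"
    "\<And>(J :: 'i set) a b. \<lbrakk>finite J; \<And>j. j \<in> J \<Longrightarrow> a j \<le> b j \<and> {a j..b j} \<subseteq> S;
       disjoint_family_on (\<lambda>j. {a j<..<b j}) J; (\<Sum>j\<in>J. b j - a j) < \<delta>\<rbrakk>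
      \<Longrightarrow> (\<Sum>j\<in>J. norm (f (b j) - f (a j))) < \<epsilon>"
proof -
  obtain \<delta> where "0 < \<delta>" and \<delta>: "\<And>I. \<lbrakk>packing S I; (\<Sum>(a, b) \<in> I. b - a) < \<delta>\<rbrakk>
      \<Longrightarrow> (\<Sum>(a, b) \<in> I. norm (f b - f a)) < \<epsilon>"
    using f \<open>0 < \<epsilon>\<close> unfolding abs_continuous_on_def packing_def by meson
  show thesis
  proof
    fix J :: "'i set" and a b :: "'i \<Rightarrow> real"
    assume J: "finite J" "\<And>j. j \<in> J \<Longrightarrow> a j \<le> b j \<and> {a j..b j} \<subseteq> S"
      "disjoint_family_on (\<lambda>j. {a j<..<b j}) J" and len: "(\<Sum>j\<in>J. b j - a j) < \<delta>"
    obtain I where "packing S I" and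
      I: "\<And>F :: real \<Rightarrow> real \<Rightarrow> real. (\<And>x. F x x = 0) \<Longrightarrow> (\<Sum>j\<in>J. F (a j) (b j)) = (\<Sum>(x, y)\<in>I. F x y)"
      using packing_of_family[OF J] by blast
    show "(\<Sum>j\<in>J. norm (f (b j) - f (a j))) < \<epsilon>"
      using \<delta>[OF \<open>packing S I\<close>] len I[of "\<lambda>x y. y - x"] I[of "\<lambda>x y. norm (f y - f x)"] by simp
  qed fact
qed

text \<open>The common source of the closure properties below: increments of a real part, an
  imaginary part or a difference are dominated in this way. Each of the two dominating functions is
  allotted half of \<epsilon>.\<close>

lemma abs_continuous_on_dominated:
  assumes f: "abs_continuous_on S f" and k: "abs_continuous_on S k"
    and le: "\<And>x y. \<lbrakk>x \<in> S; y \<in> S\<rbrakk> \<Longrightarrow> norm (h y - h x) \<le> norm (f y - f x) + norm (k y - k x)"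
  shows "abs_continuous_on S h"
  unfolding abs_continuous_on_def
proof (intro allI impI)
  fix \<epsilon> :: real assume "0 < \<epsilon>"
  then have e2: "0 < \<epsilon> / 2" by simp
  obtain d1 where d1: "0 < d1" "\<And>I. \<lbrakk>finite I; \<forall>(a, b) \<in> I. a \<le> b \<and> {a..b} \<subseteq> S;
      disjoint_family_on (\<lambda>(a, b). {a<..<b}) I; (\<Sum>(a, b) \<in> I. b - a) < d1\<rbrakk>
      \<Longrightarrow> (\<Sum>(a, b) \<in> I. norm (f b - f a)) < \<epsilon> / 2"
    using f e2 unfolding abs_continuous_on_def by meson
  obtain d2 where d2: "0 < d2" "\<And>I. \<lbrakk>finite I; \<forall>(a, b) \<in> I. a \<le> b \<and> {a..b} \<subseteq> S;
      disjoint_family_on (\<lambda>(a, b). {a<..<b}) I; (\<Sum>(a, b) \<in> I. b - a) < d2\<rbrakk>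
      \<Longrightarrow> (\<Sum>(a, b) \<in> I. norm (k b - k a)) < \<epsilon> / 2"
    using k e2 unfolding abs_continuous_on_def by meson
  show "\<exists>\<delta>>0. \<forall>I. finite I \<longrightarrow> (\<forall>(a, b)\<in>I. a \<le> b \<and> {a..b} \<subseteq> S) \<longrightarrow>
          disjoint_family_on (\<lambda>(a, b). {a<..<b}) I \<longrightarrow>
          (\<Sum>(a, b)\<in>I. b - a) < \<delta> \<longrightarrow> (\<Sum>(a, b)\<in>I. norm (h b - h a)) < \<epsilon>"
  proof (intro exI[of _ "min d1 d2"] conjI allI impI)
    fix I assume I: "finite I" "\<forall>(a, b)\<in>I. a \<le> b \<and> {a..b} \<subseteq> S"
      "disjoint_family_on (\<lambda>(a, b). {a<..<b}) I" "(\<Sum>(a, b)\<in>I. b - a) < min d1 d2"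
    have "(\<Sum>(a, b)\<in>I. norm (h b - h a)) \<le> (\<Sum>(a, b)\<in>I. norm (f b - f a) + norm (k b - k a))"
      using I(2) by (intro sum_mono) (force intro!: le)
    also have "\<dots> = (\<Sum>(a, b)\<in>I. norm (f b - f a)) + (\<Sum>(a, b)\<in>I. norm (k b - k a))"
      by (simp add: sum.distrib split_def)
    also have "\<dots> < \<epsilon> / 2 + \<epsilon> / 2"
      using I d1(2)[of I] d2(2)[of I] by (intro add_strict_mono) auto
    finally show "(\<Sum>(a, b)\<in>I. norm (h b - h a)) < \<epsilon>" by simp
  qed (use d1 d2 in auto)
qed

lemma abs_continuous_on_const: "abs_continuous_on S (\<lambda>_. c)"
  unfolding abs_continuous_on_def by (auto intro!: exI[of _ 1])

lemma abs_continuous_on_Re: "abs_continuous_on S f \<Longrightarrow> abs_continuous_on S (\<lambda>x. of_real (Re (f x)))"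
  by (rule abs_continuous_on_dominated[OF _ abs_continuous_on_const[of S 0], of f])
    (auto simp flip: of_real_diff minus_complex.sel intro: abs_Re_le_cmod)

lemma abs_continuous_on_Im: "abs_continuous_on S f \<Longrightarrow> abs_continuous_on S (\<lambda>x. of_real (Im (f x)))"
  by (rule abs_continuous_on_dominated[OF _ abs_continuous_on_const[of S 0], of f])
    (auto simp flip: of_real_diff minus_complex.sel intro: abs_Im_le_cmod)

lemma abs_continuous_on_diff:
  assumes "abs_continuous_on S f" "abs_continuous_on S k"
  shows "abs_continuous_on S (\<lambda>x. f x - k x)"
  by (rule abs_continuous_on_dominated[OF assms])
    (rule order_trans[OF _ norm_triangle_ineq4], simp add: algebra_simps)

lemma abs_continuous_on_subset:
  assumes f: "abs_continuous_on S f" and "T \<subseteq> S"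
  shows "abs_continuous_on T f"
  unfolding abs_continuous_on_def
proof (intro allI impI)
  fix \<epsilon> :: real assume "0 < \<epsilon>"
  then obtain \<delta> where "0 < \<delta>" and \<delta>: "\<And>I. \<lbrakk>finite I; \<forall>(a, b) \<in> I. a \<le> b \<and> {a..b} \<subseteq> S;
      disjoint_family_on (\<lambda>(a, b). {a<..<b}) I; (\<Sum>(a, b) \<in> I. b - a) < \<delta>\<rbrakk>
      \<Longrightarrow> (\<Sum>(a, b) \<in> I. norm (f b - f a)) < \<epsilon>"
    using f unfolding abs_continuous_on_def by meson
  show "\<exists>\<delta>>0. \<forall>I. finite I \<longrightarrow> (\<forall>(a, b)\<in>I. a \<le> b \<and> {a..b} \<subseteq> T) \<longrightarrow>
          disjoint_family_on (\<lambda>(a, b). {a<..<b}) I \<longrightarrow>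
          (\<Sum>(a, b)\<in>I. b - a) < \<delta> \<longrightarrow> (\<Sum>(a, b)\<in>I. norm (f b - f a)) < \<epsilon>"
  proof (intro exI[of _ \<delta>] conjI allI impI \<open>0 < \<delta>\<close>)
    fix I assume I: "finite I" "\<forall>(a, b)\<in>I. a \<le> b \<and> {a..b} \<subseteq> T"
      "disjoint_family_on (\<lambda>(a, b). {a<..<b}) I" "(\<Sum>(a, b)\<in>I. b - a) < \<delta>"
    have "\<forall>(a, b)\<in>I. a \<le> b \<and> {a..b} \<subseteq> S"
      using I(2) \<open>T \<subseteq> S\<close> by blast
    then show "(\<Sum>(a, b)\<in>I. norm (f b - f a)) < \<epsilon>"
      using \<delta> I by blast
  qed
qed

lemma lipschitz_imp_abs_continuous_on:
  assumes "\<And>x y. \<lbrakk>x \<in> S; y \<in> S; x \<le> y\<rbrakk> \<Longrightarrow> norm (f y - f x) \<le> L * (y - x)"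
  shows "abs_continuous_on S f"
  unfolding abs_continuous_on_def
proof (intro allI impI)
  fix \<epsilon> :: real assume "0 < \<epsilon>"
  show "\<exists>\<delta>>0. \<forall>I. finite I \<longrightarrow> (\<forall>(a, b)\<in>I. a \<le> b \<and> {a..b} \<subseteq> S) \<longrightarrow>
          disjoint_family_on (\<lambda>(a, b). {a<..<b}) I \<longrightarrow>
          (\<Sum>(a, b)\<in>I. b - a) < \<delta> \<longrightarrow> (\<Sum>(a, b)\<in>I. norm (f b - f a)) < \<epsilon>"
  \<comment> \<open>The divisor \<open>\<bar>L\<bar> + 1\<close> is positive whatever the sign of
    \<open>L\<close>.\<close>
  proof (intro exI[of _ "\<epsilon> / (\<bar>L\<bar> + 1)"] conjI allI impI)
    fix I assume I: "finite I" "\<forall>(a, b)\<in>I. a \<le> b \<and> {a..b} \<subseteq> S"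
      "(\<Sum>(a, b)\<in>I. b - a) < \<epsilon> / (\<bar>L\<bar> + 1)"
    have "(\<Sum>(a, b)\<in>I. norm (f b - f a)) \<le> (\<Sum>(a, b)\<in>I. (\<bar>L\<bar> + 1) * (b - a))"
    proof (rule sum_mono, clarify)
      fix a b assume "(a, b) \<in> I"
      then have "a \<le> b" "a \<in> S" "b \<in> S" using I(2) by fastforce+
      then have "norm (f b - f a) \<le> L * (b - a)" using assms by blast
      also have "\<dots> \<le> (\<bar>L\<bar> + 1) * (b - a)" using \<open>a \<le> b\<close> by (intro mult_right_mono) auto
      finally show "norm (f b - f a) \<le> (\<bar>L\<bar> + 1) * (b - a)" .
    qed
    also have "\<dots> = (\<bar>L\<bar> + 1) * (\<Sum>(a, b)\<in>I. b - a)" by (simp add: sum_distrib_left split_def)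
    also have "\<dots> < (\<bar>L\<bar> + 1) * (\<epsilon> / (\<bar>L\<bar> + 1))"
      using I(3) by (intro mult_strict_left_mono) auto
    finally show "(\<Sum>(a, b)\<in>I. norm (f b - f a)) < \<epsilon>" by simp
  qed (use \<open>0 < \<epsilon>\<close> in auto)
qed

text \<open>A single interval is a family with one index, hence the index type \<open>unit\<close>.
  Uniformity is what later allows \<open>u\<close> and \<open>w\<close> to be extended to the closed
  interval.\<close>

lemma abs_continuous_on_imp_uniformly_continuous_on:
  assumes f: "abs_continuous_on S f" and S: "is_interval S"
  shows "uniformly_continuous_on S f"
  unfolding uniformly_continuous_on_def
proof (intro allI impI)
  fix e :: real assume "0 < e"
  obtain \<delta> where "0 < \<delta>" and \<delta>: "\<And>(J :: unit set) a b. \<lbrakk>finite J; \<And>j. j \<in> J \<Longrightarrow> a j \<le> b j \<and> {a j..b j} \<subseteq> S;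
       disjoint_family_on (\<lambda>j. {a j<..<b j}) J; (\<Sum>j\<in>J. b j - a j) < \<delta>\<rbrakk>
      \<Longrightarrow> (\<Sum>j\<in>J. norm (f (b j) - f (a j))) < e"
    using abs_continuous_onD[OF f \<open>0 < e\<close>] by blast
  have *: "norm (f y - f x) < e" if "x \<in> S" "y \<in> S" "x \<le> y" "y - x < \<delta>" for x y
  proof -
    have "{x..y} \<subseteq> S" using S that unfolding is_interval_1 by (meson atLeastAtMost_iff subsetI)
    then show ?thesis
      using \<delta>[of "{()}" "\<lambda>_. x" "\<lambda>_. y"] that by (simp add: disjoint_family_on_def)
  qed
  show "\<exists>d>0. \<forall>x\<in>S. \<forall>x'\<in>S. dist x' x < d \<longrightarrow> dist (f x') (f x) < e"
  proof (intro exI[of _ \<delta>] conjI ballI impI)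
    fix x y assume "x \<in> S" "y \<in> S" "dist y x < \<delta>"
    then show "dist (f y) (f x) < e"
      using *[of x y] *[of y x] by (cases "x \<le> y") (auto simp: dist_norm norm_minus_commute)
  qed fact
qed

text \<open>Clamping is monotone, shrinks every interval into itself and preserves disjointness,
  though it may make many intervals degenerate. It yields a function on the whole line, as
  \<open>interval_measure\<close> requires.\<close>

lemma abs_continuous_on_clamp:
  assumes f: "abs_continuous_on {c..d} f" and "c \<le> d"
  shows "abs_continuous_on UNIV (\<lambda>x. f (max c (min d x)))"
  unfolding abs_continuous_on_def
proof (intro allI impI)
  fix \<epsilon> :: real assume "0 < \<epsilon>"
  obtain \<delta> where "0 < \<delta>" and \<delta>: "\<And>(J :: (real \<times> real) set) a b. \<lbrakk>finite J; \<And>j. j \<in> J \<Longrightarrow> a j \<le> b j \<and> {a j..b j} \<subseteq> {c..d};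
       disjoint_family_on (\<lambda>j. {a j<..<b j}) J; (\<Sum>j\<in>J. b j - a j) < \<delta>\<rbrakk>
      \<Longrightarrow> (\<Sum>j\<in>J. norm (f (b j) - f (a j))) < \<epsilon>"
    using abs_continuous_onD[OF f \<open>0 < \<epsilon>\<close>] by blast
  define k where "k = (\<lambda>x. max c (min d x))"
  have "(\<Sum>(a, b)\<in>I. norm (f (k b) - f (k a))) < \<epsilon>"
    if I: "finite I" "\<forall>(a, b)\<in>I. a \<le> b \<and> {a..b} \<subseteq> UNIV"
      "disjoint_family_on (\<lambda>(a, b). {a<..<b}) I" "(\<Sum>(a, b)\<in>I. b - a) < \<delta>" for I
  proof -
    have "(\<Sum>j\<in>I. norm (f (k (snd j)) - f (k (fst j)))) < \<epsilon>"
    proof (rule \<delta>)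
      show "disjoint_family_on (\<lambda>j. {k (fst j)<..<k (snd j)}) I"
        unfolding disjoint_family_on_def
      proof (intro ballI impI)
        fix i j assume ij: "i \<in> I" "j \<in> I" "i \<noteq> j"
        have "{k (fst i)<..<k (snd i)} \<subseteq> {fst i<..<snd i}" for i
          using \<open>c \<le> d\<close> by (auto simp: k_def)
        then show "{k (fst i)<..<k (snd i)} \<inter> {k (fst j)<..<k (snd j)} = {}"
          using I(3) ij unfolding disjoint_family_on_def split_def by blast
      qed
      have "(\<Sum>j\<in>I. k (snd j) - k (fst j)) \<le> (\<Sum>(a, b)\<in>I. b - a)"
        unfolding split_def using I(2) by (intro sum_mono) (force simp: k_def)
      then show "(\<Sum>j\<in>I. k (snd j) - k (fst j)) < \<delta>" using I(4) by simp
    qed (use I \<open>c \<le> d\<close> in \<open>force simp: k_def\<close>)+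
    then show ?thesis by (simp add: split_def)
  qed
  then show "\<exists>\<delta>>0. \<forall>I. finite I \<longrightarrow> (\<forall>(a, b)\<in>I. a \<le> b \<and> {a..b} \<subseteq> UNIV) \<longrightarrow>
          disjoint_family_on (\<lambda>(a, b). {a<..<b}) I \<longrightarrow>
          (\<Sum>(a, b)\<in>I. b - a) < \<delta> \<longrightarrow>
          (\<Sum>(a, b)\<in>I. norm (f (max c (min d b)) - f (max c (min d a)))) < \<epsilon>"
    using \<open>0 < \<delta>\<close> unfolding k_def by blast
qed

section \<open>Lebesgue differentiation\<close>

text \<open>\<open>integrable_ccontinuous_explicit\<close> averages over intervals that start at the
  point, so by itself it gives right derivatives. Applied to the reflected function it gives left
  derivatives, and the exceptional set is the first null set together with the mirror image of the
  second.\<close>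

lemma lebesgue_differentiation:
  fixes f :: "real \<Rightarrow> 'b::euclidean_space"
  assumes int: "\<And>a b. f integrable_on {a..b}"
    and F: "\<And>x y. x \<le> y \<Longrightarrow> F y - F x = integral {x..y} f"
  obtains N where "negligible N" "\<And>x. x \<notin> N \<Longrightarrow> (F has_vector_derivative f x) (at x)"
proof -
  have *: "\<exists>N. negligible N \<and> (\<forall>x e. x \<notin> N \<longrightarrow> 0 < e \<longrightarrow>
      (\<exists>d>0. \<forall>h. 0 < h \<and> h < d \<longrightarrow> norm (integral {x..x + h} k - h *\<^sub>R k x) \<le> e * h))"
    if k: "\<And>a b. k integrable_on {a..b}" for k :: "real \<Rightarrow> 'b"
  proof -
    obtain N where "negligible N" and N: "\<And>x e. \<lbrakk>x \<notin> N; 0 < e\<rbrakk> \<Longrightarrow>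
        \<exists>d>0. \<forall>h. 0 < h \<and> h < d \<longrightarrow>
          norm (integral (cbox x (x + h *\<^sub>R One)) k /\<^sub>R h ^ DIM(real) - k x) < e"
      using integrable_ccontinuous_explicit[of k] k by (metis cbox_interval)
    have "norm (integral {x..x + h} k - h *\<^sub>R k x) \<le> e * h"
      if "0 < h" "norm (integral {x..x + h} k /\<^sub>R h - k x) < e" for x e h
    proof -
      have "integral {x..x + h} k - h *\<^sub>R k x = h *\<^sub>R (integral {x..x + h} k /\<^sub>R h - k x)"
        using that by (simp add: algebra_simps)
      then show ?thesis using that by (simp add: mult.commute)
    qed
    then show ?thesis
      using \<open>negligible N\<close> N by (intro exI[of _ N]) (simp, metis)
  qed
  obtain N1 where N1: "negligible N1" "\<And>x e. \<lbrakk>x \<notin> N1; 0 < e\<rbrakk> \<Longrightarrow>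
      \<exists>d>0. \<forall>h. 0 < h \<and> h < d \<longrightarrow> norm (integral {x..x + h} f - h *\<^sub>R f x) \<le> e * h"
    using *[OF int] by blast
  have "(\<lambda>x. f (- x)) integrable_on {a..b}" for a b
    using int[of "-b" "-a"] integrable_reflect[of f "-a" "-b"] by simp
  then obtain N2 where N2: "negligible N2" "\<And>x e. \<lbrakk>x \<notin> N2; 0 < e\<rbrakk> \<Longrightarrow>
      \<exists>d>0. \<forall>h. 0 < h \<and> h < d \<longrightarrow>
        norm (integral {x..x + h} (\<lambda>x. f (- x)) - h *\<^sub>R f (- x)) \<le> e * h"
    using *[of "\<lambda>x. f (- x)"] by blast
  show thesis
  proof
    show "negligible (N1 \<union> uminus ` N2)"
      using N1(1) N2(1) by (intro negligible_Un negligible_differentiable_image_negligible) (auto intro!: derivative_intros)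
    fix x assume x: "x \<notin> N1 \<union> uminus ` N2"
    then have "- x \<notin> N2" by (metis UnI2 add.inverse_inverse image_eqI)
    show "(F has_vector_derivative f x) (at x)"
      unfolding has_vector_derivative_def has_derivative_at_alt
    proof (intro conjI allI impI)
      fix e :: real assume "0 < e"
      obtain d1 where d1: "d1 > 0" "\<And>h. \<lbrakk>0 < h; h < d1\<rbrakk> \<Longrightarrow> norm (integral {x..x + h} f - h *\<^sub>R f x) \<le> e * h"
        using N1(2)[of x e] x \<open>0 < e\<close> by auto
      obtain d2 where d2: "d2 > 0" "\<And>h. \<lbrakk>0 < h; h < d2\<rbrakk> \<Longrightarrow>
          norm (integral {-x..-x + h} (\<lambda>x. f (- x)) - h *\<^sub>R f (- (- x))) \<le> e * h"
        using N2(2)[OF \<open>- x \<notin> N2\<close> \<open>0 < e\<close>] by auto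
      have d2': "norm (integral {x - h..x} f - h *\<^sub>R f x) \<le> e * h" if "0 < h" "h < d2" for h
        using d2(2)[OF that] integral_reflect[of x "x - h" f] by (simp add: algebra_simps)
      have "norm (F y - F x - (y - x) *\<^sub>R f x) \<le> e * norm (y - x)" if "norm (y - x) < min d1 d2" for y
      proof (cases y x rule: linorder_cases)
        case less
        have "F y - F x - (y - x) *\<^sub>R f x = - (integral {y..x} f - (x - y) *\<^sub>R f x)"
          using F[of y x] less by (simp add: algebra_simps)
        then have "norm (F y - F x - (y - x) *\<^sub>R f x) = norm (integral {y..x} f - (x - y) *\<^sub>R f x)"
          by (metis norm_minus_cancel)
        then show ?thesis using d2'[of "x - y"] less that by simp
      next
        case greater
        then show ?thesis using d1(2)[of "y - x"] F[of x y] that by simp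
      qed simp
      then show "\<exists>d>0. \<forall>y. norm (y - x) < d \<longrightarrow> norm (F y - F x - (y - x) *\<^sub>R f x) \<le> e * norm (y - x)"
        using d1(1) d2(1) by (intro exI[of _ "min d1 d2"]) auto
    qed (rule bounded_linear_scaleR_left)
  qed
qed

text \<open>A bounded null set is covered by countably many nonoverlapping closed intervals of total
  length below \<delta>. A finite subfamily has Stieltjes measure at most the sum of its increments,
  which absolute continuity keeps below \<epsilon>; continuity of the measure from below extends the
  bound to the whole cover.\<close>

lemma interval_measure_abs_continuous_null:
  fixes F :: "real \<Rightarrow> real"
  assumes mono: "mono F" and ac: "abs_continuous_on UNIV (\<lambda>x. of_real (F x))"
    and cont: "continuous_on UNIV F"
    and N: "N \<in> sets borel" "negligible N" "N \<subseteq> cbox a b"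
  shows "emeasure (interval_measure F) N = 0"
proof -
  let ?M = "interval_measure F"
  have "emeasure ?M N \<le> ennreal \<epsilon>" if "0 < \<epsilon>" for \<epsilon>
  proof -
    obtain \<delta> where "0 < \<delta>" and \<delta>: "\<And>(J :: real set set) a b. \<lbrakk>finite J; \<And>j. j \<in> J \<Longrightarrow> a j \<le> b j \<and> {a j..b j} \<subseteq> UNIV;
        disjoint_family_on (\<lambda>j. {a j<..<b j}) J; (\<Sum>j\<in>J. b j - a j) < \<delta>\<rbrakk>
        \<Longrightarrow> (\<Sum>j\<in>J. norm (complex_of_real (F (b j)) - of_real (F (a j)))) < \<epsilon>"
      using abs_continuous_onD[OF ac \<open>0 < \<epsilon>\<close>] by blast
    obtain D where D: "countable D" "\<And>K. K \<in> D \<Longrightarrow> K \<subseteq> cbox a b \<and> K \<noteq> {} \<and> (\<exists>c d. K = cbox c d)"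
      "pairwise (\<lambda>A B. interior A \<inter> interior B = {}) D" "N \<subseteq> \<Union>D"
      "\<Union>D \<in> lmeasurable" "measure lebesgue (\<Union>D) \<le> measure lebesgue N + \<delta> / 2"
    proof -
      have "N \<in> lmeasurable" "\<delta> / 2 > 0"
        using N \<open>0 < \<delta>\<close> by (simp_all add: negligible_imp_measurable)
      from measurable_outer_intervals_bounded[OF this(1) N(3) this(2)] show thesis
        using that by metis
    qed
    have K: "K = {Inf K..Sup K} \<and> Inf K \<le> Sup K" if "K \<in> D" for K
      using D(2)[OF that] by (auto simp: box_real)
    have borel: "K \<in> sets borel" if "K \<in> D" for K
      using K[OF that] by (metis atLeastAtMost_borel)
    have len: "measure lebesgue K = Sup K - Inf K" "K \<in> lmeasurable" "convex K" if "K \<in> D" for K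
    proof -
      obtain a b :: real where "K = {a..b}" "a \<le> b" using K \<open>K \<in> D\<close> by metis
      then show "measure lebesgue K = Sup K - Inf K" by simp
      show "K \<in> lmeasurable" "convex K"
        using \<open>K = {a..b}\<close> by (simp_all only: lmeasurable_cbox cbox_interval[symmetric] convex_box)
    qed
    have fin: "emeasure ?M (\<Union>D') \<le> ennreal \<epsilon>" if D': "finite D'" "D' \<subseteq> D" for D'
    proof -
      have pw: "pairwise (\<lambda>A B. interior A \<inter> interior B = {}) D'"
        using D(3) D'(2) by (rule pairwise_subset)
      have "emeasure ?M (\<Union>K\<in>D'. K) \<le> (\<Sum>K\<in>D'. emeasure ?M K)"
        by (rule emeasure_subadditive_finite) (use D' borel in auto)
      then have "emeasure ?M (\<Union>D') \<le> (\<Sum>K\<in>D'. emeasure ?M K)" by simp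
      also have "\<dots> = (\<Sum>K\<in>D'. ennreal (F (Sup K) - F (Inf K)))"
      proof (rule sum.cong)
        fix K assume "K \<in> D'"
        then show "emeasure ?M K = ennreal (F (Sup K) - F (Inf K))"
          using K[of K] D'(2) emeasure_interval_measure_Icc[of "Inf K" "Sup K" F, OF _ monoD[OF mono] cont]
          by auto
      qed simp
      also have "\<dots> = ennreal (\<Sum>K\<in>D'. F (Sup K) - F (Inf K))"
        using K D'(2) monoD[OF mono] by (intro sum_ennreal) (simp add: subset_iff)
      also have "\<dots> \<le> ennreal \<epsilon>"
      proof -
        have le: "Inf K \<le> Sup K" if "K \<in> D'" for K using K that D'(2) by blast
        have "(\<Sum>K\<in>D'. norm (complex_of_real (F (Sup K)) - of_real (F (Inf K)))) < \<epsilon>"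
        proof (rule \<delta>)
          have int: "{Inf K<..<Sup K} = interior K" if "K \<in> D'" for K
            using K[of K] that D'(2) interior_atLeastAtMost_real by (metis subsetD)
          show "disjoint_family_on (\<lambda>j. {Inf j<..<Sup j}) D'"
            using pw int by (auto simp: disjoint_family_on_def pairwise_def)
          have "(\<Sum>K\<in>D'. Sup K - Inf K) = (\<Sum>K\<in>D'. measure lebesgue K)"
            by (rule sum.cong) (use len D'(2) in auto)
          also have "\<dots> = measure lebesgue (\<Union>D')"
          proof (rule measure_negligible_finite_Union[symmetric])
            show "S \<in> lmeasurable" if "S \<in> D'" for S
              using len D' that by auto
            show "pairwise (\<lambda>S T. negligible (S \<inter> T)) D'"
              unfolding pairwise_def
            proof (intro ballI impI)
              fix S T assume ST: "S \<in> D'" "T \<in> D'" "S \<noteq> T"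
              \<comment> \<open>Nonoverlapping closed intervals may still share an end point; a
                convex set with empty interior is null.\<close>
              then have "interior (S \<inter> T) = {}" using pw by (simp add: pairwise_def)
              moreover have "convex (S \<inter> T)"
                using len(3) ST(1,2) D'(2) by (intro convex_Int) auto
              ultimately show "negligible (S \<inter> T)"
                by (simp add: negligible_convex_interior)
            qed
          qed (use D' in auto)
          also have "\<dots> \<le> measure lebesgue (\<Union>D)"
          proof (rule measure_mono_fmeasurable)
            show "\<Union>D' \<in> sets lebesgue"
              using len D' by (intro sets.finite_Union) auto
          qed (use D D' in auto)
          also have "\<dots> < \<delta>" using D(6) N(2) \<open>0 < \<delta>\<close> by (simp add: negligible_imp_measure0)
          finally show "(\<Sum>K\<in>D'. Sup K - Inf K) < \<delta>" .
        qed (use D' le in auto)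
        moreover have "(\<Sum>K\<in>D'. norm (complex_of_real (F (Sup K)) - of_real (F (Inf K))))
            = (\<Sum>K\<in>D'. F (Sup K) - F (Inf K))"
          by (rule sum.cong) (use le monoD[OF mono] in \<open>auto simp flip: of_real_diff\<close>)
        ultimately show ?thesis by (intro ennreal_leI) simp
      qed
      finally show ?thesis .
    qed
    \<comment> \<open>Absolute continuity speaks of finite families only, so the cover is exhausted
      by an increasing sequence of finite ones.\<close>
    define E where "E n = {K\<in>D. to_nat_on D K < n}" for n
    have finE: "finite (E n)" for n
    proof (rule finite_imageD[of "to_nat_on D"])
      show "finite (to_nat_on D ` E n)"
        by (rule finite_subset[of _ "{..<n}"]) (auto simp: E_def)
      show "inj_on (to_nat_on D) (E n)"
        using inj_on_to_nat_on[OF D(1)] by (rule inj_on_subset) (auto simp: E_def)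
    qed
    have "\<Union>D = (\<Union>n. \<Union>(E n))" by (auto simp: E_def)
    moreover have "emeasure ?M (\<Union>n. \<Union>(E n)) = (SUP n. emeasure ?M (\<Union>(E n)))"
    proof (rule SUP_emeasure_incseq[symmetric])
      show "range (\<lambda>n. \<Union> (E n)) \<subseteq> sets ?M"
      proof clarify
        fix n
        show "\<Union>(E n) \<in> sets ?M"
          using borel finE by (intro sets.finite_Union) (auto simp: E_def)
      qed
      show "incseq (\<lambda>n. \<Union> (E n))" by (force simp: incseq_def E_def)
    qed
    moreover have "\<dots> \<le> ennreal \<epsilon>"
      by (intro SUP_least fin finE) (auto simp: E_def)
    moreover have "emeasure ?M N \<le> emeasure ?M (\<Union>D)"
      using D(1,4) borel by (intro emeasure_mono) (auto intro!: sets.countable_Union)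
    ultimately show ?thesis by simp
  qed
  note le = this
  have "emeasure ?M N \<le> 0"
  proof (rule ennreal_le_epsilon)
    fix e :: real assume "0 < e"
    then show "emeasure ?M N \<le> 0 + ennreal e" using le[of e] by simp
  qed
  then show ?thesis by simp
qed

text \<open>By the preceding lemma the Stieltjes measure has a density with respect to
  \<open>lborel\<close>; \<open>F\<close> is then an indefinite integral of that density, to which
  Lebesgue differentiation applies.\<close>

lemma mono_abs_continuous_differentiable:
  fixes F :: "real \<Rightarrow> real"
  assumes mono: "mono F" and ac: "abs_continuous_on UNIV (\<lambda>x. of_real (F x))"
  shows "negligible {x. \<not> F differentiable at x}"
proof -
  have "continuous_on UNIV (\<lambda>x. complex_of_real (F x))"
    using uniformly_continuous_imp_continuous abs_continuous_on_imp_uniformly_continuous_on[OF ac] is_interval_univ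
    by blast
  then have cont: "continuous_on UNIV F"
    using continuous_on_Re by fastforce
  let ?M = "interval_measure F"
  have right: "continuous (at_right a) F" for a
    using cont by (simp add: continuous_at_imp_continuous_at_within continuous_on_eq_continuous_at)
  have M: "emeasure ?M {a<..b} = ennreal (F b - F a)" if "a \<le> b" for a b
    using that mono right by (intro emeasure_interval_measure_Ioc) (auto dest: monoD)
  have abs: "absolutely_continuous lborel ?M"
    unfolding absolutely_continuous_def
  proof
    fix N assume N: "N \<in> null_sets (lborel :: real measure)"
    then have "N \<in> null_sets lebesgue" by (rule null_sets_completionI)
    then have "negligible N" by (simp add: negligible_iff_null_sets)
    \<comment> \<open>The covering argument needs a bounded set, hence the boxes.\<close>
    have "emeasure ?M (N \<inter> cbox (- real n) (real n)) = 0" for n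
      using interval_measure_abs_continuous_null[OF mono ac cont, of "N \<inter> cbox (- real n) (real n)"] N \<open>negligible N\<close>
      by (metis Int_lower2 borel_closed closed_cbox negligible_Int null_setsD2 sets.Int sets_lborel)
    then have "(\<Union>n. N \<inter> cbox (- real n) (real n)) \<in> null_sets ?M"
      using N by (intro null_sets_UN) (auto simp: null_sets_def)
    moreover have "(\<Union>n. N \<inter> cbox (- real n) (real n)) = N"
    proof -
      have "\<exists>n. x \<in> cbox (- real n) (real n)" for x :: real
        using real_arch_simple[of "\<bar>x\<bar>"] by (simp add: abs_le_iff minus_le_iff conj_commute)
      then show ?thesis by blast
    qed
    ultimately show "N \<in> null_sets ?M" by simp
  qed
  interpret M: sigma_finite_measure ?M
    using mono right by (intro sigma_finite_interval_measure) (auto dest: monoD)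
  define h where "h x = enn2real (RN_deriv lborel ?M x)" for x
  have h: "(h has_integral (F b - F a)) {a..b}" if "a \<le> b" for a b
  proof -
    have 1: "integrable ?M (indicat_real {a<..b})"
      using M[OF that] by (simp add: integrable_indicator_iff)
    have "integrable lborel (\<lambda>x. h x * indicat_real {a<..b} x)"
      using sigma_finite_measure.RN_deriv_integrable[OF sigma_finite_lborel M.sigma_finite_measure_axioms abs, of "indicat_real {a<..b}"] 1
      by (simp add: h_def)
    moreover have "(\<integral>x. h x * indicat_real {a<..b} x \<partial>lborel) = F b - F a"
      using sigma_finite_measure.RN_deriv_integral[OF sigma_finite_lborel M.sigma_finite_measure_axioms abs, of "indicat_real {a<..b}"] M[OF that] monoD[OF mono that]
      by (simp add: h_def measure_def)
    ultimately have "((\<lambda>x. h x * indicat_real {a<..b} x) has_integral (F b - F a)) UNIV"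
      using has_integral_integral_lborel by metis
    moreover have "(\<lambda>x. h x * indicat_real {a<..b} x) = (\<lambda>x. if x \<in> {a<..b} then h x else 0)"
      by (auto simp: indicator_def)
    ultimately have "(h has_integral (F b - F a)) {a<..b}"
      by (simp only: has_integral_restrict_UNIV)
    then show ?thesis
      by (rule iffD1[OF has_integral_spike_set_eq, rotated 2]) (auto intro: negligible_subset[of "{a}"])
  qed
  have "h integrable_on {a..b}" for a b
    using h[of a b] by (cases "a \<le> b") auto
  then obtain N where "negligible N" "\<And>x. x \<notin> N \<Longrightarrow> (F has_vector_derivative h x) (at x)"
    using lebesgue_differentiation[of h F] h by (metis integral_unique)
  then show ?thesis
    by (elim negligible_subset) (auto dest: differentiableI_vector)
qed

text \<open>FTC by a Henstock-Kurzweil gauge: on the exceptional null set the gauge is contained in a small open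
  set, where absolute continuity takes over.\<close>
lemma abs_continuous_on_has_integral:
  assumes ac: "abs_continuous_on S f" and "c \<le> d" and cd: "{c..d} \<subseteq> S"
    and N: "negligible N"
    and der: "\<And>x. \<lbrakk>x \<in> {c..d}; x \<notin> N\<rbrakk> \<Longrightarrow> (f has_vector_derivative h x) (at x)"
  shows "(h has_integral (f d - f c)) {c..d}"
proof -
  \<comment> \<open>With the integrand 0 on \<open>N\<close>, a cell tagged in \<open>N\<close>
    contributes nothing but an increment of \<open>f\<close>, which absolute continuity can
    control.\<close>
  define k where "k x = (if x \<in> N then 0 else h x)" for x
  have "(k has_integral (f d - f c)) (cbox c d)"
    unfolding has_integral
  proof (intro allI impI)
    fix e :: real assume "0 < e"
    then have e2: "0 < e / 2" by simp
    \<comment> \<open>The cells tagged outside \<open>N\<close> will cost at most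
      \<open>e' * (d - c)\<close>, that is at most \<open>e / 2\<close>; adding 1 keeps the divisor
      positive when \<open>c = d\<close>.\<close>
    define e' where "e' = e / (2 * (d - c + 1))"
    have "0 < e'" using \<open>0 < e\<close> \<open>c \<le> d\<close> by (simp add: e'_def)
    obtain \<delta> where "0 < \<delta>" and \<delta>: "\<And>(J :: (real \<times> real set) set) a b. \<lbrakk>finite J; \<And>j. j \<in> J \<Longrightarrow> a j \<le> b j \<and> {a j..b j} \<subseteq> S;
        disjoint_family_on (\<lambda>j. {a j<..<b j}) J; (\<Sum>j\<in>J. b j - a j) < \<delta>\<rbrakk>
        \<Longrightarrow> (\<Sum>j\<in>J. norm (f (b j) - f (a j))) < e / 2"
      using abs_continuous_onD[OF ac e2] by blast
    obtain U where U: "open U" "N \<subseteq> U" "U \<in> lmeasurable" "measure lebesgue U < \<delta>"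
    proof -
      obtain U where "open U" "N \<subseteq> U" "U - N \<in> lmeasurable" "emeasure lebesgue (U - N) < ennreal \<delta>"
        using sets_lebesgue_outer_open[of N \<delta>] N \<open>0 < \<delta>\<close> by (metis negligible_imp_sets)
      then have "(U - N) \<union> N \<in> lmeasurable"
        using N \<open>U - N \<in> lmeasurable\<close> by (metis fmeasurable.Un negligible_imp_measurable)
      then have "U \<in> lmeasurable" using \<open>N \<subseteq> U\<close> by (simp add: Un_absorb2)
      moreover have "measure lebesgue U = measure lebesgue (U - N)"
        by (rule measure_Diff_null_set[symmetric]) (use N \<open>U \<in> lmeasurable\<close> in \<open>auto simp: negligible_iff_null_sets\<close>)
      moreover have "measure lebesgue (U - N) < \<delta>"
        using \<open>emeasure lebesgue (U - N) < ennreal \<delta>\<close> \<open>U - N \<in> lmeasurable\<close> \<open>0 < \<delta>\<close>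
        by (simp add: emeasure_eq_measure2 ennreal_less_iff)
      ultimately show thesis using that \<open>open U\<close> \<open>N \<subseteq> U\<close> by simp
    qed
    \<comment> \<open>The gauge has two tasks: at a tag in \<open>N\<close> it forces the cell into
      \<open>U\<close>, elsewhere it enforces linear approximation with error \<open>e'\<close>
      times the distance.\<close>
    have "\<exists>r>0. (x \<in> N \<longrightarrow> ball x r \<subseteq> U) \<and>
        (x \<notin> N \<longrightarrow> x \<in> {c..d} \<longrightarrow> (\<forall>y. norm (y - x) < r \<longrightarrow> norm (f y - f x - (y - x) *\<^sub>R h x) \<le> e' * norm (y - x)))" for x
    proof (cases "x \<in> N")
      case True
      then show ?thesis using U by (auto simp: open_contains_ball)
    next
      case False
      show ?thesis
      proof (cases "x \<in> {c..d}")
        case True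
        have "\<forall>e>0. \<exists>r>0. \<forall>y. norm (y - x) < r \<longrightarrow> norm (f y - f x - (y - x) *\<^sub>R h x) \<le> e * norm (y - x)"
          using der[OF True \<open>x \<notin> N\<close>]
          unfolding has_vector_derivative_def has_derivative_at_alt by (rule conjunct2)
        then obtain r where "r > 0" "\<forall>y. norm (y - x) < r \<longrightarrow> norm (f y - f x - (y - x) *\<^sub>R h x) \<le> e' * norm (y - x)"
          using \<open>0 < e'\<close> by blast
        then show ?thesis using \<open>x \<notin> N\<close> by blast
      qed (use False in \<open>auto intro!: exI[of _ 1]\<close>)
    qed
    then obtain r where r: "\<And>x. 0 < r x" "\<And>x. x \<in> N \<Longrightarrow> ball x (r x) \<subseteq> U"
      "\<And>x y. \<lbrakk>x \<notin> N; x \<in> {c..d}; norm (y - x) < r x\<rbrakk> \<Longrightarrow> norm (f y - f x - (y - x) *\<^sub>R h x) \<le> e' * norm (y - x)"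
      by metis
    have "norm ((\<Sum>(x, K)\<in>p. measure lborel K *\<^sub>R k x) - (f d - f c)) < e"
      if p: "p tagged_division_of (cbox c d)" "(\<lambda>x. ball x (r x)) fine p" for p
    proof -
      have finp: "finite p" using p(1) by blast
      have K: "K = {Inf K..Sup K} \<and> Inf K \<le> Sup K \<and> x \<in> K \<and> K \<subseteq> {c..d} \<and> K \<subseteq> ball x (r x)" if xK: "(x, K) \<in> p" for x K
      proof -
        obtain a b where ab: "K = cbox a b" using tagged_division_ofD(4)[OF p(1) xK] by blast
        have "x \<in> K" "K \<subseteq> cbox c d" using tagged_division_ofD(2,3)[OF p(1) that] by simp_all
        moreover have "a \<le> b" using \<open>x \<in> K\<close> ab by auto
        moreover have "K \<subseteq> ball x (r x)" using p(2) that unfolding fine_def by blast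
        ultimately show ?thesis using ab by (simp add: box_real)
      qed
      let ?D = "\<lambda>(x, K). measure lborel K *\<^sub>R k x - (f (Sup K) - f (Inf K))"
      have "(\<Sum>(x, K)\<in>p. f (Sup K) - f (Inf K)) = f d - f c"
        using additive_tagged_division_1[OF \<open>c \<le> d\<close>, of p f] p(1) by (simp add: box_real)
      then have "(\<Sum>(x, K)\<in>p. measure lborel K *\<^sub>R k x) - (f d - f c) = (\<Sum>j\<in>p. ?D j)"
        by (simp add: sum_subtractf split_def)
      also have "\<dots> = (\<Sum>j\<in>{j\<in>p. fst j \<in> N}. ?D j) + (\<Sum>j\<in>{j\<in>p. fst j \<notin> N}. ?D j)"
        using finp by (subst sum.union_disjoint[symmetric]) (auto intro!: sum.cong)
      finally have eq: "(\<Sum>(x, K)\<in>p. measure lborel K *\<^sub>R k x) - (f d - f c) = \<dots>" .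
      have dis: "disjoint_family_on (\<lambda>j. {Inf (snd j)<..<Sup (snd j)}) p"
        unfolding disjoint_family_on_def
      proof (intro ballI impI)
        fix i j assume ij: "i \<in> p" "j \<in> p" "i \<noteq> j"
        obtain x A y B where xy: "i = (x, A)" "j = (y, B)" by (cases i, cases j) auto
        then have "interior A \<inter> interior B = {}"
          using tagged_division_ofD(5)[OF p(1)] ij by blast
        then show "{Inf (snd i)<..<Sup (snd i)} \<inter> {Inf (snd j)<..<Sup (snd j)} = {}"
          using K[of x A] K[of y B] ij xy by (metis interior_atLeastAtMost_real snd_conv)
      qed
      have le: "Inf A \<le> Sup A" if "(x, A) \<in> p" for x A
        using K[OF that] by blast
      have cont: "measure lborel A = Sup A - Inf A" if "(x, A) \<in> p" for x A
        using K[OF that] by (metis content_real)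
      have "norm (\<Sum>j\<in>{j\<in>p. fst j \<in> N}. ?D j) \<le> (\<Sum>j\<in>{j\<in>p. fst j \<in> N}. norm (f (Sup (snd j)) - f (Inf (snd j))))"
        by (rule sum_norm_le) (auto simp: k_def norm_minus_commute)
      also have "\<dots> < e / 2"
      proof (rule \<delta>)
        let ?P = "{j\<in>p. fst j \<in> N}"
        have d': "disjoint_family_on (\<lambda>j. {Inf (snd j)<..<Sup (snd j)}) ?P"
          using dis by (rule disjoint_family_on_mono[rotated]) auto
        then show "disjoint_family_on (\<lambda>j. {Inf (snd j)<..<Sup (snd j)}) ?P" .
        have "(\<Sum>j\<in>?P. Sup (snd j) - Inf (snd j)) = (\<Sum>j\<in>?P. measure lebesgue {Inf (snd j)<..<Sup (snd j)})"
          by (rule sum.cong) (use K in auto)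
        also have "\<dots> = measure lebesgue (\<Union>j\<in>?P. {Inf (snd j)<..<Sup (snd j)})"
          by (rule measure_finite_Union[symmetric]) (use d' finp le in auto)
        also have "\<dots> \<le> measure lebesgue U"
        proof (rule measure_mono_fmeasurable)
          show "(\<Union>j\<in>?P. {Inf (snd j)<..<Sup (snd j)}) \<subseteq> U"
          proof clarsimp
            fix x A t assume "(x, A) \<in> p" "x \<in> N" "Inf A < t" "t < Sup A"
            then have "t \<in> A" using K[of x A] by (metis atLeastAtMost_iff less_imp_le)
            then show "t \<in> U" using K[of x A] r(2)[of x] \<open>(x, A) \<in> p\<close> \<open>x \<in> N\<close> by blast
          qed
        qed (use U finp in auto)
        also have "\<dots> < \<delta>" by (rule U)
        finally show "(\<Sum>j\<in>?P. Sup (snd j) - Inf (snd j)) < \<delta>" .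
        fix j assume "j \<in> ?P"
        then show "Inf (snd j) \<le> Sup (snd j) \<and> {Inf (snd j)..Sup (snd j)} \<subseteq> S"
          using K[of "fst j" "snd j"] cd by (metis (no_types, lifting) mem_Collect_eq prod.collapse subset_trans)
      qed (use finp in auto)
      finally have N_part: "norm (\<Sum>j\<in>{j\<in>p. fst j \<in> N}. ?D j) < e / 2" .
      have "norm (\<Sum>j\<in>{j\<in>p. fst j \<notin> N}. ?D j) \<le> (\<Sum>j\<in>{j\<in>p. fst j \<notin> N}. e' * measure lborel (snd j))"
      proof (rule sum_norm_le, clarsimp)
        fix x A assume xA: "(x, A) \<in> p" "x \<notin> N"
        let ?a = "Inf A" and ?b = "Sup A"
        have m: "?a \<in> A" "?b \<in> A" using K[OF xA(1)] by (metis atLeastAtMost_iff order_refl)+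
        have ax: "?a \<le> x" "x \<le> ?b" using K[OF xA(1)] by (metis atLeastAtMost_iff)+
        have "x \<in> {c..d}" using K[OF xA(1)] by blast
        moreover have "norm (?a - x) < r x" "norm (?b - x) < r x"
          using m K[OF xA(1)] by (auto simp: dist_norm norm_minus_commute)
        ultimately have 1: "norm (f ?a - f x - (?a - x) *\<^sub>R h x) \<le> e' * norm (?a - x)"
          and 2: "norm (f ?b - f x - (?b - x) *\<^sub>R h x) \<le> e' * norm (?b - x)"
          using r(3) xA(2) by auto
        \<comment> \<open>Both end points of the cell are compared with its tag. As the tag lies
          between them, the two distances add up to the length of the cell.\<close>
        have eqA: "measure lborel A *\<^sub>R k x - (f ?b - f ?a) = (f ?a - f x - (?a - x) *\<^sub>R h x) - (f ?b - f x - (?b - x) *\<^sub>R h x)"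
          by (simp add: k_def xA(2) cont[OF xA(1)] scaleR_diff_left)
        have "norm (measure lborel A *\<^sub>R k x - (f ?b - f ?a)) \<le> e' * norm (?a - x) + e' * norm (?b - x)"
          unfolding eqA by (rule order_trans[OF norm_triangle_ineq4 add_mono[OF 1 2]])
        also have "\<dots> = e' * measure lborel A"
          unfolding cont[OF xA(1)] using ax by (simp add: algebra_simps)
        finally show "norm (measure lborel A *\<^sub>R k x - (f ?b - f ?a)) \<le> e' * measure lborel A" .
      qed
      also have "\<dots> \<le> (\<Sum>j\<in>p. e' * measure lborel (snd j))"
        using finp \<open>0 < e'\<close> by (intro sum_mono2) auto
      also have "\<dots> = e' * (d - c)"
        using additive_content_tagged_division[OF p(1)] \<open>c \<le> d\<close>
        by (simp add: sum_distrib_left[symmetric] split_def)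
      also have "\<dots> \<le> e / 2"
        using \<open>c \<le> d\<close> \<open>0 < e\<close> by (simp add: e'_def divide_simps)
      finally show ?thesis using N_part eq norm_triangle_ineq
        by (smt (verit, best) field_sum_of_halves)
    qed
    moreover have "gauge (\<lambda>x. ball x (r x))" using r(1) by (simp add: gauge_def)
    ultimately show "\<exists>\<gamma>. gauge \<gamma> \<and> (\<forall>\<D>. \<D> tagged_division_of cbox c d \<and> \<gamma> fine \<D> \<longrightarrow>
        norm ((\<Sum>(x, K)\<in>\<D>. measure lborel K *\<^sub>R k x) - (f d - f c)) < e)"
      by blast
  qed
  then show ?thesis
    using has_integral_spike[OF N, of "{c..d}" h k] by (simp add: k_def)
qed

section \<open>Total variation\<close>

definition variation_sum :: "(real \<Rightarrow> complex) \<Rightarrow> (real \<times> real) set \<Rightarrow> real" where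
  "variation_sum f I = (\<Sum>(a, b)\<in>I. norm (f b - f a))"

text \<open>Taking packings in place of partitions makes monotonicity in \<open>S\<close> immediate
  and matches the families in the definition of absolute continuity. A real \<open>SUP\<close> is
  informative only for bounded sets, hence the separate predicate
  \<open>finite_variation\<close>.\<close>

definition total_variation :: "(real \<Rightarrow> complex) \<Rightarrow> real set \<Rightarrow> real" where
  "total_variation f S = (SUP I \<in> Collect (packing S). variation_sum f I)"

definition finite_variation :: "(real \<Rightarrow> complex) \<Rightarrow> real set \<Rightarrow> bool" where
  "finite_variation f S \<longleftrightarrow> bdd_above (variation_sum f ` Collect (packing S))"

lemma packing_iff:
  "packing S I \<longleftrightarrow> finite I \<and> (\<forall>a b. (a, b) \<in> I \<longrightarrow> a \<le> b \<and> {a..b} \<subseteq> S) \<and>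
     disjoint_family_on (\<lambda>(a, b). {a<..<b}) I"
  by (simp add: packing_def Ball_def split_paired_All)

lemma packing_subset: "packing S I \<Longrightarrow> S \<subseteq> T \<Longrightarrow> packing T I"
  unfolding packing_iff by (meson order_trans)

lemma finite_variation_subset: "finite_variation f S \<Longrightarrow> T \<subseteq> S \<Longrightarrow> finite_variation f T"
  unfolding finite_variation_def by (rule bdd_above_mono) (auto intro: packing_subset)

lemma variation_sum_le:
  assumes "finite_variation f S" "packing S I"
  shows "variation_sum f I \<le> total_variation f S"
  using assms unfolding finite_variation_def total_variation_def by (auto intro: cSUP_upper)

lemma variation_family_le:
  assumes f: "finite_variation f S" and "finite J" "\<And>j. j \<in> J \<Longrightarrow> a j \<le> b j \<and> {a j..b j} \<subseteq> S"
    and "disjoint_family_on (\<lambda>j. {a j<..<b j}) J"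
  shows "(\<Sum>j\<in>J. norm (f (b j) - f (a j))) \<le> total_variation f S"
proof -
  obtain I where I: "packing S I"
    "\<And>F :: real \<Rightarrow> real \<Rightarrow> real. (\<And>x. F x x = 0) \<Longrightarrow> (\<Sum>j\<in>J. F (a j) (b j)) = (\<Sum>(x, y)\<in>I. F x y)"
    using packing_of_family[OF assms(2-4)] by blast
  have "(\<Sum>j\<in>J. norm (f (b j) - f (a j))) = variation_sum f I"
    unfolding variation_sum_def by (rule I(2)) simp
  then show ?thesis using variation_sum_le[OF f I(1)] by simp
qed

lemma packing_empty: "packing S {}"
  by (simp add: packing_def disjoint_family_on_def)

text \<open>A packing of \<open>{c..x}\<close> together with the interval from \<open>x\<close> to
  \<open>y\<close> packs \<open>{c..y}\<close>. For real \<open>f\<close> this makes the variation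
  function, and the variation function minus \<open>f\<close>, monotone.\<close>

lemma total_variation_step:
  assumes f: "finite_variation f {c..y}" and "c \<le> x" "x \<le> y"
  shows "total_variation f {c..x} + norm (f y - f x) \<le> total_variation f {c..y}"
proof -
  have "variation_sum f I \<le> total_variation f {c..y} - norm (f y - f x)" if I: "packing {c..x} I" for I
  \<comment> \<open>Packings are sets: only for \<open>x < y\<close> is the new pair certainly
    absent from \<open>I\<close>, so that inserting it adds its term to the sum.\<close>
  proof (cases "x = y")
    case True
    then show ?thesis using variation_sum_le[OF f] I by simp
  next
    case False
    then have "x < y" using \<open>x \<le> y\<close> by simp
    have sub: "p \<le> q \<and> {p..q} \<subseteq> {c..x}" if "(p, q) \<in> I" for p q
      using I that unfolding packing_iff by blast
    have notin: "(x, y) \<notin> I" using sub[of x y] \<open>x < y\<close> by auto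
    have "packing {c..y} (insert (x, y) I)"
      unfolding packing_def
    proof (intro conjI)
      show "finite (insert (x, y) I)" using I by (simp add: packing_def)
      show "\<forall>(a, b)\<in>insert (x, y) I. a \<le> b \<and> {a..b} \<subseteq> {c..y}"
        using sub \<open>c \<le> x\<close> \<open>x < y\<close> by fastforce
      have "{x<..<y} \<inter> {p<..<q} = {}" if "(p, q) \<in> I" for p q
        using sub[OF that] by auto
      then have "{x<..<y} \<inter> (\<Union>(a, b)\<in>I. {a<..<b}) = {}" by blast
      then show "disjoint_family_on (\<lambda>(a, b). {a<..<b}) (insert (x, y) I)"
        using I notin by (simp add: packing_def disjoint_family_on_insert)
    qed
    then have "variation_sum f (insert (x, y) I) \<le> total_variation f {c..y}"
      by (rule variation_sum_le[OF f])
    then show ?thesis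
      using I notin by (simp add: variation_sum_def packing_def)
  qed
  then have "total_variation f {c..x} \<le> total_variation f {c..y} - norm (f y - f x)"
    unfolding total_variation_def[of f "{c..x}"] using packing_empty by (intro cSUP_least) auto
  then show ?thesis by simp
qed

lemma disjoint_family_length_le:
  fixes a b :: "'i \<Rightarrow> real"
  assumes "finite J" and ab: "\<And>j. j \<in> J \<Longrightarrow> a j \<le> b j \<and> {a j..b j} \<subseteq> {u..v}" and "u \<le> v"
    and dis: "disjoint_family_on (\<lambda>j. {a j<..<b j}) J"
  shows "(\<Sum>j\<in>J. b j - a j) \<le> v - u"
proof -
  have "(\<Sum>j\<in>J. b j - a j) = (\<Sum>j\<in>J. measure lborel {a j<..<b j})"
    using ab by (intro sum.cong) auto
  also have "\<dots> = measure lborel (\<Union>j\<in>J. {a j<..<b j})"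
    by (rule measure_finite_Union[symmetric]) (use assms in auto)
  also have "\<dots> \<le> measure lborel {u..v}"
  proof (rule measure_mono_fmeasurable)
    show "(\<Union>j\<in>J. {a j<..<b j}) \<subseteq> {u..v}"
      using ab by (fastforce dest: less_imp_le)
    show "{u..v} \<in> fmeasurable lborel"
      using \<open>u \<le> v\<close> by (intro fmeasurableI) auto
  qed (use \<open>finite J\<close> in auto)
  finally show ?thesis using \<open>u \<le> v\<close> by simp
qed

text \<open>For each \<open>(a, b)\<close> in a short family take a packing of \<open>{c..b}\<close>
  that nearly attains the variation \<open>V b\<close>, and cut its intervals at \<open>a\<close>.
  The parts left of \<open>a\<close> contribute at most \<open>V a\<close>, so the increment of
  \<open>V\<close> is nearly the variation of \<open>f\<close> over the parts right of
  \<open>a\<close>. All these right parts together form one disjoint family no longer than the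
  original one, and absolute continuity of \<open>f\<close> bounds its variation.\<close>

lemma abs_continuous_on_total_variation:
  assumes ac: "abs_continuous_on {c..d} f" and fin: "finite_variation f {c..d}"
  shows "abs_continuous_on {c..d} (\<lambda>x. of_real (total_variation f {c..x}))"
  unfolding abs_continuous_on_def
proof (intro allI impI)
  fix \<epsilon> :: real assume "0 < \<epsilon>"
  define V where "V x = total_variation f {c..x}" for x
  have finx: "finite_variation f {c..x}" if "x \<le> d" for x
    using fin by (rule finite_variation_subset) (use that in auto)
  obtain \<delta> where "0 < \<delta>" and \<delta>: "\<And>(J :: ((real \<times> real) \<times> (real \<times> real)) set) a b.
      \<lbrakk>finite J; \<And>j. j \<in> J \<Longrightarrow> a j \<le> b j \<and> {a j..b j} \<subseteq> {c..d};
       disjoint_family_on (\<lambda>j. {a j<..<b j}) J; (\<Sum>j\<in>J. b j - a j) < \<delta>\<rbrakk>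
      \<Longrightarrow> (\<Sum>j\<in>J. norm (f (b j) - f (a j))) < \<epsilon> / 2"
    using abs_continuous_onD[OF ac half_gt_zero[OF \<open>0 < \<epsilon>\<close>]] by blast
  have "(\<Sum>(a, b)\<in>I. norm (complex_of_real (V b) - of_real (V a))) < \<epsilon>"
    if I: "finite I" "\<forall>(a, b)\<in>I. a \<le> b \<and> {a..b} \<subseteq> {c..d}"
      "disjoint_family_on (\<lambda>(a, b). {a<..<b}) I" "(\<Sum>(a, b)\<in>I. b - a) < \<delta>" for I
  proof -
    have I2: "a \<le> b \<and> c \<le> a \<and> b \<le> d" if "(a, b) \<in> I" for a b
      using I(2) that by fastforce
    \<comment> \<open>One loss of \<eta> per member of \<open>I\<close> amounts to at most half of
      \<epsilon>; adding 1 covers the empty family.\<close>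
    define \<eta> where "\<eta> = \<epsilon> / (2 * (real (card I) + 1))"
    have "0 < \<eta>" using \<open>0 < \<epsilon>\<close> by (simp add: \<eta>_def)
    have "\<exists>Q. packing {c..b} Q \<and> V b - \<eta> < variation_sum f Q" if "b \<le> d" for b
    proof -
      have "V b - \<eta> < (SUP I \<in> Collect (packing {c..b}). variation_sum f I)"
        using \<open>0 < \<eta>\<close> by (simp add: V_def total_variation_def)
      then show ?thesis
        using finx[OF that] packing_empty unfolding finite_variation_def
        by (subst (asm) less_cSUP_iff) auto
    qed
    then obtain Q where Q: "\<And>b. b \<le> d \<Longrightarrow> packing {c..b} (Q b)" "\<And>b. b \<le> d \<Longrightarrow> V b - \<eta> < variation_sum f (Q b)"
      by metis
    \<comment> \<open>An index \<open>((a, b), (p, q))\<close> stands for the part of the interval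
      from \<open>p\<close> to \<open>q\<close> that lies right of \<open>a\<close>. That part is
      degenerate when \<open>q \<le> a\<close>.\<close>
    let ?l = "\<lambda>j :: (real \<times> real) \<times> (real \<times> real). max (fst (fst j)) (fst (snd j))"
    let ?r = "\<lambda>j :: (real \<times> real) \<times> (real \<times> real). max (fst (fst j)) (snd (snd j))"
    let ?J = "SIGMA i:I. Q (snd i)"
    have Qd: "finite (Q b)" "\<And>p q. (p, q) \<in> Q b \<Longrightarrow> c \<le> p \<and> p \<le> q \<and> q \<le> b"
      "disjoint_family_on (\<lambda>(p, q). {p<..<q}) (Q b)" if "b \<le> d" for b
    proof -
      have *: "p \<le> q \<and> {p..q} \<subseteq> {c..b}" if "(p, q) \<in> Q b" for p q
        using Q(1)[OF \<open>b \<le> d\<close>] that unfolding packing_iff by blast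
      then show "c \<le> p \<and> p \<le> q \<and> q \<le> b" if "(p, q) \<in> Q b" for p q
        using *[OF that] by auto
    qed (use Q(1)[OF that] in \<open>simp_all add: packing_def\<close>)
    \<comment> \<open>Cutting at \<open>a\<close> is expressed by \<open>min a\<close> and
      \<open>max a\<close>, so an interval lying on one side needs no separate bookkeeping: its
      other part is degenerate and costs 0.\<close>
    have step: "V b - V a \<le> \<eta> + (\<Sum>(p, q)\<in>Q b. norm (f (max a q) - f (max a p)))" if ab: "(a, b) \<in> I" for a b
    proof -
      have b: "b \<le> d" and a: "a \<le> d" "c \<le> a" "a \<le> b" using I2[OF ab] by auto
      have "variation_sum f (Q b) \<le> (\<Sum>(p, q)\<in>Q b. norm (f (min a q) - f (min a p)) + norm (f (max a q) - f (max a p)))"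
        unfolding variation_sum_def
      proof (rule sum_mono, clarify)
        fix p q assume "(p, q) \<in> Q b"
        then have "p \<le> q" using Qd(2)[OF b] by blast
        then consider "q \<le> a" | "p \<le> a" "a \<le> q" | "a \<le> p" by linarith
        then show "norm (f q - f p) \<le> norm (f (min a q) - f (min a p)) + norm (f (max a q) - f (max a p))"
        proof cases
          case 2
          have "norm (f q - f p) \<le> norm (f a - f p) + norm (f q - f a)"
            using norm_triangle_ineq[of "f a - f p" "f q - f a"] by simp
          then show ?thesis using 2 by (simp add: min_def max_def split: if_splits)
        qed (use \<open>p \<le> q\<close> in \<open>auto simp: min_def max_def\<close>)
      qed
      also have "\<dots> = (\<Sum>j\<in>Q b. norm (f (min a (snd j)) - f (min a (fst j)))) + (\<Sum>(p, q)\<in>Q b. norm (f (max a q) - f (max a p)))"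
        by (simp add: sum.distrib split_def)
      also have "(\<Sum>j\<in>Q b. norm (f (min a (snd j)) - f (min a (fst j)))) \<le> V a"
        unfolding V_def
      proof (rule variation_family_le[OF finx[OF a(1)] Qd(1)[OF b]])
        show "min a (fst j) \<le> min a (snd j) \<and> {min a (fst j)..min a (snd j)} \<subseteq> {c..a}" if "j \<in> Q b" for j
          using Qd(2)[OF b, of "fst j" "snd j"] that a(2) by auto
        show "disjoint_family_on (\<lambda>j. {min a (fst j)<..<min a (snd j)}) (Q b)"
          using Qd(3)[OF b] unfolding disjoint_family_on_def by fastforce
      qed
      finally show ?thesis using Q(2)[OF b] by simp
    qed
    have mono: "V a \<le> V b" if "(a, b) \<in> I" for a b
      using total_variation_step[of f c b a] I2[OF that] finx[of b] norm_ge_zero[of "f b - f a"]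
      unfolding V_def by linarith
    have "(\<Sum>(a, b)\<in>I. norm (complex_of_real (V b) - of_real (V a))) \<le>
        (\<Sum>(a, b)\<in>I. \<eta> + (\<Sum>(p, q)\<in>Q b. norm (f (max a q) - f (max a p))))"
    proof (rule sum_mono, clarify)
      fix a b assume "(a, b) \<in> I"
      then show "norm (complex_of_real (V b) - of_real (V a)) \<le> \<eta> + (\<Sum>(p, q)\<in>Q b. norm (f (max a q) - f (max a p)))"
        using step[of a b] mono[of a b] by (simp flip: of_real_diff)
    qed
    also have "\<dots> = card I * \<eta> + (\<Sum>i\<in>I. \<Sum>j\<in>Q (snd i). norm (f (?r (i, j)) - f (?l (i, j))))"
      by (simp add: sum.distrib split_def)
    also have "(\<Sum>i\<in>I. \<Sum>j\<in>Q (snd i). norm (f (?r (i, j)) - f (?l (i, j)))) = (\<Sum>j\<in>?J. norm (f (?r j) - f (?l j)))"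
      using I(1) I2 Qd(1) by (subst sum.Sigma) (auto simp: split_def)
    also have "\<dots> < \<epsilon> / 2"
    proof (rule \<delta>)
      show "finite ?J" using I(1) I2 Qd(1) by auto
      show "?l j \<le> ?r j \<and> {?l j..?r j} \<subseteq> {c..d}" if J: "j \<in> ?J" for j
      proof -
        obtain a b p q where j: "j = ((a, b), (p, q))" by (metis surj_pair)
        then show ?thesis using J I2[of a b] Qd(2)[of b p q] by auto
      qed
      have dis: "disjoint_family_on (\<lambda>j. {?l (i, j)<..<?r (i, j)}) (Q (snd i))" if "i \<in> I" for i
        unfolding disjoint_family_on_def
      proof (intro ballI impI)
        fix j j' assume j: "j \<in> Q (snd i)" "j' \<in> Q (snd i)" "j \<noteq> j'"
        have "snd i \<le> d" using I2[of "fst i" "snd i"] that by simp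
        then have "{fst j<..<snd j} \<inter> {fst j'<..<snd j'} = {}"
          using disjoint_family_onD[OF Qd(3) j] by (simp add: split_def)
        moreover have "{?l (i, j)<..<?r (i, j)} \<subseteq> {fst j<..<snd j}" for j
          by auto
        ultimately show "{?l (i, j)<..<?r (i, j)} \<inter> {?l (i, j')<..<?r (i, j')} = {}"
          by blast
      qed
      show "disjoint_family_on (\<lambda>j. {?l j<..<?r j}) ?J"
        unfolding disjoint_family_on_def
      proof (intro ballI impI)
        fix j j' assume J: "j \<in> ?J" "j' \<in> ?J" "j \<noteq> j'"
        obtain a b p q a' b' p' q' where j: "j = ((a, b), (p, q))" "j' = ((a', b'), (p', q'))"
          by (metis surj_pair)
        show "{?l j<..<?r j} \<inter> {?l j'<..<?r j'} = {}"
        proof (cases "(a, b) = (a', b')")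
          case True
          then show ?thesis
            using disjoint_family_onD[OF dis, of "(a, b)" "(p, q)" "(p', q')"] J j by simp
        next
          case False
          then have "{a<..<b} \<inter> {a'<..<b'} = {}"
            using disjoint_family_onD[OF I(3), of "(a, b)" "(a', b')"] J j by simp
          moreover have "{?l j<..<?r j} \<subseteq> {a<..<b}" "{?l j'<..<?r j'} \<subseteq> {a'<..<b'}"
            using J j Qd(2)[of b p q] Qd(2)[of b' p' q'] I2[of a b] I2[of a' b'] by auto
          ultimately show ?thesis by blast
        qed
      qed
      have "(\<Sum>j\<in>?J. ?r j - ?l j) = (\<Sum>i\<in>I. \<Sum>j\<in>Q (snd i). ?r (i, j) - ?l (i, j))"
        using I(1) I2 Qd(1) by (subst sum.Sigma) (auto simp: split_def)
      also have "\<dots> \<le> (\<Sum>i\<in>I. snd i - fst i)"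
      proof (rule sum_mono)
        fix i assume i: "i \<in> I"
        obtain a b where ab: "i = (a, b)" by fastforce
        show "(\<Sum>j\<in>Q (snd i). ?r (i, j) - ?l (i, j)) \<le> snd i - fst i"
        proof (rule disjoint_family_length_le)
          show "?l (i, j) \<le> ?r (i, j) \<and> {?l (i, j)..?r (i, j)} \<subseteq> {fst i..snd i}" if "j \<in> Q (snd i)" for j
            using that i ab I2[of a b] Qd(2)[of b "fst j" "snd j"] by (auto simp: split_def)
        qed (use dis[OF i] i ab I2[of a b] Qd(1) in auto)
      qed
      also have "\<dots> < \<delta>" using I(4) by (simp add: split_def)
      finally show "(\<Sum>j\<in>?J. ?r j - ?l j) < \<delta>" .
    qed
    also have "real (card I) * \<eta> \<le> \<epsilon> / 2"
      using \<open>0 < \<epsilon>\<close> by (simp add: \<eta>_def divide_simps)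
    finally show ?thesis by simp
  qed
  then show "\<exists>\<delta>>0. \<forall>I. finite I \<longrightarrow> (\<forall>(a, b)\<in>I. a \<le> b \<and> {a..b} \<subseteq> {c..d}) \<longrightarrow>
          disjoint_family_on (\<lambda>(a, b). {a<..<b}) I \<longrightarrow>
          (\<Sum>(a, b)\<in>I. b - a) < \<delta> \<longrightarrow>
          (\<Sum>(a, b)\<in>I. norm (complex_of_real (total_variation f {c..b}) - of_real (total_variation f {c..a}))) < \<epsilon>"
    using \<open>0 < \<delta>\<close> unfolding V_def by blast
qed

text \<open>For the tolerance 1 absolute continuity gives a \<delta>. A packing of an interval
  shorter than \<delta> has total length below \<delta>, hence variation at most 1. Short intervals
  suffice because differentiability is a local matter.\<close>

lemma abs_continuous_on_finite_variation:
  assumes "abs_continuous_on S f"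
  obtains \<delta> where "0 < \<delta>" "\<And>c d. \<lbrakk>c \<le> d; {c..d} \<subseteq> S; d - c < \<delta>\<rbrakk> \<Longrightarrow> finite_variation f {c..d}"
proof -
  obtain \<delta> where "0 < \<delta>" and \<delta>: "\<And>I. \<lbrakk>packing S I; (\<Sum>(a, b) \<in> I. b - a) < \<delta>\<rbrakk>
      \<Longrightarrow> (\<Sum>(a, b) \<in> I. norm (f b - f a)) < 1"
    using assms zero_less_one unfolding abs_continuous_on_def packing_def by meson
  show thesis
  proof
    fix c d assume cd: "c \<le> d" "{c..d} \<subseteq> S" "d - c < \<delta>"
    have "variation_sum f I \<le> 1" if I: "packing {c..d} I" for I
    proof -
      have "(\<Sum>j\<in>I. snd j - fst j) \<le> d - c"
        by (rule disjoint_family_length_le) (use I cd(1) in \<open>auto simp: packing_iff split_def\<close>)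
      then have "(\<Sum>(a, b)\<in>I. norm (f b - f a)) < 1"
        using \<delta>[OF packing_subset[OF I cd(2)]] cd(3) by (simp add: split_def)
      then show ?thesis by (simp add: variation_sum_def)
    qed
    then show "finite_variation f {c..d}"
      unfolding finite_variation_def by (intro bdd_aboveI2[of _ _ 1]) simp
  qed fact
qed

text \<open>Jordan decomposition: \<open>r\<close> is \<open>V\<close> minus the monotone function
  \<open>V - r\<close>, where \<open>V\<close> is its variation. Both are absolutely continuous and
  are clamped to become functions on the line; on the open interval the clamp is the identity, so
  derivatives at its points are unaffected.\<close>

lemma abs_continuous_finite_variation_differentiable:
  fixes r :: "real \<Rightarrow> real"
  assumes ac: "abs_continuous_on {c..d} (\<lambda>x. of_real (r x))" and "c \<le> d"
    and fin: "finite_variation (\<lambda>x. of_real (r x)) {c..d}"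
  shows "negligible {x \<in> {c<..<d}. \<not> r differentiable at x}"
proof -
  define V where "V x = total_variation (\<lambda>x. of_real (r x)) {c..x}" for x
  define k where "k x = max c (min d x)" for x
  have k: "c \<le> k x" "k x \<le> d" "x \<le> y \<Longrightarrow> k x \<le> k y" for x y
    using \<open>c \<le> d\<close> by (auto simp: k_def)
  have step: "V x + \<bar>r y - r x\<bar> \<le> V y" if "c \<le> x" "x \<le> y" "y \<le> d" for x y
    using total_variation_step[OF finite_variation_subset[OF fin, of "{c..y}"] that(1,2)] that
    by (simp add: V_def flip: of_real_diff)
  have mono: "mono (\<lambda>x. V (k x))" "mono (\<lambda>x. V (k x) - r (k x))"
  proof -
    have "V (k x) \<le> V (k y)" "V (k x) - r (k x) \<le> V (k y) - r (k y)" if "x \<le> y" for x y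
      using step[OF k(1) k(3)[OF that] k(2)] by (auto simp: abs_le_iff)
    then show "mono (\<lambda>x. V (k x))" "mono (\<lambda>x. V (k x) - r (k x))"
      by (auto intro: monoI)
  qed
  have acV: "abs_continuous_on {c..d} (\<lambda>x. of_real (V x))"
    unfolding V_def by (rule abs_continuous_on_total_variation[OF ac fin])
  have "abs_continuous_on UNIV (\<lambda>x. of_real (V (k x)))"
    unfolding k_def by (rule abs_continuous_on_clamp[OF acV \<open>c \<le> d\<close>])
  then have N1: "negligible {x. \<not> (\<lambda>x. V (k x)) differentiable at x}"
    by (rule mono_abs_continuous_differentiable[OF mono(1)])
  have "abs_continuous_on UNIV (\<lambda>x. of_real (V (k x) - r (k x)))"
    using abs_continuous_on_clamp[OF abs_continuous_on_diff[OF acV ac] \<open>c \<le> d\<close>]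
    by (simp add: k_def)
  then have N2: "negligible {x. \<not> (\<lambda>x. V (k x) - r (k x)) differentiable at x}"
    by (rule mono_abs_continuous_differentiable[OF mono(2)])
  have "r differentiable at x"
    if x: "x \<in> {c<..<d}" "(\<lambda>x. V (k x)) differentiable at x" "(\<lambda>x. V (k x) - r (k x)) differentiable at x" for x
  proof -
    have "(\<lambda>x. V (k x) - (V (k x) - r (k x))) differentiable at x"
      by (rule differentiable_diff[OF x(2,3)])
    then obtain D where "((\<lambda>x. V (k x) - (V (k x) - r (k x))) has_derivative D) (at x)"
      by (auto simp: differentiable_def)
    then have "(r has_derivative D) (at x)"
      by (rule has_derivative_transform_within_open[of _ _ _ _ "{c<..<d}"]) (use x in \<open>auto simp: k_def\<close>)
    then show ?thesis by (auto simp: differentiable_def)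
  qed
  then show ?thesis
    by (intro negligible_subset[OF negligible_Un[OF N1 N2]]) blast
qed

text \<open>Finite variation is available on short intervals only. This is enough, since a set is
  negligible as soon as each of its points has a negligible relative neighbourhood in it.\<close>

lemma abs_continuous_real_differentiable:
  fixes r :: "real \<Rightarrow> real"
  assumes ac: "abs_continuous_on S (\<lambda>x. of_real (r x))" and "open S"
  shows "negligible {x \<in> S. \<not> r differentiable at x}"
proof -
  obtain \<delta> where "0 < \<delta>" and
    \<delta>: "\<And>c d. \<lbrakk>c \<le> d; {c..d} \<subseteq> S; d - c < \<delta>\<rbrakk> \<Longrightarrow> finite_variation (\<lambda>x. of_real (r x)) {c..d}"
    using abs_continuous_on_finite_variation[OF ac] by blast
  show ?thesis
    unfolding locally_negligible_alt[of "{x \<in> S. \<not> r differentiable at x}"]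
  proof
    fix x assume x: "x \<in> {x \<in> S. \<not> r differentiable at x}"
    then obtain e where e: "0 < e" "cball x e \<subseteq> S"
      using \<open>open S\<close> by (auto simp: open_contains_cball)
    \<comment> \<open>The interval around \<open>x\<close> has length \<open>2 * h\<close>, at most
      two thirds of \<delta>.\<close>
    define h where "h = min e (\<delta> / 3)"
    have h: "0 < h" "{x - h..x + h} \<subseteq> S" "(x + h) - (x - h) < \<delta>"
    proof -
      have "{x - h..x + h} \<subseteq> {x - e..x + e}" by (simp add: h_def)
      then show "{x - h..x + h} \<subseteq> S" using e(2) unfolding cball_eq_atLeastAtMost by (rule subset_trans)
    qed (use e \<open>0 < \<delta>\<close> in \<open>auto simp: h_def\<close>)
    have "negligible {y \<in> {x - h<..<x + h}. \<not> r differentiable at y}"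
      by (rule abs_continuous_finite_variation_differentiable[OF abs_continuous_on_subset[OF ac h(2)]])
        (use \<delta>[of "x - h" "x + h"] h in auto)
    moreover have "openin (top_of_set {x \<in> S. \<not> r differentiable at x})
        ({x \<in> S. \<not> r differentiable at x} \<inter> {x - h<..<x + h})"
      by (intro openin_open_Int) simp
    ultimately show "\<exists>U. openin (top_of_set {x \<in> S. \<not> r differentiable at x}) U \<and> x \<in> U \<and> negligible U"
      using x h(1)
      by (intro exI[of _ "{x \<in> S. \<not> r differentiable at x} \<inter> {x - h<..<x + h}"])
        (auto elim: negligible_subset)
  qed
qed

text \<open>This makes the \<open>vector_derivative\<close> of a solution \<open>u\<close> a genuine
  derivative at almost every point.\<close>

theorem abs_continuous_on_differentiable:
  assumes ac: "abs_continuous_on S f" and "open S"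
  shows "negligible {x \<in> S. \<not> f differentiable at x}"
proof -
  have "f differentiable at x"
    if "(\<lambda>x. Re (f x)) differentiable at x" "(\<lambda>x. Im (f x)) differentiable at x" for x
  proof -
    obtain D E where "((\<lambda>x. Re (f x)) has_derivative D) (at x)" "((\<lambda>x. Im (f x)) has_derivative E) (at x)"
      using \<open>(\<lambda>x. Re (f x)) differentiable at x\<close> \<open>(\<lambda>x. Im (f x)) differentiable at x\<close>
      unfolding differentiable_def by blast
    then have "((\<lambda>x. of_real (Re (f x)) + \<i> * of_real (Im (f x))) has_derivative
        (\<lambda>t. of_real (D t) + \<i> * of_real (E t))) (at x)"
      by (intro has_derivative_add has_derivative_mult_right has_derivative_of_real)
    then show ?thesis by (auto simp: differentiable_def simp flip: complex_eq)
  qed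
  then show ?thesis
    by (intro negligible_subset[OF negligible_Un[OF
          abs_continuous_real_differentiable[OF abs_continuous_on_Re[OF ac] \<open>open S\<close>]
          abs_continuous_real_differentiable[OF abs_continuous_on_Im[OF ac] \<open>open S\<close>]]]) blast
qed

section \<open>A linear system with bounded measurable coefficients\<close>

text \<open>Compare \<open>e\<close> with the weight \<open>E t = exp (2 * M * (t - a))\<close> at
  the point \<open>s\<close> where \<open>e / E\<close> attains its maximum \<open>m\<close>.
  Because of the factor 2 in the exponent, the integral term is at most
  \<open>m * (E s - 1) / 2\<close>, which \<open>m * E s\<close> absorbs. This leaves
  \<open>m \<le> 2 * \<alpha>\<close> when \<open>m\<close> is positive.\<close>

lemma gronwall_exp:
  fixes e :: "real \<Rightarrow> real"
  assumes cont: "continuous_on {a..b} e" and "0 < M" "0 \<le> \<alpha>"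
    and le: "\<And>x. x \<in> {a..b} \<Longrightarrow> e x \<le> \<alpha> + M * integral {a..x} e"
    and x: "x \<in> {a..b}"
  shows "e x \<le> 2 * \<alpha> * exp (2 * M * (x - a))"
proof -
  define E where "E t = exp (2 * M * (t - a))" for t
  have E: "0 < E t" "t \<ge> a \<Longrightarrow> 1 \<le> E t" for t
    using \<open>0 < M\<close> by (auto simp: E_def)
  have contE: "continuous_on {a..b} (\<lambda>t. e t / E t)"
    using E(1) unfolding E_def by (intro continuous_intros cont) auto
  obtain s where s: "s \<in> {a..b}" "\<And>t. t \<in> {a..b} \<Longrightarrow> e t / E t \<le> e s / E s"
    using continuous_attains_sup[OF _ _ contE] x by auto
  define m where "m = e s / E s"
  have m: "e t \<le> m * E t" if "t \<in> {a..b}" for t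
    using s(2)[OF that] E(1)[of t] by (simp add: m_def pos_divide_le_eq)
  show ?thesis
  proof (cases "m \<le> 0")
    case True
    then have "e x \<le> 0" using m[OF x] E(1)[of x] by (smt (verit) mult_nonpos_nonneg)
    then show ?thesis using \<open>0 \<le> \<alpha>\<close> by (smt (verit) exp_gt_zero mult_nonneg_nonneg)
  next
    case False
    have intE: "(E has_integral ((E s - 1) / (2 * M))) {a..s}"
    proof -
      have "(E has_integral (E s / (2 * M) - E a / (2 * M))) {a..s}"
      proof (rule fundamental_theorem_of_calculus)
        show "((\<lambda>t. E t / (2 * M)) has_vector_derivative E t) (at t within {a..s})" for t
          unfolding E_def using \<open>0 < M\<close>
          by (auto intro!: derivative_eq_intros simp: has_real_derivative_iff_has_vector_derivative[symmetric])
      qed (use s(1) in auto)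
      then show ?thesis by (simp add: E_def diff_divide_distrib)
    qed
    have "integral {a..s} e \<le> integral {a..s} (\<lambda>t. m * E t)"
    proof (rule integral_le)
      show "e integrable_on {a..s}"
        using s(1) by (intro integrable_continuous_real continuous_on_subset[OF cont]) auto
      show "(\<lambda>t. m * E t) integrable_on {a..s}"
        using has_integral_mult_right[OF intE] by blast
    qed (use m s(1) in auto)
    also have "\<dots> = m * ((E s - 1) / (2 * M))"
      by (rule integral_unique[OF has_integral_mult_right[OF intE]])
    finally have "M * integral {a..s} e \<le> m * (E s - 1) / 2"
      using \<open>0 < M\<close> by (simp add: field_simps)
    then have "e s \<le> \<alpha> + m * (E s - 1) / 2" using le[OF s(1)] by linarith
    moreover have "e s = m * E s" using E(1)[of s] by (simp add: m_def)
    ultimately have "m * (E s + 1) \<le> 2 * \<alpha>" by (simp add: field_simps)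
    moreover have "m * 1 \<le> m * (E s + 1)" using False E(1)[of s] by (intro mult_left_mono) auto
    ultimately have "m \<le> 2 * \<alpha>" by linarith
    then have "m * E x \<le> 2 * \<alpha> * E x" using E(1)[of x] by (intro mult_right_mono) auto
    with m[OF x] have "e x \<le> 2 * \<alpha> * E x" by (rule order_trans)
    then show ?thesis by (simp add: E_def)
  qed
qed

text \<open>Measured against the weight \<open>exp (2 * M * (t - a))\<close>, each iteration halves
  the distance between successive iterates. Hence they converge uniformly on the whole interval at
  once, with no gluing of short ones. Dependence on \<open>t\<close> enters only through
  integrability along continuous functions, which admits measurable coefficients.\<close>

lemma picard_existence:
  fixes A :: "real \<Rightarrow> 'b::euclidean_space \<Rightarrow> 'b"
  assumes "a \<le> b" "0 < M"
    and lip: "\<And>t u v. t \<in> {a..b} \<Longrightarrow> norm (A t u - A t v) \<le> M * norm (u - v)"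
    and int: "\<And>v. continuous_on {a..b} v \<Longrightarrow> (\<lambda>t. A t (v t)) integrable_on {a..b}"
  obtains v where "continuous_on {a..b} v" "v a = v0"
    "\<And>x. x \<in> {a..b} \<Longrightarrow> ((\<lambda>t. A t (v t)) has_integral (v x - v a)) {a..x}"
proof -
  define P where "P v x = v0 + integral {a..x} (\<lambda>t. A t (v t))" for v x
  define v where "v n = (P ^^ n) (\<lambda>_. v0)" for n
  have v: "v 0 = (\<lambda>_. v0)" "v (Suc n) = P (v n)" for n
    by (simp_all add: v_def)
  have contP: "continuous_on {a..b} (P w)" if "continuous_on {a..b} w" for w
    unfolding P_def by (intro continuous_intros indefinite_integral_continuous_1 int that)
  have cont: "continuous_on {a..b} (v n)" for n
    by (induction n) (auto simp: v contP)
  have intx: "(\<lambda>t. A t (w t)) integrable_on {a..x}" if "continuous_on {a..b} w" "x \<in> {a..b}" for w x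
    using int[OF that(1)] by (rule integrable_on_subinterval) (use that in auto)
  have diff: "norm (P w x - P w' x) \<le> integral {a..x} h"
    if "continuous_on {a..b} w" "continuous_on {a..b} w'" "x \<in> {a..b}" "h integrable_on {a..x}"
      "\<And>t. t \<in> {a..b} \<Longrightarrow> M * norm (w t - w' t) \<le> h t" for w w' x h
  proof -
    have "P w x - P w' x = integral {a..x} (\<lambda>t. A t (w t) - A t (w' t))"
      using integral_diff[OF intx[OF that(1,3)] intx[OF that(2,3)]] by (simp add: P_def)
    also have "norm \<dots> \<le> integral {a..x} h"
    proof (rule integral_norm_bound_integral)
      show "(\<lambda>t. A t (w t) - A t (w' t)) integrable_on {a..x}"
        by (intro integrable_diff intx that)
      show "norm (A t (w t) - A t (w' t)) \<le> h t" if "t \<in> {a..x}" for t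
        using lip[of t "w t" "w' t"] \<open>x \<in> {a..b}\<close> that \<open>\<And>t. t \<in> {a..b} \<Longrightarrow> M * norm (w t - w' t) \<le> h t\<close>
        by (meson atLeastAtMost_iff order_trans)
    qed fact
    finally show ?thesis .
  qed
  define E where "E t = exp (2 * M * (t - a))" for t
  have intE: "(E has_integral ((E x - 1) / (2 * M))) {a..x}" if "x \<in> {a..b}" for x
  proof -
    have "(E has_integral (E x / (2 * M) - E a / (2 * M))) {a..x}"
    proof (rule fundamental_theorem_of_calculus)
      show "((\<lambda>t. E t / (2 * M)) has_vector_derivative E t) (at t within {a..x})" for t
        unfolding E_def using \<open>0 < M\<close>
        by (auto intro!: derivative_eq_intros simp: has_real_derivative_iff_has_vector_derivative[symmetric])
    qed (use that in auto)
    then show ?thesis by (simp add: E_def diff_divide_distrib)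
  qed
  have "bounded ((\<lambda>x. v 1 x - v 0 x) ` {a..b})"
    by (intro compact_imp_bounded compact_continuous_image continuous_intros cont compact_Icc)
  then obtain C where "0 < C" and C: "\<And>x. x \<in> {a..b} \<Longrightarrow> norm (v 1 x - v 0 x) \<le> C"
    by (auto simp: bounded_pos)
  have step: "norm (v (Suc n) x - v n x) \<le> C * E x / 2 ^ n" if "x \<in> {a..b}" for n x
    using that
  proof (induction n arbitrary: x)
    case 0
    have "1 \<le> E x" using 0 \<open>0 < M\<close> by (simp add: E_def)
    then have "C * 1 \<le> C * E x" using \<open>0 < C\<close> by (intro mult_left_mono) auto
    then show ?case using C[OF 0] by simp
  next
    case (Suc n)
    have 1: "((\<lambda>t. M * (C / 2 ^ n) * E t) has_integral (M * (C / 2 ^ n) * ((E x - 1) / (2 * M)))) {a..x}"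
      by (rule has_integral_mult_right[OF intE[OF Suc.prems]])
    have "norm (P (v (Suc n)) x - P (v n) x) \<le> integral {a..x} (\<lambda>t. M * (C / 2 ^ n) * E t)"
    proof (rule diff[OF cont cont Suc.prems])
      show "M * norm (v (Suc n) t - v n t) \<le> M * (C / 2 ^ n) * E t" if "t \<in> {a..b}" for t
        using mult_left_mono[OF Suc.IH[OF that], of M] \<open>0 < M\<close> by simp
    qed (use 1 in blast)
    also have "\<dots> = M * (C / 2 ^ n) * ((E x - 1) / (2 * M))"
      by (rule integral_unique[OF 1])
    also have "\<dots> \<le> C * E x / 2 ^ Suc n"
      using \<open>0 < M\<close> \<open>0 < C\<close> by (simp add: field_simps)
    finally show ?case by (simp add: v)
  qed
  have "uniform_limit {a..b} (\<lambda>n x. \<Sum>i<n. v (Suc i) x - v i x) (\<lambda>x. \<Sum>i. v (Suc i) x - v i x) sequentially"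
  proof (rule Weierstrass_m_test)
    fix n x assume "x \<in> {a..b}"
    moreover have "E x \<le> E b" using calculation \<open>0 < M\<close> by (simp add: E_def)
    then have "C * E x / 2 ^ n \<le> C * E b / 2 ^ n"
      using \<open>0 < C\<close> by (intro divide_right_mono mult_left_mono) auto
    ultimately show "norm (v (Suc n) x - v n x) \<le> C * E b * (1 / 2) ^ n"
      using step[of x n] by (simp add: power_divide)
  next
    show "summable (\<lambda>n. C * E b * (1 / 2) ^ n)"
      by (intro summable_mult summable_geometric) simp
  qed
  moreover have "(\<Sum>i<n. v (Suc i) x - v i x) = v n x - v 0 x" for n x
    by (rule sum_lessThan_telescope[of "\<lambda>i. v i x"])
  ultimately obtain l where ul: "uniform_limit {a..b} (\<lambda>n x. v n x - v 0 x) l sequentially"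
    by (simp only:)
  define w where "w x = v 0 x + l x" for x
  have "uniform_limit {a..b} (\<lambda>n x. v 0 x + (v n x - v 0 x)) (\<lambda>x. v 0 x + l x) sequentially"
    by (intro uniform_limit_intros ul)
  moreover have "w = (\<lambda>x. v 0 x + l x)" by (simp add: w_def fun_eq_iff)
  ultimately have lim: "uniform_limit {a..b} v w sequentially" by simp
  have contw: "continuous_on {a..b} w"
    using cont by (intro uniform_limit_theorem[OF _ lim]) auto
  have fixp: "w x = P w x" if x: "x \<in> {a..b}" for x
  proof -
    have "(\<lambda>n. P (v n) x) \<longlonglongrightarrow> P w x"
    proof (rule tendstoI)
      fix \<epsilon> :: real assume "0 < \<epsilon>"
      \<comment> \<open>Chosen so that \<open>M * \<eta> * (b - a + 1) = \<epsilon> / 2\<close>; the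
        added 1 keeps the divisor positive when \<open>a = b\<close>.\<close>
      define \<eta> where "\<eta> = \<epsilon> / (2 * M * (b - a + 1))"
      have "0 < \<eta>" using \<open>0 < \<epsilon>\<close> \<open>0 < M\<close> \<open>a \<le> b\<close> by (simp add: \<eta>_def)
      have "\<forall>\<^sub>F n in sequentially. \<forall>t\<in>{a..b}. dist (v n t) (w t) < \<eta>"
        using uniform_limitD[OF lim \<open>0 < \<eta>\<close>] .
      then show "\<forall>\<^sub>F n in sequentially. dist (P (v n) x) (P w x) < \<epsilon>"
      proof eventually_elim
        case (elim n)
        have "norm (P (v n) x - P w x) \<le> integral {a..x} (\<lambda>_. M * \<eta>)"
        proof (rule diff[OF cont contw x])
          show "M * norm (v n t - w t) \<le> M * \<eta>" if "t \<in> {a..b}" for t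
            using elim that \<open>0 < M\<close> by (auto simp: dist_norm intro: less_imp_le)
        qed auto
        also have "\<dots> = M * \<eta> * (x - a)" using x by simp
        also have "\<dots> \<le> M * \<eta> * (b - a + 1)"
          using x \<open>0 < M\<close> \<open>0 < \<eta>\<close> by (intro mult_left_mono) auto
        also have "\<dots> = \<epsilon> / 2"
        proof -
          have "b - a + 1 > 0" using \<open>a \<le> b\<close> by simp
          then show ?thesis using \<open>0 < M\<close> unfolding \<eta>_def by (simp add: divide_simps)
        qed
        also have "\<dots> < \<epsilon>" using \<open>0 < \<epsilon>\<close> by simp
        finally show ?case by (simp add: dist_norm)
      qed
    qed
    moreover have "(\<lambda>n. v (Suc n) x) \<longlonglongrightarrow> w x"
      using tendsto_uniform_limitI[OF lim x] by (rule LIMSEQ_Suc)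
    ultimately show ?thesis by (simp add: v LIMSEQ_unique)
  qed
  show thesis
  proof
    have wa: "w a = v0" using fixp[of a] \<open>a \<le> b\<close> by (simp add: P_def)
    then show "w a = v0" .
    show "((\<lambda>t. A t (w t)) has_integral (w x - w a)) {a..x}" if "x \<in> {a..b}" for x
      using integrable_integral[OF intx[OF contw that]] fixp[OF that] wa by (simp add: P_def)
  qed (rule contw)
qed

text \<open>The Caratheodory form of y' = p z, z' = - q y, meaningful for bounded measurable
  coefficients and including both end points. The general value type serves the real fundamental
  solutions and the complex solutions alike.\<close>

definition ode_sol ::
    "real \<Rightarrow> real \<Rightarrow> (real \<Rightarrow> real) \<Rightarrow> (real \<Rightarrow> real) \<Rightarrow> (real \<Rightarrow> 'a::euclidean_space) \<Rightarrow> (real \<Rightarrow> 'a) \<Rightarrow> bool" where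
  "ode_sol a b p q y z \<longleftrightarrow> continuous_on {a..b} y \<and> continuous_on {a..b} z \<and>
     (\<forall>x\<in>{a..b}. ((\<lambda>t. p t *\<^sub>R z t) has_integral (y x - y a)) {a..x} \<and>
                 ((\<lambda>t. - (q t *\<^sub>R y t)) has_integral (z x - z a)) {a..x})"

lemma ode_sol_exists:
  fixes p q :: "real \<Rightarrow> real" and y0 z0 :: "'a::euclidean_space"
  assumes "a \<le> b" and p: "p \<in> borel_measurable lebesgue" and q: "q \<in> borel_measurable lebesgue"
    and M: "\<And>t. t \<in> {a..b} \<Longrightarrow> \<bar>p t\<bar> \<le> M \<and> \<bar>q t\<bar> \<le> M"
  obtains y z where "ode_sol a b p q y z" "y a = y0" "z a = z0"
proof -
  define A where "A t v = (p t *\<^sub>R snd v, - (q t *\<^sub>R fst v))" for t and v :: "'a \<times> 'a"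
  \<comment> \<open>Picard iteration asks for a positive Lipschitz constant. The norm of a pair is
    Euclidean, so the bound below is proved for squares.\<close>
  define L where "L = \<bar>M\<bar> + 1"
  have "0 < L" by (simp add: L_def)
  have bound: "norm (A t v) \<le> L * norm v" if t: "t \<in> {a..b}" for t v
  proof -
    have pq: "(p t)\<^sup>2 \<le> L\<^sup>2" "(q t)\<^sup>2 \<le> L\<^sup>2"
      using M[OF t] by (auto simp: L_def intro!: abs_le_square_iff[THEN iffD1])
    have "(norm (A t v))\<^sup>2 = (p t)\<^sup>2 * (norm (snd v))\<^sup>2 + (q t)\<^sup>2 * (norm (fst v))\<^sup>2"
      by (simp add: A_def norm_Pair power_mult_distrib)
    also have "\<dots> \<le> L\<^sup>2 * (norm (snd v))\<^sup>2 + L\<^sup>2 * (norm (fst v))\<^sup>2"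
      using pq by (intro add_mono mult_right_mono) auto
    also have "\<dots> = (L * norm v)\<^sup>2"
      by (cases v) (simp add: norm_Pair power_mult_distrib algebra_simps)
    finally show ?thesis
      by (rule power2_le_imp_le) (use \<open>0 < L\<close> in simp)
  qed
  have lip: "norm (A t u - A t v) \<le> L * norm (u - v)" if "t \<in> {a..b}" for t u v
    using bound[OF that, of "u - v"] by (simp add: A_def scaleR_diff_right)
  have int: "(\<lambda>t. A t (v t)) integrable_on {a..b}" if v: "continuous_on {a..b} v" for v
  proof (rule measurable_bounded_by_integrable_imp_integrable)
    have [measurable]: "v \<in> borel_measurable (lebesgue_on {a..b})"
      using v by (intro continuous_imp_measurable_on_sets_lebesgue) auto
    have [measurable]: "(\<lambda>t. fst (v t)) \<in> borel_measurable (lebesgue_on {a..b})"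
      "(\<lambda>t. snd (v t)) \<in> borel_measurable (lebesgue_on {a..b})"
      using v by (auto intro!: continuous_imp_measurable_on_sets_lebesgue continuous_intros)
    have [measurable]: "p \<in> borel_measurable (lebesgue_on {a..b})" "q \<in> borel_measurable (lebesgue_on {a..b})"
      using p q by (auto intro: measurable_restrict_space1)
    show "(\<lambda>t. A t (v t)) \<in> borel_measurable (lebesgue_on {a..b})"
      unfolding A_def by measurable
    show "(\<lambda>t. L * norm (v t)) integrable_on {a..b}"
      using v by (intro integrable_continuous_real continuous_intros)
  qed (use bound in auto)
  obtain v where v: "continuous_on {a..b} v" "v a = (y0, z0)"
    "\<And>x. x \<in> {a..b} \<Longrightarrow> ((\<lambda>t. A t (v t)) has_integral (v x - v a)) {a..x}"
    using picard_existence[OF \<open>a \<le> b\<close> \<open>0 < L\<close> lip int, of "(y0, z0)"] by blast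
  have "ode_sol a b p q (\<lambda>t. fst (v t)) (\<lambda>t. snd (v t))"
    unfolding ode_sol_def
  proof (intro conjI ballI)
    fix x assume x: "x \<in> {a..b}"
    show "((\<lambda>t. p t *\<^sub>R snd (v t)) has_integral (fst (v x) - fst (v a))) {a..x}"
      using has_integral_linear[OF v(3)[OF x] bounded_linear_fst] by (simp add: o_def A_def)
    show "((\<lambda>t. - (q t *\<^sub>R fst (v t))) has_integral (snd (v x) - snd (v a))) {a..x}"
      using has_integral_linear[OF v(3)[OF x] bounded_linear_snd] by (simp add: o_def A_def)
  qed (intro continuous_intros v(1))+
  then show thesis using that v(2) by simp
qed

text \<open>The splitting \<open>p' z' - p z = p' (z' - z) + (p' - p) z\<close> needs a bound only
  for the primed coefficients and for the unprimed solution, so one \<open>C\<close> serves a whole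
  sequence of perturbations. The factor 4 is 2 for the two equations times 2 from the Gronwall
  bound.\<close>

lemma ode_sol_perturb:
  fixes y z y' z' :: "real \<Rightarrow> 'a::euclidean_space"
  assumes s: "ode_sol a b p q y z" and s': "ode_sol a b p' q' y' z'"
    and init: "y' a = y a" "z' a = z a" and "0 < M" "0 \<le> \<eta>" "0 \<le> C"
    and M: "\<And>t. t \<in> {a..b} \<Longrightarrow> \<bar>p' t\<bar> \<le> M \<and> \<bar>q' t\<bar> \<le> M"
    and \<eta>: "\<And>t. t \<in> {a..b} \<Longrightarrow> \<bar>p' t - p t\<bar> \<le> \<eta> \<and> \<bar>q' t - q t\<bar> \<le> \<eta>"
    and C: "\<And>t. t \<in> {a..b} \<Longrightarrow> norm (y t) \<le> C \<and> norm (z t) \<le> C"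
    and x: "x \<in> {a..b}"
  shows "norm (y' x - y x) + norm (z' x - z x) \<le> 4 * \<eta> * C * (b - a) * exp (2 * M * (x - a))"
proof -
  define e where "e t = norm (y' t - y t) + norm (z' t - z t)" for t
  have ab: "a \<le> b" using x by simp
  have cont: "continuous_on {a..b} y" "continuous_on {a..b} z" "continuous_on {a..b} y'" "continuous_on {a..b} z'"
    using s s' by (simp_all add: ode_sol_def)
  have conte: "continuous_on {a..b} e"
    unfolding e_def by (intro continuous_intros cont)
  have scale: "norm (r' *\<^sub>R u' - r *\<^sub>R u) \<le> M * norm (u' - u) + \<eta> * C"
    if "\<bar>r'\<bar> \<le> M" "\<bar>r' - r\<bar> \<le> \<eta>" "norm u \<le> C" for r r' and u u' :: 'a
  proof -
    have "r' *\<^sub>R u' - r *\<^sub>R u = r' *\<^sub>R (u' - u) + (r' - r) *\<^sub>R u"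
      by (simp add: algebra_simps)
    then have "norm (r' *\<^sub>R u' - r *\<^sub>R u) \<le> \<bar>r'\<bar> * norm (u' - u) + \<bar>r' - r\<bar> * norm u"
      by (metis norm_scaleR norm_triangle_ineq)
    also have "\<dots> \<le> M * norm (u' - u) + \<eta> * C"
      using that by (intro add_mono mult_mono) auto
    finally show ?thesis .
  qed
  have "e t \<le> 2 * \<eta> * C * (b - a) + M * integral {a..t} e" if t: "t \<in> {a..b}" for t
  proof -
    have sub: "{a..t} \<subseteq> {a..b}" using t by auto
    have i: "((\<lambda>s. p' s *\<^sub>R z' s) has_integral (y' t - y' a)) {a..t}"
        "((\<lambda>s. - (q' s *\<^sub>R y' s)) has_integral (z' t - z' a)) {a..t}"
        "((\<lambda>s. p s *\<^sub>R z s) has_integral (y t - y a)) {a..t}"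
        "((\<lambda>s. - (q s *\<^sub>R y s)) has_integral (z t - z a)) {a..t}"
      using s s' t by (simp_all add: ode_sol_def)
    have i1: "((\<lambda>s. p' s *\<^sub>R z' s - p s *\<^sub>R z s) has_integral (y' t - y t)) {a..t}"
      using has_integral_diff[OF i(1,3)] init by simp
    have i2: "((\<lambda>s. - (q' s *\<^sub>R y' s) - - (q s *\<^sub>R y s)) has_integral (z' t - z t)) {a..t}"
      using has_integral_diff[OF i(2,4)] init by simp
    have h: "(\<lambda>s. M * norm (f s) + \<eta> * C) integrable_on {a..t}" if "continuous_on {a..b} f" for f :: "real \<Rightarrow> 'a"
      using continuous_on_subset[OF that sub] by (intro integrable_continuous_real continuous_intros)
    have "norm (y' t - y t) \<le> integral {a..t} (\<lambda>s. M * norm (z' s - z s) + \<eta> * C)"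
      using M \<eta> C sub
      by (subst integral_unique[OF i1, symmetric])
        (intro integral_norm_bound_integral has_integral_integrable[OF i1] h continuous_intros cont scale, auto)
    moreover have "norm (z' t - z t) \<le> integral {a..t} (\<lambda>s. M * norm (y' s - y s) + \<eta> * C)"
    proof (subst integral_unique[OF i2, symmetric], rule integral_norm_bound_integral)
      show "norm (- (q' s *\<^sub>R y' s) - - (q s *\<^sub>R y s)) \<le> M * norm (y' s - y s) + \<eta> * C" if "s \<in> {a..t}" for s
        using scale[of "q' s" "q s" "y s" "y' s"] M[of s] \<eta>[of s] C[of s] sub that
        by (simp add: norm_minus_commute subset_iff)
    qed (intro has_integral_integrable[OF i2] h continuous_intros cont)+
    ultimately have "e t \<le> integral {a..t} (\<lambda>s. M * norm (z' s - z s) + \<eta> * C) + integral {a..t} (\<lambda>s. M * norm (y' s - y s) + \<eta> * C)"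
      by (simp add: e_def)
    also have "\<dots> = integral {a..t} (\<lambda>s. (M * norm (z' s - z s) + \<eta> * C) + (M * norm (y' s - y s) + \<eta> * C))"
      by (intro integral_add[symmetric] h continuous_intros cont)
    also have "\<dots> = integral {a..t} (\<lambda>s. M * e s + 2 * \<eta> * C)"
      by (rule arg_cong[where f = "integral {a..t}"]) (auto simp: e_def algebra_simps)
    also have "\<dots> = M * integral {a..t} e + 2 * \<eta> * C * (t - a)"
    proof -
      have "(\<lambda>s. M * e s) integrable_on {a..t}"
        by (intro integrable_continuous_real continuous_intros continuous_on_subset[OF conte sub])
      then show ?thesis using t by (subst integral_add) (auto simp: algebra_simps)
    qed
    also have "\<dots> \<le> M * integral {a..t} e + 2 * \<eta> * C * (b - a)"
      using t \<open>0 \<le> \<eta>\<close> \<open>0 \<le> C\<close> by (intro add_left_mono mult_left_mono) auto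
    finally show ?thesis by simp
  qed
  then have "e x \<le> 2 * (2 * \<eta> * C * (b - a)) * exp (2 * M * (x - a))"
    using gronwall_exp[OF conte \<open>0 < M\<close>, of "2 * \<eta> * C * (b - a)"] x ab \<open>0 \<le> \<eta>\<close> \<open>0 \<le> C\<close> by simp
  then show ?thesis by (simp add: e_def)
qed

lemma ode_sol_bounded:
  assumes "ode_sol a b p q y z"
  obtains C where "0 < C" "\<And>t. t \<in> {a..b} \<Longrightarrow> norm (y t) \<le> C \<and> norm (z t) \<le> C"
proof -
  have "bounded (y ` {a..b})" "bounded (z ` {a..b})"
    using assms by (auto simp: ode_sol_def intro: compact_imp_bounded compact_continuous_image)
  then have "bounded (y ` {a..b} \<union> z ` {a..b})" by simp
  then show thesis using that by (force simp: bounded_pos)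
qed

lemma ode_sol_unique:
  fixes y z y' z' :: "real \<Rightarrow> 'a::euclidean_space"
  assumes s: "ode_sol a b p q y z" and s': "ode_sol a b p q y' z'"
    and init: "y' a = y a" "z' a = z a"
    and M: "\<And>t. t \<in> {a..b} \<Longrightarrow> \<bar>p t\<bar> \<le> M \<and> \<bar>q t\<bar> \<le> M"
    and x: "x \<in> {a..b}"
  shows "y' x = y x" "z' x = z x"
proof -
  obtain C where C: "0 < C" "\<And>t. t \<in> {a..b} \<Longrightarrow> norm (y t) \<le> C \<and> norm (z t) \<le> C"
    using ode_sol_bounded[OF s] by blast
  \<comment> \<open>Uniqueness is the perturbation estimate with \<eta> = 0.\<close>
  have "norm (y' x - y x) + norm (z' x - z x) \<le> 4 * 0 * C * (b - a) * exp (2 * (\<bar>M\<bar> + 1) * (x - a))"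
    by (rule ode_sol_perturb[OF s s' init]) (use C M x in force)+
  then have "norm (y' x - y x) + norm (z' x - z x) \<le> 0" by simp
  then show "y' x = y x" "z' x = z x"
    by (smt (verit) norm_ge_zero norm_le_zero_iff right_minus_eq)+
qed

section \<open>Essential one-sided limits\<close>

lemma eventually_ess_at_right:
  "eventually P (ess_at_right x) \<longleftrightarrow> (\<exists>b>x. AE y in lebesgue. x < y \<and> y < b \<longrightarrow> P y)"
proof
  assume "eventually P (ess_at_right x)"
  then obtain Q R where Q: "eventually Q (at_right x)" "AE y in lebesgue. R y" "\<And>y. Q y \<Longrightarrow> R y \<Longrightarrow> P y"
    by (auto simp: ess_at_right_def eventually_inf)
  then obtain b where "b > x" "\<And>y. x < y \<Longrightarrow> y < b \<Longrightarrow> Q y"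
    by (auto simp: eventually_at_right_field)
  then show "\<exists>b>x. AE y in lebesgue. x < y \<and> y < b \<longrightarrow> P y"
    using Q(2,3) by (intro exI[of _ b]) (auto elim: eventually_mono)
next
  assume "\<exists>b>x. AE y in lebesgue. x < y \<and> y < b \<longrightarrow> P y"
  then obtain b where "b > x" "AE y in lebesgue. x < y \<and> y < b \<longrightarrow> P y" by blast
  moreover have "\<forall>\<^sub>F y in at_right x. x < y \<and> y < b"
    using \<open>b > x\<close> by (auto simp: eventually_at_right_field)
  ultimately show "eventually P (ess_at_right x)"
    unfolding ess_at_right_def eventually_inf by blast
qed

lemma eventually_ess_at_left:
  "eventually P (ess_at_left x) \<longleftrightarrow> (\<exists>b<x. AE y in lebesgue. b < y \<and> y < x \<longrightarrow> P y)"
proof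
  assume "eventually P (ess_at_left x)"
  then obtain Q R where Q: "eventually Q (at_left x)" "AE y in lebesgue. R y" "\<And>y. Q y \<Longrightarrow> R y \<Longrightarrow> P y"
    by (auto simp: ess_at_left_def eventually_inf)
  then obtain b where "b < x" "\<And>y. b < y \<Longrightarrow> y < x \<Longrightarrow> Q y"
    by (auto simp: eventually_at_left_field)
  then show "\<exists>b<x. AE y in lebesgue. b < y \<and> y < x \<longrightarrow> P y"
    using Q(2,3) by (intro exI[of _ b]) (auto elim: eventually_mono)
next
  assume "\<exists>b<x. AE y in lebesgue. b < y \<and> y < x \<longrightarrow> P y"
  then obtain b where "b < x" "AE y in lebesgue. b < y \<and> y < x \<longrightarrow> P y" by blast
  moreover have "\<forall>\<^sub>F y in at_left x. b < y \<and> y < x"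
    using \<open>b < x\<close> by (auto simp: eventually_at_left_field)
  ultimately show "eventually P (ess_at_left x)"
    unfolding ess_at_left_def eventually_inf by blast
qed

text \<open>Nonempty open intervals have positive measure. The essential filters are therefore
  proper, and one-sided limits along them are unique.\<close>

lemma AE_lebesgue_interval_False:
  fixes a b :: real
  assumes "a < b"
  shows "\<not> (AE y in lebesgue. a < y \<and> y < b \<longrightarrow> False)"
proof
  assume "AE y in lebesgue. a < y \<and> y < b \<longrightarrow> False"
  then have "AE y in lebesgue. y \<notin> {a<..<b}" by (rule eventually_mono) auto
  then have "{a<..<b} \<in> null_sets lebesgue"
    by (subst AE_iff_null_sets) auto
  then show False using assms by (simp add: null_sets_def)
qed

lemma ess_at_right_neq_bot [simp]: "ess_at_right x \<noteq> bot"
  unfolding trivial_limit_def eventually_ess_at_right using AE_lebesgue_interval_False by blast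

lemma ess_at_left_neq_bot [simp]: "ess_at_left x \<noteq> bot"
  unfolding trivial_limit_def eventually_ess_at_left using AE_lebesgue_interval_False by blast

definition end_filters :: "real \<Rightarrow> real \<Rightarrow> real filter set" where
  "end_filters x0 x1 = {ess_at_right x0, ess_at_left x1}"

lemma end_filter_neq_bot: "F \<in> end_filters x0 x1 \<Longrightarrow> F \<noteq> bot"
  unfolding end_filters_def by (elim insertE emptyE) (simp_all only: ess_at_right_neq_bot ess_at_left_neq_bot not_False_eq_True)

lemma eventually_end_filter:
  assumes "x0 < x1" "F \<in> end_filters x0 x1" and P: "AE x in lebesgue_on {x0<..<x1}. P x"
  shows "eventually P F"
proof -
  have "AE x in lebesgue. x0 < x \<and> x < x1 \<longrightarrow> P x"
    using P by (simp add: AE_restrict_space_iff)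
  then show ?thesis
    using assms(1,2) by (auto simp: end_filters_def eventually_ess_at_right eventually_ess_at_left)
qed

text \<open>Finitely many points leave a one-sided neighbourhood of each end free; being connected,
  it lies within one component. The end point itself may belong to \<open>D\<close>, hence
  \<open>D - {p}\<close> in the choice of the radius.\<close>

lemma Step_eventually_const:
  assumes "x0 < x1" "F \<in> end_filters x0 x1" and s: "s \<in> Step x0 x1"
  obtains c where "eventually (\<lambda>x. s x = c) F"
proof -
  obtain D where "finite D" and D: "\<And>C. C \<in> components ({x0<..<x1} - D) \<Longrightarrow> s constant_on C"
    using s by (auto simp: Step_def)
  have const: "\<exists>c. \<forall>x\<in>{a<..<b}. s x = c" if ab: "a < b" "{a<..<b} \<subseteq> {x0<..<x1} - D" for a b
  proof -
    have "{x0<..<x1} - D \<noteq> {}" using ab by force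
    moreover have "connected {a<..<b}" by simp
    ultimately obtain C where "C \<in> components ({x0<..<x1} - D)" "{a<..<b} \<subseteq> C"
      using exists_component_superset[of "{a<..<b}" "{x0<..<x1} - D"] ab by blast
    then show ?thesis using D unfolding constant_on_def by blast
  qed
  have ball: "\<exists>e>0. ball p e \<inter> (D - {p}) = {}" for p
  proof -
    have "open (- (D - {p}))" using \<open>finite D\<close> by (intro open_Compl finite_imp_closed) simp
    then obtain e where "e > 0" "ball p e \<subseteq> - (D - {p})"
      by (rule openE[where x = p]) auto
    then show ?thesis by blast
  qed
  show thesis
  proof (cases "F = ess_at_right x0")
    case True
    obtain e where "e > 0" and e: "ball x0 e \<inter> (D - {x0}) = {}" using ball by blast
    define b where "b = min x1 (x0 + e)"
    have "x0 < b" using \<open>x0 < x1\<close> \<open>e > 0\<close> by (simp add: b_def)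
    moreover have "{x0<..<b} \<subseteq> {x0<..<x1} - D"
    proof
      fix x assume "x \<in> {x0<..<b}"
      then have "x \<in> ball x0 e" "x \<in> {x0<..<x1}" "x \<noteq> x0" by (auto simp: b_def dist_real_def)
      then show "x \<in> {x0<..<x1} - D" using e by blast
    qed
    ultimately obtain c where "\<forall>x\<in>{x0<..<b}. s x = c" using const by blast
    then have "eventually (\<lambda>x. s x = c) F"
      unfolding True eventually_ess_at_right using \<open>x0 < b\<close> by (intro exI[of _ b]) auto
    then show thesis by (rule that)
  next
    case False
    then have F: "F = ess_at_left x1" using assms(2) by (simp add: end_filters_def)
    obtain e where "e > 0" and e: "ball x1 e \<inter> (D - {x1}) = {}" using ball by blast
    define b where "b = max x0 (x1 - e)"
    have "b < x1" using \<open>x0 < x1\<close> \<open>e > 0\<close> by (simp add: b_def)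
    moreover have "{b<..<x1} \<subseteq> {x0<..<x1} - D"
    proof
      fix x assume "x \<in> {b<..<x1}"
      then have "x \<in> ball x1 e" "x \<in> {x0<..<x1}" "x \<noteq> x1" by (auto simp: b_def dist_real_def)
      then show "x \<in> {x0<..<x1} - D" using e by blast
    qed
    ultimately obtain c where "\<forall>x\<in>{b<..<x1}. s x = c" using const by blast
    then have "eventually (\<lambda>x. s x = c) F"
      unfolding F eventually_ess_at_left using \<open>b < x1\<close> by (intro exI[of _ b]) auto
    then show thesis by (rule that)
  qed
qed

text \<open>A Cauchy criterion for filters. Two approximating constants are compared at a common
  point, which exists because \<open>F\<close> is proper; the limit of the constants is the limit of
  \<open>f\<close>.\<close>

lemma tendsto_of_eventually_close:
  fixes f :: "'b \<Rightarrow> 'a::banach"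
  assumes F: "F \<noteq> bot" and close: "\<And>\<epsilon>. 0 < \<epsilon> \<Longrightarrow> \<exists>c. eventually (\<lambda>x. norm (f x - c) < \<epsilon>) F"
  obtains L where "(f \<longlongrightarrow> L) F"
proof -
  have "\<exists>c. eventually (\<lambda>x. norm (f x - c) < inverse (real (Suc n))) F" for n
    by (rule close) simp
  then obtain c where c: "\<And>n. eventually (\<lambda>x. norm (f x - c n) < inverse (real (Suc n))) F"
    by metis
  have dist: "norm (c m - c n) < inverse (real (Suc m)) + inverse (real (Suc n))" for m n
  proof -
    obtain x where x: "norm (f x - c m) < inverse (real (Suc m))" "norm (f x - c n) < inverse (real (Suc n))"
      using eventually_happens'[OF F eventually_conj[OF c[of m] c[of n]]] by blast
    have "c m - c n = (f x - c n) - (f x - c m)" by simp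
    then have "norm (c m - c n) \<le> norm (f x - c n) + norm (f x - c m)" by (metis norm_triangle_ineq4)
    then show ?thesis using x by linarith
  qed
  have "Cauchy c"
  proof (rule CauchyI)
    fix e :: real assume "0 < e"
    then obtain k where k: "inverse (real (Suc k)) < e / 2" using reals_Archimedean[of "e / 2"] by auto
    have "norm (c m - c n) < e" if "k \<le> m" "k \<le> n" for m n
    proof -
      have "inverse (real (Suc m)) \<le> inverse (real (Suc k))" "inverse (real (Suc n)) \<le> inverse (real (Suc k))"
        using that by (auto intro!: le_imp_inverse_le)
      then show ?thesis using dist[of m n] k by linarith
    qed
    then show "\<exists>M. \<forall>m\<ge>M. \<forall>n\<ge>M. norm (c m - c n) < e" by blast
  qed
  then obtain L where L: "c \<longlonglongrightarrow> L" by (auto simp: Cauchy_convergent_iff convergent_def)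
  have "(f \<longlongrightarrow> L) F"
  proof (rule tendstoI)
    fix e :: real assume "0 < e"
    then have "\<forall>\<^sub>F n in sequentially. norm (c n - L) < e / 2"
      using tendstoD[OF L, of "e / 2"] by (simp add: dist_norm)
    moreover have "\<forall>\<^sub>F n in sequentially. inverse (real (Suc n)) < e / 2"
      using order_tendstoD(2)[OF LIMSEQ_inverse_real_of_nat, of "e / 2"] \<open>0 < e\<close> by simp
    ultimately obtain n where n: "norm (c n - L) < e / 2" "inverse (real (Suc n)) < e / 2"
      using eventually_happens'[OF sequentially_bot eventually_conj] by blast
    show "\<forall>\<^sub>F x in F. dist (f x) L < e"
      using c[of n]
    proof eventually_elim
      case (elim x)
      have "norm (f x - L) \<le> norm (f x - c n) + norm (c n - L)"
        using norm_triangle_ineq[of "f x - c n" "c n - L"] by simp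
      then show ?case using elim n by (simp add: dist_norm)
    qed
  qed
  then show thesis by (rule that)
qed

lemma AE_norm_le_Linf_norm:
  "AE x in lebesgue_on {x0<..<x1}. ereal (norm (f x)) \<le> Linf_norm x0 x1 f"
  unfolding Linf_norm_def by (rule esssup_AE)

text \<open>Near an end an approximating step function is a single constant. The error bound holds
  only almost everywhere, which the essential filters absorb.\<close>

lemma Reg_tendsto:
  assumes "x0 < x1" "F \<in> end_filters x0 x1" "f \<in> Reg x0 x1"
  obtains L where "(f \<longlongrightarrow> L) F"
proof (rule tendsto_of_eventually_close[where F = F and f = f])
  show "F \<noteq> bot" using assms(2) by (rule end_filter_neq_bot)
  fix \<epsilon> :: real assume "0 < \<epsilon>"
  then obtain s where s: "s \<in> Step x0 x1" "Linf_norm x0 x1 (\<lambda>x. f x - s x) < ereal \<epsilon>"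
    using assms(3) by (auto simp: Reg_def)
  have "AE x in lebesgue_on {x0<..<x1}. norm (f x - s x) < \<epsilon>"
    using AE_norm_le_Linf_norm[where f = "\<lambda>x. f x - s x"]
    by (rule eventually_mono) (use s(2) in \<open>auto dest: le_less_trans\<close>)
  then have "eventually (\<lambda>x. norm (f x - s x) < \<epsilon>) F"
    by (rule eventually_end_filter[OF assms(1,2)])
  moreover obtain c where "eventually (\<lambda>x. s x = c) F"
    using Step_eventually_const[OF assms(1,2) s(1)] .
  ultimately have "eventually (\<lambda>x. norm (f x - c) < \<epsilon>) F"
    by eventually_elim simp
  then show "\<exists>c. eventually (\<lambda>x. norm (f x - c) < \<epsilon>) F" by blast
qed

lemma Reg_plus_measurable:
  assumes "f \<in> Reg_plus x0 x1"
  shows "f \<in> borel_measurable (lebesgue_on {x0<..<x1})"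
proof -
  have "(\<lambda>x. complex_of_real (f x)) \<in> borel_measurable (lebesgue_on {x0<..<x1})"
    using assms by (simp add: Reg_plus_def Reg_def Linf_def)
  then have "(\<lambda>x. Re (complex_of_real (f x))) \<in> borel_measurable (lebesgue_on {x0<..<x1})"
    by measurable
  then show ?thesis by simp
qed

lemma Reg_plus_bounds:
  assumes "f \<in> Reg_plus x0 x1"
  obtains \<epsilon> B where "0 < \<epsilon>" "AE x in lebesgue_on {x0<..<x1}. \<epsilon> \<le> f x \<and> f x \<le> B"
proof -
  obtain \<epsilon> where "0 < \<epsilon>" and \<epsilon>: "AE x in lebesgue_on {x0<..<x1}. f x > \<epsilon>"
    using assms by (auto simp: Reg_plus_def)
  have "Linf_norm x0 x1 (\<lambda>x. complex_of_real (f x)) < \<infinity>"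
    using assms by (simp add: Reg_plus_def Reg_def Linf_def)
  then have "Linf_norm x0 x1 (\<lambda>x. complex_of_real (f x)) \<noteq> \<infinity>" by simp
  then obtain n where "Linf_norm x0 x1 (\<lambda>x. complex_of_real (f x)) < ereal (real n)"
    unfolding less_PInf_Ex_of_nat by blast
  then obtain B where B: "Linf_norm x0 x1 (\<lambda>x. complex_of_real (f x)) \<le> ereal B"
    using less_imp_le by blast
  have "AE x in lebesgue_on {x0<..<x1}. \<epsilon> \<le> f x \<and> f x \<le> B"
    using \<epsilon> AE_norm_le_Linf_norm[where f = "\<lambda>x. complex_of_real (f x)"]
  proof eventually_elim
    case (elim x)
    have "ereal \<bar>f x\<bar> \<le> ereal B" using elim(2) B by (metis norm_of_real order_trans)
    then show ?case using elim(1) by simp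
  qed
  then show thesis using that \<open>0 < \<epsilon>\<close> by blast
qed

lemma Reg_plus_tendsto:
  assumes "x0 < x1" "F \<in> end_filters x0 x1" "f \<in> Reg_plus x0 x1"
  obtains l where "(f \<longlongrightarrow> l) F" "0 < l"
proof -
  obtain L where "((\<lambda>x. complex_of_real (f x)) \<longlongrightarrow> L) F"
    using Reg_tendsto[OF assms(1,2)] assms(3) by (auto simp: Reg_plus_def)
  then have "((\<lambda>x. Re (complex_of_real (f x))) \<longlongrightarrow> Re L) F"
    by (rule tendsto_Re)
  then have lim: "(f \<longlongrightarrow> Re L) F" by simp
  obtain \<epsilon> B where "0 < \<epsilon>" "AE x in lebesgue_on {x0<..<x1}. \<epsilon> \<le> f x \<and> f x \<le> B"
    using Reg_plus_bounds[OF assms(3)] .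
  then have "eventually (\<lambda>x. \<epsilon> \<le> f x) F"
    by (intro eventually_end_filter[OF assms(1,2)]) (auto elim: eventually_mono)
  then have "\<epsilon> \<le> Re L"
    using tendsto_lowerbound[OF lim] end_filter_neq_bot[OF assms(2)] by blast
  then show thesis using that lim \<open>0 < \<epsilon>\<close> by simp
qed

section \<open>Increments, derivatives and Wronskian of solutions of the integral equations\<close>

lemma has_integral_increment:
  fixes f :: "real \<Rightarrow> 'b::euclidean_space"
  assumes "(f has_integral (F c - F a)) {a..c}" "(f has_integral (F d - F a)) {a..d}" "a \<le> c" "c \<le> d"
  shows "(f has_integral (F d - F c)) {c..d}"
proof -
  have "f integrable_on {a..d}" using assms(2) by blast
  then have "f integrable_on {c..d}" by (rule integrable_on_subinterval) (use assms in auto)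
  moreover have "integral {c..d} f = F d - F c"
    using Henstock_Kurzweil_Integration.integral_combine[OF assms(3,4) \<open>f integrable_on {a..d}\<close>]
      integral_unique[OF assms(1)] integral_unique[OF assms(2)] by (simp add: algebra_simps)
  ultimately show ?thesis by (metis integrable_integral)
qed

lemma ode_sol_increment:
  assumes "ode_sol a b p q y z" "a \<le> c" "c \<le> d" "d \<le> b"
  shows "((\<lambda>t. p t *\<^sub>R z t) has_integral (y d - y c)) {c..d}"
    and "((\<lambda>t. - (q t *\<^sub>R y t)) has_integral (z d - z c)) {c..d}"
proof -
  have "c \<in> {a..b}" "d \<in> {a..b}" using assms(2-4) by auto
  then show "((\<lambda>t. p t *\<^sub>R z t) has_integral (y d - y c)) {c..d}"
    "((\<lambda>t. - (q t *\<^sub>R y t)) has_integral (z d - z c)) {c..d}"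
    using assms(1) has_integral_increment[where F = y and a = a, OF _ _ assms(2,3)]
      has_integral_increment[where F = z and a = a, OF _ _ assms(2,3)]
    unfolding ode_sol_def by blast+
qed

text \<open>Lebesgue differentiation was stated on the whole line, so \<open>f\<close> is extended
  by 0 and \<open>F\<close> by clamping its argument; inside the open interval nothing
  changes.\<close>

lemma indefinite_integral_derivative_ae:
  fixes F f :: "real \<Rightarrow> 'b::euclidean_space"
  assumes "a \<le> b" and inc: "\<And>c d. \<lbrakk>a \<le> c; c \<le> d; d \<le> b\<rbrakk> \<Longrightarrow> (f has_integral (F d - F c)) {c..d}"
  obtains N where "negligible N"
    "\<And>x. \<lbrakk>a < x; x < b; x \<notin> N\<rbrakk> \<Longrightarrow> (F has_vector_derivative f x) (at x)"
proof -
  define h where "h x = (if x \<in> {a..b} then f x else 0)" for x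
  define k where "k x = max a (min b x)" for x
  have int: "(h has_integral (F (k d) - F (k c))) {c..d}" if "c \<le> d" for c d
  proof (cases "max a c \<le> min b d")
    case True
    then have eq: "{a..b} \<inter> {c..d} = {k c..k d}" and "a \<le> k c" "k c \<le> k d" "k d \<le> b"
      using \<open>a \<le> b\<close> that by (auto simp: k_def)
    then have "(f has_integral (F (k d) - F (k c))) ({a..b} \<inter> {c..d})"
      using inc[of "k c" "k d"] by simp
    then have "((\<lambda>x. if x \<in> {a..b} \<inter> {c..d} then f x else 0) has_integral (F (k d) - F (k c))) UNIV"
      by (simp only: has_integral_restrict_UNIV)
    moreover have "(\<lambda>x. if x \<in> {a..b} \<inter> {c..d} then f x else 0) = (\<lambda>x. if x \<in> {c..d} then h x else 0)"
      by (auto simp: h_def)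
    ultimately show ?thesis by (simp only: has_integral_restrict_UNIV)
  next
    case False
    then have "k c = k d" using \<open>a \<le> b\<close> that by (auto simp: k_def max_def min_def split: if_splits)
    moreover have "(h has_integral 0) {c..d}"
      by (rule has_integral_is_0) (use False in \<open>auto simp: h_def\<close>)
    ultimately show ?thesis by simp
  qed
  have "h integrable_on {c..d}" for c d
    using int[of c d] by (cases "c \<le> d") auto
  moreover have "F (k d) - F (k c) = integral {c..d} h" if "c \<le> d" for c d
    using integral_unique[OF int[OF that]] by simp
  ultimately obtain N where N: "negligible N" "\<And>x. x \<notin> N \<Longrightarrow> ((\<lambda>x. F (k x)) has_vector_derivative h x) (at x)"
    using lebesgue_differentiation[of h "\<lambda>x. F (k x)"] by blast
  have "(F has_vector_derivative f x) (at x)" if "a < x" "x < b" "x \<notin> N" for x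
  proof -
    have "(F has_vector_derivative h x) (at x)"
      by (rule has_vector_derivative_transform_within_open[OF N(2)[OF that(3)], of "{a<..<b}"])
        (use that in \<open>auto simp: k_def\<close>)
    then show ?thesis using that by (simp add: h_def)
  qed
  then show thesis using that N(1) by blast
qed

lemma bounded_measurable_scaleR_integrable:
  fixes f :: "real \<Rightarrow> 'b::euclidean_space"
  assumes "p \<in> borel_measurable lebesgue" and M: "\<And>t. t \<in> {a..b} \<Longrightarrow> \<bar>p t\<bar> \<le> M"
    and f: "continuous_on {a..b} f"
  shows "(\<lambda>t. p t *\<^sub>R f t) integrable_on {a..b}"
proof (rule measurable_bounded_by_integrable_imp_integrable)
  have [measurable]: "f \<in> borel_measurable (lebesgue_on {a..b})" "p \<in> borel_measurable (lebesgue_on {a..b})"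
    using f assms(1) by (auto intro: continuous_imp_measurable_on_sets_lebesgue measurable_restrict_space1)
  show "(\<lambda>t. p t *\<^sub>R f t) \<in> borel_measurable (lebesgue_on {a..b})"
    by measurable
  show "(\<lambda>t. M * norm (f t)) integrable_on {a..b}"
    using f by (intro integrable_continuous_real continuous_intros)
  show "norm (p t *\<^sub>R f t) \<le> M * norm (f t)" if "t \<in> {a..b}" for t
    using M[OF that] by (simp add: mult_right_mono)
qed auto

text \<open>Carries identities from the open interval, where derivatives exist, to the end points,
  where the data sit.\<close>

lemma continuous_on_eq_on_Icc:
  fixes f :: "real \<Rightarrow> 'b::real_normed_vector"
  assumes "a < b" "continuous_on {a..b} f" "\<And>c d. \<lbrakk>a < c; c \<le> d; d < b\<rbrakk> \<Longrightarrow> f d = f c"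
    and x: "x \<in> {a..b}"
  shows "f x = f a"
proof -
  define m where "m = (a + b) / 2"
  have m: "a < m" "m < b" using \<open>a < b\<close> by (auto simp: m_def)
  have "f y = f m" if "y \<in> {a<..<b}" for y
    using assms(3)[of y m] assms(3)[of m y] that m by (cases "y \<le> m") auto
  then have "f y = f m" if "y \<in> {a..b}" for y
    using continuous_constant_on_closure[of "{a<..<b}" f "f m" y] assms(1,2) that
    by (simp add: closure_greaterThanLessThan)
  then show ?thesis using x \<open>a < b\<close> by simp
qed

text \<open>This is how the real propagator acts on complex data.\<close>

lemma ode_sol_linear_combination:
  fixes y1 z1 y2 z2 :: "real \<Rightarrow> real" and \<alpha> \<beta> :: "'a::euclidean_space"
  assumes "ode_sol a b p q y1 z1" "ode_sol a b p q y2 z2"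
  shows "ode_sol a b p q (\<lambda>x. y1 x *\<^sub>R \<alpha> + y2 x *\<^sub>R \<beta>) (\<lambda>x. z1 x *\<^sub>R \<alpha> + z2 x *\<^sub>R \<beta>)"
  unfolding ode_sol_def
proof (intro conjI ballI)
  have c: "continuous_on {a..b} y1" "continuous_on {a..b} z1" "continuous_on {a..b} y2" "continuous_on {a..b} z2"
    using assms by (simp_all add: ode_sol_def)
  show "continuous_on {a..b} (\<lambda>x. y1 x *\<^sub>R \<alpha> + y2 x *\<^sub>R \<beta>)" "continuous_on {a..b} (\<lambda>x. z1 x *\<^sub>R \<alpha> + z2 x *\<^sub>R \<beta>)"
    by (intro continuous_intros c)+
  fix x assume x: "x \<in> {a..b}"
  have i: "((\<lambda>t. p t * z1 t) has_integral (y1 x - y1 a)) {a..x}" "((\<lambda>t. - (q t * y1 t)) has_integral (z1 x - z1 a)) {a..x}"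
    "((\<lambda>t. p t * z2 t) has_integral (y2 x - y2 a)) {a..x}" "((\<lambda>t. - (q t * y2 t)) has_integral (z2 x - z2 a)) {a..x}"
    using assms x by (simp_all add: ode_sol_def)
  show "((\<lambda>t. p t *\<^sub>R (z1 t *\<^sub>R \<alpha> + z2 t *\<^sub>R \<beta>)) has_integral
      (y1 x *\<^sub>R \<alpha> + y2 x *\<^sub>R \<beta> - (y1 a *\<^sub>R \<alpha> + y2 a *\<^sub>R \<beta>))) {a..x}"
    using has_integral_add[OF has_integral_scaleR_left[OF i(1), of \<alpha>] has_integral_scaleR_left[OF i(3), of \<beta>]]
    by (simp add: algebra_simps)
  show "((\<lambda>t. - (q t *\<^sub>R (y1 t *\<^sub>R \<alpha> + y2 t *\<^sub>R \<beta>))) has_integral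
      (z1 x *\<^sub>R \<alpha> + z2 x *\<^sub>R \<beta> - (z1 a *\<^sub>R \<alpha> + z2 a *\<^sub>R \<beta>))) {a..x}"
    using has_integral_add[OF has_integral_scaleR_left[OF i(2), of \<alpha>] has_integral_scaleR_left[OF i(4), of \<beta>]]
    by (simp add: algebra_simps)
qed

lemma ode_sol_lipschitz:
  fixes y z :: "real \<Rightarrow> 'a::euclidean_space"
  assumes s: "ode_sol a b p q y z" and M: "\<And>t. t \<in> {a..b} \<Longrightarrow> \<bar>p t\<bar> \<le> M \<and> \<bar>q t\<bar> \<le> M"
  obtains L where "0 \<le> L" "\<And>c d. \<lbrakk>a \<le> c; c \<le> d; d \<le> b\<rbrakk> \<Longrightarrow>
    norm (y d - y c) \<le> L * (d - c) \<and> norm (z d - z c) \<le> L * (d - c)"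
proof -
  obtain C where C: "0 < C" "\<And>t. t \<in> {a..b} \<Longrightarrow> norm (y t) \<le> C \<and> norm (z t) \<le> C"
    using ode_sol_bounded[OF s] by blast
  have "norm (y d - y c) \<le> \<bar>M\<bar> * C * (d - c) \<and> norm (z d - z c) \<le> \<bar>M\<bar> * C * (d - c)"
    if cd: "a \<le> c" "c \<le> d" "d \<le> b" for c d
  proof
    have *: "\<bar>p t\<bar> * norm (z t) \<le> \<bar>M\<bar> * C" "\<bar>q t\<bar> * norm (y t) \<le> \<bar>M\<bar> * C" if "t \<in> {c..d}" for t
      using M[of t] C(2)[of t] that cd by (auto intro!: mult_mono)
    show "norm (y d - y c) \<le> \<bar>M\<bar> * C * (d - c)"
    proof -
      have "norm (y d - y c) \<le> \<bar>M\<bar> * C * measure lborel {c..d}"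
        by (rule has_integral_bound_real[where S = "{}", OF _ _ ode_sol_increment(1)[OF s cd]])
          (use * C(1) in auto)
      then show ?thesis using cd(2) by simp
    qed
    show "norm (z d - z c) \<le> \<bar>M\<bar> * C * (d - c)"
    proof -
      have "norm (z d - z c) \<le> \<bar>M\<bar> * C * measure lborel {c..d}"
        by (rule has_integral_bound_real[where S = "{}", OF _ _ ode_sol_increment(2)[OF s cd]])
          (use * C(1) in auto)
      then show ?thesis using cd(2) by simp
    qed
  qed
  then show thesis using that[of "\<bar>M\<bar> * C"] C(1) by simp
qed

lemma ode_sol_derivative_ae:
  fixes y z :: "real \<Rightarrow> 'a::euclidean_space"
  assumes s: "ode_sol a b p q y z" and "a \<le> b"
  obtains N where "negligible N"
    "\<And>x. \<lbrakk>a < x; x < b; x \<notin> N\<rbrakk> \<Longrightarrow> (y has_vector_derivative p x *\<^sub>R z x) (at x)"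
    "\<And>x. \<lbrakk>a < x; x < b; x \<notin> N\<rbrakk> \<Longrightarrow> (z has_vector_derivative - (q x *\<^sub>R y x)) (at x)"
proof -
  obtain N1 where N1: "negligible N1"
    "\<And>x. \<lbrakk>a < x; x < b; x \<notin> N1\<rbrakk> \<Longrightarrow> (y has_vector_derivative p x *\<^sub>R z x) (at x)"
    using indefinite_integral_derivative_ae[OF \<open>a \<le> b\<close> ode_sol_increment(1)[OF s]] by blast
  obtain N2 where N2: "negligible N2"
    "\<And>x. \<lbrakk>a < x; x < b; x \<notin> N2\<rbrakk> \<Longrightarrow> (z has_vector_derivative - (q x *\<^sub>R y x)) (at x)"
    using indefinite_integral_derivative_ae[OF \<open>a \<le> b\<close> ode_sol_increment(2)[OF s]] by blast
  show thesis
    by (rule that[of "N1 \<union> N2"]) (use N1 N2 in auto)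
qed

text \<open>The derivative of \<open>W\<close> cancels, but only almost everywhere; to conclude
  constancy, \<open>W\<close> must be absolutely continuous. It is even Lipschitz, being built from
  products of bounded Lipschitz functions.\<close>

lemma ode_sol_wronskian:
  fixes y1 z1 y2 z2 :: "real \<Rightarrow> real"
  assumes s1: "ode_sol a b p q y1 z1" and s2: "ode_sol a b p q y2 z2" and "a < b"
    and M: "\<And>t. t \<in> {a..b} \<Longrightarrow> \<bar>p t\<bar> \<le> M \<and> \<bar>q t\<bar> \<le> M"
  shows "y1 b * z2 b - y2 b * z1 b = y1 a * z2 a - y2 a * z1 a"
proof -
  define W where "W x = y1 x * z2 x - y2 x * z1 x" for x
  obtain C1 where C1: "0 < C1" "\<And>t. t \<in> {a..b} \<Longrightarrow> norm (y1 t) \<le> C1 \<and> norm (z1 t) \<le> C1"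
    using ode_sol_bounded[OF s1] by blast
  obtain C2 where C2: "0 < C2" "\<And>t. t \<in> {a..b} \<Longrightarrow> norm (y2 t) \<le> C2 \<and> norm (z2 t) \<le> C2"
    using ode_sol_bounded[OF s2] by blast
  obtain L1 where L1: "0 \<le> L1" "\<And>c d. \<lbrakk>a \<le> c; c \<le> d; d \<le> b\<rbrakk> \<Longrightarrow>
      norm (y1 d - y1 c) \<le> L1 * (d - c) \<and> norm (z1 d - z1 c) \<le> L1 * (d - c)"
    using ode_sol_lipschitz[OF s1 M] by blast
  obtain L2 where L2: "0 \<le> L2" "\<And>c d. \<lbrakk>a \<le> c; c \<le> d; d \<le> b\<rbrakk> \<Longrightarrow>
      norm (y2 d - y2 c) \<le> L2 * (d - c) \<and> norm (z2 d - z2 c) \<le> L2 * (d - c)"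
    using ode_sol_lipschitz[OF s2 M] by blast
  obtain N1 where N1: "negligible N1"
    "\<And>x. \<lbrakk>a < x; x < b; x \<notin> N1\<rbrakk> \<Longrightarrow> (y1 has_vector_derivative p x *\<^sub>R z1 x) (at x)"
    "\<And>x. \<lbrakk>a < x; x < b; x \<notin> N1\<rbrakk> \<Longrightarrow> (z1 has_vector_derivative - (q x *\<^sub>R y1 x)) (at x)"
    using ode_sol_derivative_ae[OF s1 less_imp_le[OF \<open>a < b\<close>]] by blast
  obtain N2 where N2: "negligible N2"
    "\<And>x. \<lbrakk>a < x; x < b; x \<notin> N2\<rbrakk> \<Longrightarrow> (y2 has_vector_derivative p x *\<^sub>R z2 x) (at x)"
    "\<And>x. \<lbrakk>a < x; x < b; x \<notin> N2\<rbrakk> \<Longrightarrow> (z2 has_vector_derivative - (q x *\<^sub>R y2 x)) (at x)"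
    using ode_sol_derivative_ae[OF s2 less_imp_le[OF \<open>a < b\<close>]] by blast
  have prod: "\<bar>u' * v' - u * v\<bar> \<le> (C1 * L2 + L1 * C2) * h"
    if "\<bar>u'\<bar> \<le> C1" "\<bar>v\<bar> \<le> C2" "\<bar>u' - u\<bar> \<le> L1 * h" "\<bar>v' - v\<bar> \<le> L2 * h" "0 \<le> h" for u u' v v' h :: real
  proof -
    have "u' * v' - u * v = u' * (v' - v) + (u' - u) * v" by (simp add: algebra_simps)
    then have "\<bar>u' * v' - u * v\<bar> \<le> \<bar>u'\<bar> * \<bar>v' - v\<bar> + \<bar>u' - u\<bar> * \<bar>v\<bar>"
      by (metis abs_mult abs_triangle_ineq)
    also have "\<dots> \<le> C1 * (L2 * h) + (L1 * h) * C2"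
      using that C1(1) L1(1) by (intro add_mono mult_mono) auto
    finally show ?thesis by (simp add: algebra_simps)
  qed
  have "abs_continuous_on {a<..<b} (\<lambda>x. of_real (W x))"
  proof (rule lipschitz_imp_abs_continuous_on)
    fix c d assume "c \<in> {a<..<b}" "d \<in> {a<..<b}" "c \<le> d"
    then have cd: "a \<le> c" "c \<le> d" "d \<le> b" "c \<in> {a..b}" "d \<in> {a..b}" by auto
    have "\<bar>y1 d * z2 d - y1 c * z2 c\<bar> \<le> (C1 * L2 + L1 * C2) * (d - c)"
      by (rule prod) (use C1(2) C2(2) L1(2) L2(2) cd in auto)
    \<comment> \<open>The factors are swapped because \<open>prod\<close> expects the component of
      the first solution on the left.\<close>
    moreover have "\<bar>z1 d * y2 d - z1 c * y2 c\<bar> \<le> (C1 * L2 + L1 * C2) * (d - c)"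
      by (rule prod) (use C1(2) C2(2) L1(2) L2(2) cd in auto)
    ultimately have "\<bar>W d - W c\<bar> \<le> (2 * (C1 * L2 + L1 * C2)) * (d - c)"
      by (simp add: W_def algebra_simps abs_le_iff)
    then show "norm (complex_of_real (W d) - of_real (W c)) \<le> (2 * (C1 * L2 + L1 * C2)) * (d - c)"
      by (simp flip: of_real_diff)
  qed
  moreover have "((\<lambda>x. complex_of_real (W x)) has_vector_derivative 0) (at x)"
    if "a < x" "x < b" "x \<notin> N1 \<union> N2" for x
  proof -
    have "(W has_vector_derivative (y1 x * - (q x *\<^sub>R y2 x) + p x *\<^sub>R z1 x * z2 x)
        - (y2 x * - (q x *\<^sub>R y1 x) + p x *\<^sub>R z2 x * z1 x)) (at x)"
      unfolding W_def using that N1 N2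
      by (intro has_vector_derivative_diff has_vector_derivative_mult) auto
    then have "(W has_real_derivative 0) (at x)"
      by (simp add: algebra_simps has_real_derivative_iff_has_vector_derivative)
    from has_vector_derivative_of_real[OF this] show ?thesis by simp
  qed
  ultimately have eq: "W d = W c" if "a < c" "c \<le> d" "d < b" for c d
  proof -
    have "((\<lambda>_. 0) has_integral (complex_of_real (W d) - of_real (W c))) {c..d}"
    proof (rule abs_continuous_on_has_integral)
      show "negligible (N1 \<union> N2)" using N1(1) N2(1) by simp
    qed (use \<open>abs_continuous_on {a<..<b} (\<lambda>x. of_real (W x))\<close> that
        \<open>\<And>x. \<lbrakk>a < x; x < b; x \<notin> N1 \<union> N2\<rbrakk> \<Longrightarrow> ((\<lambda>x. complex_of_real (W x)) has_vector_derivative 0) (at x)\<close> in auto)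
    then have "complex_of_real (W d) - of_real (W c) = 0" by (simp add: has_integral_0_eq)
    then show ?thesis by simp
  qed
  have "continuous_on {a..b} W"
    unfolding W_def using s1 s2 by (intro continuous_intros) (auto simp: ode_sol_def)
  from continuous_on_eq_on_Icc[OF \<open>a < b\<close> this eq, of b] show ?thesis
    using \<open>a < b\<close> by (simp add: W_def)
qed

section \<open>Reflection coefficients\<close>

text \<open>The limit of \<open>u'\<close> is reached through \<open>w / \<zeta>\<close>: both
  \<open>w\<close> and \<open>\<zeta>\<close> have limits along \<open>F\<close>, the latter a
  nonzero one.\<close>

lemma parts_tendsto:
  assumes u: "(u \<longlongrightarrow> U) F" and w: "(w \<longlongrightarrow> W) F"
    and eq: "eventually (\<lambda>x. w x = of_real (\<zeta> x) * vector_derivative u (at x)) F"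
    and \<zeta>: "(\<zeta> \<longlongrightarrow> l) F" "l \<noteq> 0"
  shows "(left_part \<omega> u \<longlongrightarrow> 1/2 * (U - 1 / (\<i> * of_real \<omega>) * (W / of_real l))) F"
    and "(right_part \<omega> u \<longlongrightarrow> 1/2 * (U + 1 / (\<i> * of_real \<omega>) * (W / of_real l))) F"
proof -
  have "((\<lambda>x. w x / complex_of_real (\<zeta> x)) \<longlongrightarrow> W / of_real l) F"
    using \<zeta> by (intro tendsto_divide w tendsto_of_real) auto
  moreover have "eventually (\<lambda>x. w x / complex_of_real (\<zeta> x) = vector_derivative u (at x)) F"
    using eq tendsto_imp_eventually_ne[OF \<zeta>(1,2)] by eventually_elim simp
  ultimately have d: "((\<lambda>x. vector_derivative u (at x)) \<longlongrightarrow> W / of_real l) F"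
    by (rule Lim_transform_eventually)
  show "(left_part \<omega> u \<longlongrightarrow> 1/2 * (U - 1 / (\<i> * of_real \<omega>) * (W / of_real l))) F"
    unfolding left_part_def by (intro tendsto_intros u d)
  show "(right_part \<omega> u \<longlongrightarrow> 1/2 * (U + 1 / (\<i> * of_real \<omega>) * (W / of_real l))) F"
    unfolding right_part_def by (intro tendsto_intros u d)
qed

text \<open>With the propagator \<open>(a b; c d)\<close> of \<open>(u, \<zeta> u')\<close> from \<open>x0\<close> to \<open>x1\<close>, data \<open>u\<^sup>r = 1\<close>,
  \<open>u\<^sup>l = \<eta>\<close> at \<open>x0\<close> are transported to \<open>2 u\<^sup>r = A + B \<eta>\<close>, \<open>2 u\<^sup>l = cnj B + cnj A \<eta>\<close> at \<open>x1\<close>,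
  where \<open>A = transfer_diag\<close> and \<open>B = transfer_off\<close>.\<close>
definition transfer_diag :: "real \<Rightarrow> real \<Rightarrow> real \<Rightarrow> real \<Rightarrow> real \<Rightarrow> real \<Rightarrow> real \<Rightarrow> complex" where
  "transfer_diag \<omega> l0 l1 a b c d = Complex (a + d * l0 / l1) (b * \<omega> * l0 - c / (\<omega> * l1))"

definition transfer_off :: "real \<Rightarrow> real \<Rightarrow> real \<Rightarrow> real \<Rightarrow> real \<Rightarrow> real \<Rightarrow> real \<Rightarrow> complex" where
  "transfer_off \<omega> l0 l1 a b c d = Complex (a - d * l0 / l1) (- (b * \<omega> * l0) - c / (\<omega> * l1))"

text \<open>The difference of the squared norms is the determinant times \<open>4 * l0 / l1\<close>,
  an expression of flux conservation.\<close>

lemma norm_transfer_less: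
  assumes "a * d - b * c = 1" "0 < l0" "0 < l1" "\<omega> \<noteq> 0"
  shows "norm (transfer_off \<omega> l0 l1 a b c d) < norm (transfer_diag \<omega> l0 l1 a b c d)"
proof -
  have "(norm (transfer_diag \<omega> l0 l1 a b c d))\<^sup>2 - (norm (transfer_off \<omega> l0 l1 a b c d))\<^sup>2
      = 4 * (a * d - b * c) * l0 / l1"
    unfolding cmod_power2 transfer_diag_def transfer_off_def complex.sel
    using assms(2-4) by (simp add: field_simps power2_eq_square)
  then have "(norm (transfer_off \<omega> l0 l1 a b c d))\<^sup>2 < (norm (transfer_diag \<omega> l0 l1 a b c d))\<^sup>2"
    using assms by (smt (verit) divide_pos_pos mult_pos_pos)
  then show ?thesis by (rule power2_less_imp_less) simp
qed

text \<open>The data come from u = u^r + u^l and u' = i \<omega> (u^r - u^l). With u^r = 1 and u^l =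
  \<eta> at \<open>x0\<close> these give \<open>1 + \<eta>\<close> for \<open>u\<close> and
  \<open>\<i> * \<omega> * l0 * (1 - \<eta>)\<close> for the product of \<open>\<zeta>\<close> and
  u'.\<close>

lemma transfer_parts:
  assumes "l0 \<noteq> 0" "l1 \<noteq> 0" "\<omega> \<noteq> 0"
    and U: "U = a *\<^sub>R (1 + \<eta>) + b *\<^sub>R (\<i> * of_real (\<omega> * l0) * (1 - \<eta>))"
    and W: "W = c *\<^sub>R (1 + \<eta>) + d *\<^sub>R (\<i> * of_real (\<omega> * l0) * (1 - \<eta>))"
  shows "1/2 * (U + 1 / (\<i> * of_real \<omega>) * (W / of_real l1)) =
      (transfer_diag \<omega> l0 l1 a b c d + transfer_off \<omega> l0 l1 a b c d * \<eta>) / 2"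
    and "1/2 * (U - 1 / (\<i> * of_real \<omega>) * (W / of_real l1)) =
      (cnj (transfer_off \<omega> l0 l1 a b c d) + cnj (transfer_diag \<omega> l0 l1 a b c d) * \<eta>) / 2"
  using assms unfolding U W transfer_diag_def transfer_off_def
  by (simp_all add: complex_eq_iff Re_divide Im_divide power2_eq_square) (simp_all add: field_simps)

text \<open>\<open>z\<close> is a representative of \<open>\<zeta>\<close> that is measurable and bounded everywhere.\<close>
locale medium =
  fixes x0 x1 \<omega> :: real and \<zeta> z :: "real \<Rightarrow> real" and l0 l1 \<epsilon> B :: real
  assumes x01: "x0 < x1" and \<omega>: "\<omega> \<noteq> 0"
    and z_measurable: "z \<in> borel_measurable lebesgue"
    and \<epsilon>: "0 < \<epsilon>" and z_bounds: "\<And>x. \<epsilon> \<le> z x \<and> z x \<le> B"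
    and z_ae: "AE x in lebesgue_on {x0<..<x1}. \<zeta> x = z x"
    and l0: "(\<zeta> \<longlongrightarrow> l0) (ess_at_right x0)" "0 < l0"
    and l1: "(\<zeta> \<longlongrightarrow> l1) (ess_at_left x1)" "0 < l1"
begin

abbreviation p where "p \<equiv> \<lambda>t. 1 / z t"
abbreviation q where "q \<equiv> \<lambda>t. \<omega>\<^sup>2 * z t"

lemma coefficient_bounds: "\<bar>p t\<bar> \<le> max (1 / \<epsilon>) (\<omega>\<^sup>2 * B) \<and> \<bar>q t\<bar> \<le> max (1 / \<epsilon>) (\<omega>\<^sup>2 * B)"
proof -
  have "0 < z t" "\<epsilon> \<le> z t" "z t \<le> B" using \<epsilon> z_bounds[of t] by auto
  then have "1 / z t \<le> 1 / \<epsilon>" "\<omega>\<^sup>2 * z t \<le> \<omega>\<^sup>2 * B"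
    using \<epsilon> by (auto intro: frac_le mult_left_mono)
  then show ?thesis using \<open>0 < z t\<close> by (auto simp: abs_mult)
qed

lemma coefficient_measurable: "p \<in> borel_measurable lebesgue" "q \<in> borel_measurable lebesgue"
  using z_measurable by measurable

lemma ae_end:
  assumes "AE x in lebesgue_on {x0<..<x1}. P x"
  shows "eventually P (ess_at_right x0)" "eventually P (ess_at_left x1)"
  using eventually_end_filter[OF x01 _ assms] by (auto simp: end_filters_def)

text \<open>The existence half of the passage: bounded coefficients make the solution Lipschitz, and
  Lebesgue differentiation recovers the equations almost everywhere, first for \<open>z\<close> and
  then for \<open>\<zeta>\<close>.\<close>

lemma ode_sol_imp_weak_solution:
  assumes s: "ode_sol x0 x1 p q U (W :: real \<Rightarrow> complex)"
  shows "abs_continuous_on {x0<..<x1} U" "abs_continuous_on {x0<..<x1} W"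
    and "AE x in lebesgue_on {x0<..<x1}. W x = of_real (\<zeta> x) * vector_derivative U (at x)"
    and "AE x in lebesgue_on {x0<..<x1}. (W has_vector_derivative - (of_real (\<omega>\<^sup>2 * \<zeta> x) * U x)) (at x)"
proof -
  obtain L where L: "0 \<le> L" "\<And>c d. \<lbrakk>x0 \<le> c; c \<le> d; d \<le> x1\<rbrakk> \<Longrightarrow>
      norm (U d - U c) \<le> L * (d - c) \<and> norm (W d - W c) \<le> L * (d - c)"
    using ode_sol_lipschitz[OF s coefficient_bounds] by blast
  show "abs_continuous_on {x0<..<x1} U" "abs_continuous_on {x0<..<x1} W"
    using L(2) by (auto intro!: lipschitz_imp_abs_continuous_on[where L = L])
  obtain N where N: "negligible N"
    "\<And>x. \<lbrakk>x0 < x; x < x1; x \<notin> N\<rbrakk> \<Longrightarrow> (U has_vector_derivative p x *\<^sub>R W x) (at x)"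
    "\<And>x. \<lbrakk>x0 < x; x < x1; x \<notin> N\<rbrakk> \<Longrightarrow> (W has_vector_derivative - (q x *\<^sub>R U x)) (at x)"
    using ode_sol_derivative_ae[OF s less_imp_le[OF x01]] by blast
  have "AE x in lebesgue. x \<notin> N"
    using N(1) by (intro AE_not_in) (simp add: negligible_iff_null_sets)
  then have "AE x in lebesgue_on {x0<..<x1}. x \<in> {x0<..<x1} \<and> x \<notin> N"
    by (auto simp: AE_restrict_space_iff elim: eventually_mono)
  with z_ae have ae: "AE x in lebesgue_on {x0<..<x1}. \<zeta> x = z x \<and> x \<in> {x0<..<x1} \<and> x \<notin> N"
    by (rule eventually_conj)
  have pos: "z x \<noteq> 0" for x using \<epsilon> z_bounds[of x] by auto
  show "AE x in lebesgue_on {x0<..<x1}. W x = of_real (\<zeta> x) * vector_derivative U (at x)"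
    using ae
  proof eventually_elim
    case (elim x)
    then have "vector_derivative U (at x) = p x *\<^sub>R W x"
      using N(2)[of x] by (simp add: vector_derivative_at)
    then show ?case using elim pos[of x] by (simp add: scaleR_conv_of_real)
  qed
  show "AE x in lebesgue_on {x0<..<x1}. (W has_vector_derivative - (of_real (\<omega>\<^sup>2 * \<zeta> x) * U x)) (at x)"
    using ae
  proof eventually_elim
    case (elim x)
    then show ?case using N(3)[of x] by (simp add: scaleR_conv_of_real)
  qed
qed

text \<open>The uniqueness half. Uniform continuity extends \<open>u\<close> and \<open>w\<close> to
  the closed interval. Differentiability of \<open>w\<close> is part of the equation, while for
  \<open>u\<close> it comes from absolute continuity. The fundamental theorem then gives the
  integral equations between interior points.\<close>

lemma weak_solution_imp_ode_sol:
  assumes u: "abs_continuous_on {x0<..<x1} u" and w: "abs_continuous_on {x0<..<x1} w"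
    and ae1: "AE x in lebesgue_on {x0<..<x1}. w x = of_real (\<zeta> x) * vector_derivative u (at x)"
    and ae2: "AE x in lebesgue_on {x0<..<x1}. (w has_vector_derivative - (of_real (\<omega>\<^sup>2 * \<zeta> x) * u x)) (at x)"
  obtains U W where "ode_sol x0 x1 p q U W" "\<And>x. x \<in> {x0<..<x1} \<Longrightarrow> U x = u x \<and> W x = w x"
proof -
  have cl: "closure {x0<..<x1} = {x0..x1}" using x01 by simp
  have "is_interval {x0<..<x1}" by (simp add: is_interval_oo)
  note uc = abs_continuous_on_imp_uniformly_continuous_on[OF _ this]
  obtain U where U: "continuous_on {x0..x1} U" "\<And>x. x \<in> {x0<..<x1} \<Longrightarrow> u x = U x"
    using uniformly_continuous_on_extension_on_closure[OF uc[OF u]] cl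
    by (metis uniformly_continuous_imp_continuous)
  obtain W where W: "continuous_on {x0..x1} W" "\<And>x. x \<in> {x0<..<x1} \<Longrightarrow> w x = W x"
    using uniformly_continuous_on_extension_on_closure[OF uc[OF w]] cl
    by (metis uniformly_continuous_imp_continuous)
  have "AE x in lebesgue. x \<notin> {x \<in> {x0<..<x1}. \<not> u differentiable at x}"
    using abs_continuous_on_differentiable[OF u] by (intro AE_not_in) (simp add: negligible_iff_null_sets)
  moreover have "AE x in lebesgue. x \<in> {x0<..<x1} \<longrightarrow> \<zeta> x = z x"
    "AE x in lebesgue. x \<in> {x0<..<x1} \<longrightarrow> w x = of_real (\<zeta> x) * vector_derivative u (at x)"
    "AE x in lebesgue. x \<in> {x0<..<x1} \<longrightarrow> (w has_vector_derivative - (of_real (\<omega>\<^sup>2 * \<zeta> x) * u x)) (at x)"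
    using z_ae ae1 ae2 by (simp_all add: AE_restrict_space_iff)
  ultimately have "AE x in lebesgue. x \<in> {x0<..<x1} \<longrightarrow> (u has_vector_derivative p x *\<^sub>R W x) (at x) \<and>
      (w has_vector_derivative - (q x *\<^sub>R U x)) (at x)"
  proof eventually_elim
    case (elim x)
    show ?case
    proof
      assume x: "x \<in> {x0<..<x1}"
      have "z x \<noteq> 0" using \<epsilon> z_bounds[of x] by auto
      have "(u has_vector_derivative vector_derivative u (at x)) (at x)"
        using elim x by (simp add: vector_derivative_works)
      moreover have "vector_derivative u (at x) = p x *\<^sub>R W x"
        using elim x \<open>z x \<noteq> 0\<close> W(2)[OF x, symmetric] by (simp add: scaleR_conv_of_real)
      ultimately show "(u has_vector_derivative p x *\<^sub>R W x) (at x) \<and>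
          (w has_vector_derivative - (q x *\<^sub>R U x)) (at x)"
        using elim x U(2)[OF x] by (simp add: scaleR_conv_of_real)
    qed
  qed
  then obtain N where N: "negligible N" "\<And>x. \<lbrakk>x \<in> {x0<..<x1}; x \<notin> N\<rbrakk> \<Longrightarrow>
      (u has_vector_derivative p x *\<^sub>R W x) (at x) \<and> (w has_vector_derivative - (q x *\<^sub>R U x)) (at x)"
    unfolding eventually_ae_filter_negligible by blast
  have int: "(h has_integral (H x - H x0)) {x0..x}"
    if x: "x \<in> {x0..x1}" and contH: "continuous_on {x0..x1} H" and h: "h integrable_on {x0..x1}"
      and ac: "abs_continuous_on {x0<..<x1} f" and f: "\<And>x. x \<in> {x0<..<x1} \<Longrightarrow> f x = H x"
      and der: "\<And>x. \<lbrakk>x \<in> {x0<..<x1}; x \<notin> N\<rbrakk> \<Longrightarrow> (f has_vector_derivative h x) (at x)"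
    for x and f h H :: "real \<Rightarrow> complex"
  proof -
    \<comment> \<open>The defect of the integral equation started at \<open>x0\<close>. The
      fundamental theorem makes it constant inside the interval, and continuity makes it constant up
      to both ends.\<close>
    define \<phi> where "\<phi> t = H t - integral {x0..t} h" for t
    have "continuous_on {x0..x1} \<phi>"
      unfolding \<phi>_def by (intro continuous_intros contH indefinite_integral_continuous_1 h)
    moreover have "\<phi> d = \<phi> c" if cd: "x0 < c" "c \<le> d" "d < x1" for c d
    proof -
      have "(h has_integral (f d - f c)) {c..d}"
        by (rule abs_continuous_on_has_integral[OF ac cd(2) _ N(1)]) (use cd der in auto)
      moreover have "integral {x0..c} h + integral {c..d} h = integral {x0..d} h"
        by (rule Henstock_Kurzweil_Integration.integral_combine)
          (use cd in \<open>auto intro: integrable_on_subinterval[OF h]\<close>)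
      ultimately show ?thesis
        using f[of c] f[of d] cd by (simp add: \<phi>_def integral_unique algebra_simps)
    qed
    ultimately have "\<phi> x = \<phi> x0" by (rule continuous_on_eq_on_Icc[OF x01 _ _ x])
    then have "integral {x0..x} h = H x - H x0" by (simp add: \<phi>_def algebra_simps)
    moreover have "h integrable_on {x0..x}"
      using h by (rule integrable_on_subinterval) (use x in auto)
    ultimately show ?thesis by (metis integrable_integral)
  qed
  have "ode_sol x0 x1 p q U W"
    unfolding ode_sol_def
  proof (intro conjI ballI U(1) W(1))
    fix x assume x: "x \<in> {x0..x1}"
    show "((\<lambda>t. p t *\<^sub>R W t) has_integral (U x - U x0)) {x0..x}"
      by (rule int[OF x U(1) _ u U(2)])
        (use N(2) bounded_measurable_scaleR_integrable[OF coefficient_measurable(1) conjunct1[OF coefficient_bounds] W(1)] in auto)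
    show "((\<lambda>t. - (q t *\<^sub>R U t)) has_integral (W x - W x0)) {x0..x}"
      by (rule int[OF x W(1) _ w W(2)])
        (use N(2) integrable_neg[OF bounded_measurable_scaleR_integrable[OF coefficient_measurable(2) conjunct2[OF coefficient_bounds] U(1)]] in auto)
  qed
  then show thesis using that U(2) W(2) by simp
qed

lemma ode_sol_end_limits:
  assumes s: "ode_sol x0 x1 p q U (W :: real \<Rightarrow> complex)"
    and eq: "\<And>x. x \<in> {x0<..<x1} \<Longrightarrow> U x = u x \<and> W x = w x"
    and ae: "AE x in lebesgue_on {x0<..<x1}. w x = of_real (\<zeta> x) * vector_derivative u (at x)"
  shows "(left_part \<omega> u \<longlongrightarrow> 1/2 * (U x0 - 1 / (\<i> * of_real \<omega>) * (W x0 / of_real l0))) (ess_at_right x0)"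
    and "(right_part \<omega> u \<longlongrightarrow> 1/2 * (U x0 + 1 / (\<i> * of_real \<omega>) * (W x0 / of_real l0))) (ess_at_right x0)"
    and "(left_part \<omega> u \<longlongrightarrow> 1/2 * (U x1 - 1 / (\<i> * of_real \<omega>) * (W x1 / of_real l1))) (ess_at_left x1)"
    and "(right_part \<omega> u \<longlongrightarrow> 1/2 * (U x1 + 1 / (\<i> * of_real \<omega>) * (W x1 / of_real l1))) (ess_at_left x1)"
proof -
  have c: "continuous_on {x0..x1} U" "continuous_on {x0..x1} W" using s by (simp_all add: ode_sol_def)
  have ae': "AE x in lebesgue_on {x0<..<x1}. U x = u x \<and> W x = w x"
    using eq by (simp add: AE_restrict_space_iff)
  have sub: "ess_at_right x0 \<le> at_right x0" "ess_at_left x1 \<le> at_left x1"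
    by (simp_all add: ess_at_right_def ess_at_left_def)
  have r: "(u \<longlongrightarrow> U x0) (ess_at_right x0)" "(w \<longlongrightarrow> W x0) (ess_at_right x0)"
    using Lim_transform_eventually[OF tendsto_mono[OF sub(1) continuous_on_Icc_at_rightD[OF c(1) x01]], of u]
      Lim_transform_eventually[OF tendsto_mono[OF sub(1) continuous_on_Icc_at_rightD[OF c(2) x01]], of w]
      ae_end(1)[OF ae'] by (auto simp: eventually_conj_iff)
  have l: "(u \<longlongrightarrow> U x1) (ess_at_left x1)" "(w \<longlongrightarrow> W x1) (ess_at_left x1)"
    using Lim_transform_eventually[OF tendsto_mono[OF sub(2) continuous_on_Icc_at_leftD[OF c(1) x01]], of u]
      Lim_transform_eventually[OF tendsto_mono[OF sub(2) continuous_on_Icc_at_leftD[OF c(2) x01]], of w]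
      ae_end(2)[OF ae'] by (auto simp: eventually_conj_iff)
  show "(left_part \<omega> u \<longlongrightarrow> 1/2 * (U x0 - 1 / (\<i> * of_real \<omega>) * (W x0 / of_real l0))) (ess_at_right x0)"
    "(right_part \<omega> u \<longlongrightarrow> 1/2 * (U x0 + 1 / (\<i> * of_real \<omega>) * (W x0 / of_real l0))) (ess_at_right x0)"
    using parts_tendsto[OF r ae_end(1)[OF ae] l0(1)] l0(2) by simp_all
  show "(left_part \<omega> u \<longlongrightarrow> 1/2 * (U x1 - 1 / (\<i> * of_real \<omega>) * (W x1 / of_real l1))) (ess_at_left x1)"
    "(right_part \<omega> u \<longlongrightarrow> 1/2 * (U x1 + 1 / (\<i> * of_real \<omega>) * (W x1 / of_real l1))) (ess_at_left x1)"
    using parts_tendsto[OF l ae_end(2)[OF ae] l1(1)] l1(2) by simp_all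
qed

text \<open>The family \<open>U \<eta>\<close> exhausts the solutions with u^r = 1 at
  \<open>x0\<close>, and \<eta> is the value of u^l there. The condition at \<open>x1\<close> reads
  \<open>\<eta> * (cnj A - \<xi> * C) = \<xi> * A - cnj C\<close>, which has exactly one root, so
  the description operator in \<open>g\<close> is well-defined.\<close>

theorem g_eq:
  fixes y1 z1 y2 z2 :: "real \<Rightarrow> real"
  assumes s1: "ode_sol x0 x1 p q y1 z1" "y1 x0 = 1" "z1 x0 = 0"
    and s2: "ode_sol x0 x1 p q y2 z2" "y2 x0 = 0" "z2 x0 = 1"
  defines "A \<equiv> transfer_diag \<omega> l0 l1 (y1 x1) (y2 x1) (z1 x1) (z2 x1)"
    and "C \<equiv> transfer_off \<omega> l0 l1 (y1 x1) (y2 x1) (z1 x1) (z2 x1)"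
  shows "norm C < norm A"
    and "\<xi> \<in> ball 0 1 \<Longrightarrow> g x0 x1 \<zeta> \<omega> \<xi> = (\<xi> * A - cnj C) / (cnj A - \<xi> * C)"
proof -
  have "y1 x1 * z2 x1 - y2 x1 * z1 x1 = 1"
    using ode_sol_wronskian[OF s1(1) s2(1) x01 coefficient_bounds] s1 s2 by simp
  then show less: "norm C < norm A"
    unfolding A_def C_def using l0(2) l1(2) \<omega> by (intro norm_transfer_less) auto
  assume \<xi>: "\<xi> \<in> ball 0 1"
  have ne: "cnj A - \<xi> * C \<noteq> 0"
  proof
    assume "cnj A - \<xi> * C = 0"
    then have "norm A = norm \<xi> * norm C" by (metis complex_mod_cnj eq_iff_diff_eq_0 norm_mult)
    also have "\<dots> \<le> 1 * norm C" using \<xi> by (intro mult_right_mono) auto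
    finally show False using less by simp
  qed
  define \<eta>0 where "\<eta>0 = (\<xi> * A - cnj C) / (cnj A - \<xi> * C)"
  have match: "(cnj C + cnj A * \<eta>) / 2 = \<xi> * ((A + C * \<eta>) / 2) \<longleftrightarrow> \<eta> = \<eta>0" for \<eta>
  proof -
    have "(cnj C + cnj A * \<eta>) / 2 = \<xi> * ((A + C * \<eta>) / 2) \<longleftrightarrow> cnj C + cnj A * \<eta> = \<xi> * (A + C * \<eta>)"
      by (simp only: times_divide_eq_right divide_cancel_right) simp
    moreover have "cnj C + cnj A * \<eta> - \<xi> * (A + C * \<eta>) = \<eta> * (cnj A - \<xi> * C) - (\<xi> * A - cnj C)"
      by (simp add: algebra_simps)
    ultimately have "(cnj C + cnj A * \<eta>) / 2 = \<xi> * ((A + C * \<eta>) / 2) \<longleftrightarrow> \<eta> * (cnj A - \<xi> * C) = \<xi> * A - cnj C"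
      by (metis eq_iff_diff_eq_0)
    then show ?thesis using ne by (simp only: \<eta>0_def eq_divide_eq not_False_eq_True if_True)
  qed
  define U where "U \<eta> x = y1 x *\<^sub>R (1 + \<eta>) + y2 x *\<^sub>R (\<i> * of_real (\<omega> * l0) * (1 - \<eta>))" for \<eta> x
  define W where "W \<eta> x = z1 x *\<^sub>R (1 + \<eta>) + z2 x *\<^sub>R (\<i> * of_real (\<omega> * l0) * (1 - \<eta>))" for \<eta> x
  have sol: "ode_sol x0 x1 p q (U \<eta>) (W \<eta>)" for \<eta>
    unfolding U_def W_def by (rule ode_sol_linear_combination[OF s1(1) s2(1)])
  have start: "U \<eta> x0 = 1 + \<eta>" "W \<eta> x0 = \<i> * of_real (\<omega> * l0) * (1 - \<eta>)" for \<eta>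
    using s1 s2 by (simp_all add: U_def W_def)
  have parts0: "1/2 * (U \<eta> x0 - 1 / (\<i> * of_real \<omega>) * (W \<eta> x0 / of_real l0)) = \<eta>"
    "1/2 * (U \<eta> x0 + 1 / (\<i> * of_real \<omega>) * (W \<eta> x0 / of_real l0)) = 1" for \<eta>
    unfolding start using \<omega> l0(2) by (simp_all add: field_simps)
  have parts1: "1/2 * (U \<eta> x1 + 1 / (\<i> * of_real \<omega>) * (W \<eta> x1 / of_real l1)) = (A + C * \<eta>) / 2"
    "1/2 * (U \<eta> x1 - 1 / (\<i> * of_real \<omega>) * (W \<eta> x1 / of_real l1)) = (cnj C + cnj A * \<eta>) / 2" for \<eta>
    unfolding A_def C_def
    by (rule transfer_parts[OF _ _ \<omega> U_def W_def]; use l0(2) l1(2) in simp)+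
  \<comment> \<open>Recovers u and u' / (i \<omega>) at \<open>x0\<close> from their half difference
    and half sum, that is from u^l and u^r.\<close>
  have halves: "s = 1 + c" "t = 1 - c" if "c = 1/2 * (s - t)" "1 = 1/2 * (s + t)" for c s t :: complex
  proof -
    have "2 * (1/2 * x) = x" for x :: complex by simp
    from this[of "s + t"] have "2 * 1 = s + t" by (simp only: that(2)[symmetric])
    then have s: "s = 2 - t" by (simp add: algebra_simps)
    have "c = 1/2 * (2 - t - t)" using that(1) unfolding s .
    also have "\<dots> = 1 - t" by (simp add: field_simps)
    finally have "c = 1 - t" .
    then show "s = 1 + c" "t = 1 - c" by (simp_all add: s)
  qed
  have exists: "is_solution x0 x1 \<zeta> \<omega> \<xi> (U \<eta>0)" "(left_part \<omega> (U \<eta>0) \<longlongrightarrow> \<eta>0) (ess_at_right x0)"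
  proof -
    note ws = ode_sol_imp_weak_solution[OF sol[of \<eta>0]]
    note lims = ode_sol_end_limits[OF sol[of \<eta>0] _ ws(3), simplified parts0 parts1, OF conjI[OF refl refl]]
    show "(left_part \<omega> (U \<eta>0) \<longlongrightarrow> \<eta>0) (ess_at_right x0)" by (rule lims(1))
    show "is_solution x0 x1 \<zeta> \<omega> \<xi> (U \<eta>0)"
      unfolding is_solution_def
      using ws lims(2-4) match[of \<eta>0] by blast
  qed
  have unique: "c = \<eta>0" if u: "is_solution x0 x1 \<zeta> \<omega> \<xi> u" "(left_part \<omega> u \<longlongrightarrow> c) (ess_at_right x0)" for u c
  proof -
    obtain w where w: "abs_continuous_on {x0<..<x1} w"
      "AE x in lebesgue_on {x0<..<x1}. w x = of_real (\<zeta> x) * vector_derivative u (at x)"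
      "AE x in lebesgue_on {x0<..<x1}. (w has_vector_derivative - (of_real (\<omega>\<^sup>2 * \<zeta> x) * u x)) (at x)"
      and u0: "abs_continuous_on {x0<..<x1} u" "(right_part \<omega> u \<longlongrightarrow> 1) (ess_at_right x0)"
      and u1: "\<exists>a b. (left_part \<omega> u \<longlongrightarrow> a) (ess_at_left x1) \<and> (right_part \<omega> u \<longlongrightarrow> b) (ess_at_left x1) \<and> a = \<xi> * b"
      using u(1) unfolding is_solution_def by blast
    obtain U' W' where s: "ode_sol x0 x1 p q U' W'" "\<And>x. x \<in> {x0<..<x1} \<Longrightarrow> U' x = u x \<and> W' x = w x"
      using weak_solution_imp_ode_sol[OF u0(1) w] by blast
    note lims = ode_sol_end_limits[OF s w(2)]
    have "c = 1/2 * (U' x0 - 1 / (\<i> * of_real \<omega>) * (W' x0 / of_real l0))"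
      "1 = 1/2 * (U' x0 + 1 / (\<i> * of_real \<omega>) * (W' x0 / of_real l0))"
      using tendsto_unique[OF ess_at_right_neq_bot u(2) lims(1)]
        tendsto_unique[OF ess_at_right_neq_bot u0(2) lims(2)] by simp_all
    then have "U' x0 = 1 + c" "1 / (\<i> * of_real \<omega>) * (W' x0 / of_real l0) = 1 - c"
      using halves by blast+
    then have "U' x0 = U c x0" "W' x0 = W c x0"
      using \<omega> l0(2) unfolding start by (simp_all add: field_simps)
    \<comment> \<open>Equal data at \<open>x0\<close> force equal values at \<open>x1\<close>, so an
      arbitrary solution has the same end limits as the family member with parameter
      \<open>c\<close>.\<close>
    then have end_eq: "U' x1 = U c x1" "W' x1 = W c x1"
      using ode_sol_unique[OF sol[of c] s(1) _ _ coefficient_bounds, of x1] x01 by simp_all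
    have lims1: "(left_part \<omega> u \<longlongrightarrow> (cnj C + cnj A * c) / 2) (ess_at_left x1)"
      "(right_part \<omega> u \<longlongrightarrow> (A + C * c) / 2) (ess_at_left x1)"
      using lims(3,4) unfolding end_eq parts1 by blast+
    obtain a b where ab: "(left_part \<omega> u \<longlongrightarrow> a) (ess_at_left x1)"
      "(right_part \<omega> u \<longlongrightarrow> b) (ess_at_left x1)" "a = \<xi> * b"
      using u1 by blast
    have "(cnj C + cnj A * c) / 2 = \<xi> * ((A + C * c) / 2)"
      using ab(3) tendsto_unique[OF ess_at_left_neq_bot ab(1) lims1(1)]
        tendsto_unique[OF ess_at_left_neq_bot ab(2) lims1(2)] by (simp only:)
    then show ?thesis using match by blast
  qed
  show "g x0 x1 \<zeta> \<omega> \<xi> = (\<xi> * A - cnj C) / (cnj A - \<xi> * C)"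
    unfolding g_def \<eta>0_def[symmetric] using exists unique by (intro the_equality) blast+
qed

end

section \<open>Disk automorphisms in terms of their coefficients\<close>

lemma mobius_in_K:
  assumes less: "norm C < norm A"
    and f: "\<And>\<xi>. \<xi> \<in> ball 0 1 \<Longrightarrow> f \<xi> = (\<xi> * A - cnj C) / (cnj A - \<xi> * C)"
  shows "f \<in> K"
proof -
  have "A \<noteq> 0" using less by auto
  \<comment> \<open>Both parameters result from taking the factor \<open>A\<close> out of the
    numerator and \<open>cnj A\<close> out of the denominator.\<close>
  define \<mu> where "\<mu> = A / cnj A"
  define \<rho> where "\<rho> = - cnj C / A"
  have "norm \<mu> = 1" using \<open>A \<noteq> 0\<close> by (simp add: \<mu>_def norm_divide)
  moreover have "norm \<rho> < 1" using less \<open>A \<noteq> 0\<close> by (simp add: \<rho>_def norm_divide)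
  moreover have "f \<xi> = \<mu> * ((\<xi> + \<rho>) / (1 + cnj \<rho> * \<xi>))" if "\<xi> \<in> ball 0 1" for \<xi>
  proof -
    have "\<xi> + \<rho> = (\<xi> * A - cnj C) / A" "1 + cnj \<rho> * \<xi> = (cnj A - \<xi> * C) / cnj A"
      using \<open>A \<noteq> 0\<close> by (simp_all add: \<rho>_def field_simps)
    then show ?thesis using f[OF that] \<open>A \<noteq> 0\<close> by (simp add: \<mu>_def)
  qed
  ultimately show ?thesis unfolding K_def by blast
qed

lemma uniform_limit_affine:
  fixes a b :: "nat \<Rightarrow> complex"
  assumes "a \<longlonglongrightarrow> a0" "b \<longlonglongrightarrow> b0" and S: "S \<subseteq> ball 0 1"
  shows "uniform_limit S (\<lambda>n \<xi>. \<xi> * a n - b n) (\<lambda>\<xi>. \<xi> * a0 - b0) sequentially"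
proof (rule uniform_limitI)
  fix e :: real assume "0 < e"
  then have "\<forall>\<^sub>F n in sequentially. dist (a n) a0 < e / 2" "\<forall>\<^sub>F n in sequentially. dist (b n) b0 < e / 2"
    using tendstoD[OF assms(1), of "e / 2"] tendstoD[OF assms(2), of "e / 2"] by simp_all
  then show "\<forall>\<^sub>F n in sequentially. \<forall>\<xi>\<in>S. dist (\<xi> * a n - b n) (\<xi> * a0 - b0) < e"
  proof eventually_elim
    case (elim n)
    show ?case
    proof
      fix \<xi> assume "\<xi> \<in> S"
      then have "norm \<xi> \<le> 1" using S by auto
      have "(\<xi> * a n - b n) - (\<xi> * a0 - b0) = \<xi> * (a n - a0) - (b n - b0)"
        by (simp add: algebra_simps)
      then have "norm ((\<xi> * a n - b n) - (\<xi> * a0 - b0)) \<le> norm \<xi> * norm (a n - a0) + norm (b n - b0)"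
        by (metis norm_mult norm_triangle_ineq4)
      also have "\<dots> \<le> 1 * norm (a n - a0) + norm (b n - b0)"
        using \<open>norm \<xi> \<le> 1\<close> by (intro add_right_mono mult_right_mono) auto
      finally show "dist (\<xi> * a n - b n) (\<xi> * a0 - b0) < e"
        using elim by (simp add: dist_norm)
    qed
  qed
qed

text \<open>Division preserves uniform limits when the limit numerator is bounded and the limit
  denominator stays away from 0; on the disk the latter has norm at least
  \<open>norm A0 - norm C0\<close>.\<close>

lemma mobius_uniform_limit:
  fixes A C :: "nat \<Rightarrow> complex"
  assumes A: "A \<longlonglongrightarrow> A0" and C: "C \<longlonglongrightarrow> C0" and less: "norm C0 < norm A0" and S: "S \<subseteq> ball 0 1"
  shows "uniform_limit S (\<lambda>n \<xi>. (\<xi> * A n - cnj (C n)) / (cnj (A n) - \<xi> * C n))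
    (\<lambda>\<xi>. (\<xi> * A0 - cnj C0) / (cnj A0 - \<xi> * C0)) sequentially"
proof (rule uniform_lim_divide)
  show "uniform_limit S (\<lambda>n \<xi>. \<xi> * A n - cnj (C n)) (\<lambda>\<xi>. \<xi> * A0 - cnj C0) sequentially"
    by (intro uniform_limit_affine A tendsto_cnj C S)
  \<comment> \<open>The denominator is again affine in \<xi>, with the signs arranged to fit
    \<open>uniform_limit_affine\<close>.\<close>
  have "uniform_limit S (\<lambda>n \<xi>. \<xi> * (- C n) - (- cnj (A n))) (\<lambda>\<xi>. \<xi> * (- C0) - (- cnj A0)) sequentially"
    by (intro uniform_limit_affine tendsto_minus tendsto_cnj A C S)
  then show "uniform_limit S (\<lambda>n \<xi>. cnj (A n) - \<xi> * C n) (\<lambda>\<xi>. cnj A0 - \<xi> * C0) sequentially"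
    by (simp add: algebra_simps)
  have S1: "norm \<xi> \<le> 1" if "\<xi> \<in> S" for \<xi> using S that by auto
  have "norm (\<xi> * A0 - cnj C0) \<le> norm A0 + norm C0" if "\<xi> \<in> S" for \<xi>
    using norm_triangle_ineq4[of "\<xi> * A0" "cnj C0"] mult_right_mono[OF S1[OF that], of "norm A0"]
    by (simp add: norm_mult)
  then show "bounded ((\<lambda>\<xi>. \<xi> * A0 - cnj C0) ` S)" by (auto simp: bounded_iff)
  show "norm A0 - norm C0 \<le> norm (cnj A0 - \<xi> * C0)" if "\<xi> \<in> S" for \<xi>
    using norm_triangle_ineq2[of "cnj A0" "\<xi> * C0"] mult_right_mono[OF S1[OF that], of "norm C0"]
    by (simp add: norm_mult)
  show "norm A0 - norm C0 > 0" using less by simp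
qed

section \<open>Continuous dependence on the coefficient\<close>

lemma ode_sol_tendsto:
  fixes y z :: "real \<Rightarrow> 'a::euclidean_space"
  assumes s: "ode_sol a b p q y z" and sn: "\<And>n. ode_sol a b (ps n) (qs n) (ys n) (zs n)"
    and init: "\<And>n. ys n a = y a" "\<And>n. zs n a = z a" and "a \<le> b"
    and M: "\<And>t. \<bar>p t\<bar> \<le> M \<and> \<bar>q t\<bar> \<le> M"
    and close: "\<And>\<eta>. 0 < \<eta> \<Longrightarrow> \<forall>\<^sub>F n in sequentially. \<forall>t. \<bar>ps n t - p t\<bar> \<le> \<eta> \<and> \<bar>qs n t - q t\<bar> \<le> \<eta>"
  shows "(\<lambda>n. ys n b) \<longlonglongrightarrow> y b" "(\<lambda>n. zs n b) \<longlonglongrightarrow> z b"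
proof -
  obtain C where C: "0 < C" "\<And>t. t \<in> {a..b} \<Longrightarrow> norm (y t) \<le> C \<and> norm (z t) \<le> C"
    using ode_sol_bounded[OF s] by blast
  define R where "R = 4 * C * (b - a) * exp (2 * (\<bar>M\<bar> + 1) * (b - a))"
  have "0 \<le> R" using C(1) \<open>a \<le> b\<close> by (simp add: R_def)
  have "\<forall>\<^sub>F n in sequentially. norm (ys n b - y b) + norm (zs n b - z b) < e" if "0 < e" for e
  proof -
    \<comment> \<open>The bound 1 keeps the perturbed coefficients below
      \<open>\<bar>M\<bar> + 1\<close>, so that the exponent in \<open>R\<close> does not depend on
      \<open>n\<close>; the other bound makes \<open>\<eta> * R\<close> smaller than
      \<open>e\<close>.\<close>
    define \<eta> where "\<eta> = min 1 (e / (2 * (R + 1)))"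
    have \<eta>: "0 < \<eta>" "\<eta> \<le> 1" "\<eta> \<le> e / (2 * (R + 1))"
      using \<open>0 < e\<close> \<open>0 \<le> R\<close> by (simp_all add: \<eta>_def)
    have "\<eta> * R \<le> e / (2 * (R + 1)) * (R + 1)"
      using \<eta> \<open>0 \<le> R\<close> \<open>0 < e\<close> by (intro mult_mono) auto
    also have "\<dots> < e"
      using add_pos_nonneg[OF \<open>0 < e\<close>, of "R * e"] \<open>0 < e\<close> \<open>0 \<le> R\<close> by (simp add: field_simps)
    finally have small: "\<eta> * R < e" .
    show ?thesis
      using close[OF \<eta>(1)]
    proof eventually_elim
      case (elim n)
      have bound: "\<bar>ps n t\<bar> \<le> \<bar>M\<bar> + 1 \<and> \<bar>qs n t\<bar> \<le> \<bar>M\<bar> + 1" for t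
        using M[of t] elim[rule_format, of t] \<eta>(2) by linarith
      have "norm (ys n b - y b) + norm (zs n b - z b) \<le> 4 * \<eta> * C * (b - a) * exp (2 * (\<bar>M\<bar> + 1) * (b - a))"
        by (rule ode_sol_perturb[OF s sn init]) (use C bound elim \<eta> \<open>a \<le> b\<close> in auto)
      also have "\<dots> = \<eta> * R" by (simp add: R_def)
      finally show ?case using small by simp
    qed
  qed
  note ev = this
  show "(\<lambda>n. ys n b) \<longlonglongrightarrow> y b"
  proof (rule tendstoI)
    fix e :: real assume "0 < e"
    from ev[OF this] show "\<forall>\<^sub>F n in sequentially. dist (ys n b) (y b) < e"
      unfolding dist_norm by (rule eventually_mono) (use norm_ge_zero in \<open>smt (verit)\<close>)
  qed
  show "(\<lambda>n. zs n b) \<longlonglongrightarrow> z b"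
  proof (rule tendstoI)
    fix e :: real assume "0 < e"
    from ev[OF this] show "\<forall>\<^sub>F n in sequentially. dist (zs n b) (z b) < e"
      unfolding dist_norm by (rule eventually_mono) (use norm_ge_zero in \<open>smt (verit)\<close>)
  qed
qed

lemma Linf_tendstoD:
  assumes "Linf_tendsto x0 x1 fs f" "0 < e"
  shows "\<forall>\<^sub>F n in sequentially. Linf_norm x0 x1 (\<lambda>x. complex_of_real (fs n x - f x)) < ereal e"
  using order_tendstoD(2)[of _ 0 sequentially "ereal e"] assms unfolding Linf_tendsto_def by simp

text \<open>A bound valid almost everywhere passes to limits along the essential filter, so limits
  at an end differ by no more than the functions do. Passing to the limit weakens strict
  inequalities, hence the margin \<open>e / 2\<close>.\<close>

lemma Linf_tendsto_end_limits:
  assumes "x0 < x1" "F \<in> end_filters x0 x1" and lim: "Linf_tendsto x0 x1 fs f"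
    and f: "(f \<longlongrightarrow> l) F" and fs: "\<And>n. (fs n \<longlongrightarrow> ls n) F"
  shows "ls \<longlonglongrightarrow> l"
proof (rule tendstoI)
  fix e :: real assume "0 < e"
  then have "0 < e / 2" by simp
  from Linf_tendstoD[OF lim this] show "\<forall>\<^sub>F n in sequentially. dist (ls n) l < e"
  proof eventually_elim
    case (elim n)
    have "AE x in lebesgue_on {x0<..<x1}. \<bar>fs n x - f x\<bar> \<le> e / 2"
      using AE_norm_le_Linf_norm[where f = "\<lambda>x. complex_of_real (fs n x - f x)"]
    proof eventually_elim
      case (elim x)
      then have "ereal \<bar>fs n x - f x\<bar> < ereal (e / 2)"
        using \<open>Linf_norm x0 x1 _ < ereal (e / 2)\<close> by (metis norm_of_real order_le_less_trans)
      then show ?case by simp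
    qed
    then have "eventually (\<lambda>x. \<bar>fs n x - f x\<bar> \<le> e / 2) F"
      by (rule eventually_end_filter[OF assms(1,2)])
    moreover have "((\<lambda>x. \<bar>fs n x - f x\<bar>) \<longlongrightarrow> \<bar>ls n - l\<bar>) F"
      by (intro tendsto_intros fs f)
    ultimately have "\<bar>ls n - l\<bar> \<le> e / 2"
      using tendsto_upperbound end_filter_neq_bot[OF assms(2)] by blast
    then show ?case using \<open>0 < e\<close> by (simp add: dist_real_def)
  qed
qed

text \<open>The value 1 off \<open>E\<close> is an arbitrary positive constant, which explains
  \<open>min \<epsilon> 1\<close> and \<open>max B 1\<close>. With the same \<open>E\<close> and the
  same constant for every medium, normalized coefficients differ only on \<open>E\<close>.\<close>

lemma medium_normalized:
  assumes "x0 < x1" "\<omega> \<noteq> 0" and f: "f \<in> Reg_plus x0 x1"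
    and E: "E \<in> sets lebesgue" "E \<subseteq> {x0<..<x1}" "AE x in lebesgue_on {x0<..<x1}. x \<in> E"
    and b: "0 < \<epsilon>" "\<And>x. x \<in> E \<Longrightarrow> \<epsilon> \<le> f x \<and> f x \<le> B"
    and l: "(f \<longlongrightarrow> l0) (ess_at_right x0)" "0 < l0" "(f \<longlongrightarrow> l1) (ess_at_left x1)" "0 < l1"
  shows "medium x0 x1 \<omega> f (\<lambda>x. if x \<in> E then f x else 1) l0 l1 (min \<epsilon> 1) (max B 1)"
proof
  have "(\<lambda>x. if x \<in> {x0<..<x1} then f x else 0) \<in> borel_measurable lebesgue"
    by (rule borel_measurable_if_I[OF Reg_plus_measurable[OF f]]) auto
  then have "(\<lambda>x. if x \<in> E then (if x \<in> {x0<..<x1} then f x else 0) else 1) \<in> borel_measurable lebesgue"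
    by (rule measurable_If_set) (use E(1) in simp_all)
  moreover have "(\<lambda>x. if x \<in> E then (if x \<in> {x0<..<x1} then f x else 0) else 1) = (\<lambda>x. if x \<in> E then f x else 1)"
    using E(2) by (auto simp: fun_eq_iff)
  ultimately show "(\<lambda>x. if x \<in> E then f x else 1) \<in> borel_measurable lebesgue" by simp
  show "AE x in lebesgue_on {x0<..<x1}. f x = (if x \<in> E then f x else 1)"
    using E(3) by (auto elim: eventually_mono)
  show "min \<epsilon> 1 \<le> (if x \<in> E then f x else 1) \<and> (if x \<in> E then f x else 1) \<le> max B 1" for x
    using b(2)[of x] by auto
qed (use assms in auto)

lemma AE_lebesgue_on_negligible:
  assumes "AE x in lebesgue_on {x0<..<x1::real}. P x"
  obtains N where "negligible N" "\<And>x. \<lbrakk>x \<in> {x0<..<x1}; x \<notin> N\<rbrakk> \<Longrightarrow> P x"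
proof -
  have "AE x in lebesgue. x \<in> {x0<..<x1} \<longrightarrow> P x"
    using assms by (simp add: AE_restrict_space_iff)
  then show thesis
    using that unfolding eventually_ae_filter_negligible by blast
qed

text \<open>The difference is \<open>(z - w) / (w * z)\<close>; the bound on \<delta> keeps
  \<open>w\<close> above \<open>\<epsilon> / 2\<close>, whence the constant.\<close>

lemma inverse_diff_le:
  fixes z w :: real
  assumes "0 < \<epsilon>" "\<epsilon> \<le> z" "\<bar>w - z\<bar> \<le> \<delta>" "\<delta> \<le> \<epsilon> / 2"
  shows "\<bar>1 / w - 1 / z\<bar> \<le> 2 * \<delta> / \<epsilon>\<^sup>2"
proof -
  have w: "\<epsilon> / 2 \<le> w" using assms by linarith
  have "1 / w - 1 / z = (z - w) / (w * z)" using w assms by (simp add: field_simps)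
  then have "\<bar>1 / w - 1 / z\<bar> = \<bar>w - z\<bar> / (w * z)" using w assms by (simp add: abs_mult abs_minus_commute)
  also have "\<dots> \<le> \<delta> / (\<epsilon> / 2 * \<epsilon>)"
    using w assms by (intro frac_le mult_mono mult_pos_pos) auto
  finally show ?thesis by (simp add: power2_eq_square mult.commute)
qed

theorem theorem3:
  fixes x0 x1 :: real and \<zeta> :: "real \<Rightarrow> real" and \<zeta>s :: "nat \<Rightarrow> real \<Rightarrow> real"
  assumes "x0 < x1"
    and "\<zeta> \<in> Reg_plus x0 x1"
    and "\<And>n. \<zeta>s n \<in> Reg_plus x0 x1"
    and "Linf_tendsto x0 x1 \<zeta>s \<zeta>"
  shows "AE \<omega> in lebesgue. K_tendsto (\<lambda>n. g x0 x1 (\<zeta>s n) \<omega>) (g x0 x1 \<zeta> \<omega>)"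
proof -
  have ends: "ess_at_right x0 \<in> end_filters x0 x1" "ess_at_left x1 \<in> end_filters x0 x1"
    by (simp_all add: end_filters_def)
  obtain l0 l1 where l: "(\<zeta> \<longlongrightarrow> l0) (ess_at_right x0)" "0 < l0" "(\<zeta> \<longlongrightarrow> l1) (ess_at_left x1)" "0 < l1"
    using Reg_plus_tendsto[OF assms(1) _ assms(2)] ends by metis
  obtain ls0 where ls0: "\<And>n. (\<zeta>s n \<longlongrightarrow> ls0 n) (ess_at_right x0)" "\<And>n. 0 < ls0 n"
  proof -
    have "\<exists>l. (\<zeta>s n \<longlongrightarrow> l) (ess_at_right x0) \<and> 0 < l" for n
      using Reg_plus_tendsto[OF assms(1) ends(1) assms(3)[of n]] by blast
    then show thesis using that by metis
  qed
  obtain ls1 where ls1: "\<And>n. (\<zeta>s n \<longlongrightarrow> ls1 n) (ess_at_left x1)" "\<And>n. 0 < ls1 n"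
  proof -
    have "\<exists>l. (\<zeta>s n \<longlongrightarrow> l) (ess_at_left x1) \<and> 0 < l" for n
      using Reg_plus_tendsto[OF assms(1) ends(2) assms(3)[of n]] by blast
    then show thesis using that by metis
  qed
  have lims: "ls0 \<longlonglongrightarrow> l0" "ls1 \<longlonglongrightarrow> l1"
    using Linf_tendsto_end_limits[OF assms(1) ends(1) assms(4) l(1) ls0(1)]
      Linf_tendsto_end_limits[OF assms(1) ends(2) assms(4) l(3) ls1(1)] by auto
  obtain \<epsilon> B where b: "0 < \<epsilon>" "AE x in lebesgue_on {x0<..<x1}. \<epsilon> \<le> \<zeta> x \<and> \<zeta> x \<le> B"
    using Reg_plus_bounds[OF assms(2)] .
  obtain \<epsilon>s Bs where bs: "\<And>n. 0 < \<epsilon>s n" "\<And>n. AE x in lebesgue_on {x0<..<x1}. \<epsilon>s n \<le> \<zeta>s n x \<and> \<zeta>s n x \<le> Bs n"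
  proof -
    have "\<exists>\<epsilon> B. 0 < \<epsilon> \<and> (AE x in lebesgue_on {x0<..<x1}. \<epsilon> \<le> \<zeta>s n x \<and> \<zeta>s n x \<le> B)" for n
      using Reg_plus_bounds[OF assms(3)[of n]] by blast
    then show thesis using that by metis
  qed
  let ?d = "\<lambda>n. Linf_norm x0 x1 (\<lambda>x. complex_of_real (\<zeta>s n x - \<zeta> x))"
  \<comment> \<open>The conditions are countably many, so a single null set takes care of the bounds
    and the distances for all \<open>n\<close>.\<close>
  have "AE x in lebesgue_on {x0<..<x1}. (\<epsilon> \<le> \<zeta> x \<and> \<zeta> x \<le> B) \<and> (\<forall>n. \<epsilon>s n \<le> \<zeta>s n x \<and> \<zeta>s n x \<le> Bs n) \<and>
      (\<forall>n. ereal (norm (complex_of_real (\<zeta>s n x - \<zeta> x))) \<le> ?d n)"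
    by (intro eventually_conj b(2) AE_all_countable[THEN iffD2] allI bs(2) AE_norm_le_Linf_norm)
  from AE_lebesgue_on_negligible[OF this] obtain N where N: "negligible N"
    "\<And>x. \<lbrakk>x \<in> {x0<..<x1}; x \<notin> N\<rbrakk> \<Longrightarrow>
      (\<epsilon> \<le> \<zeta> x \<and> \<zeta> x \<le> B) \<and> (\<forall>n. \<epsilon>s n \<le> \<zeta>s n x \<and> \<zeta>s n x \<le> Bs n) \<and>
      (\<forall>n. ereal (norm (complex_of_real (\<zeta>s n x - \<zeta> x))) \<le> ?d n)"
    by (auto simp only:)
  define E where "E = {x0<..<x1} - N"
  have E: "E \<in> sets lebesgue" "E \<subseteq> {x0<..<x1}" "AE x in lebesgue_on {x0<..<x1}. x \<in> E"
  proof -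
    show "E \<in> sets lebesgue" using N(1) by (auto simp: E_def negligible_imp_sets)
    have "AE x in lebesgue. x \<notin> N" using N(1) by (intro AE_not_in) (simp add: negligible_iff_null_sets)
    then show "AE x in lebesgue_on {x0<..<x1}. x \<in> E"
      by (auto simp: AE_restrict_space_iff E_def elim: eventually_mono)
  qed (auto simp: E_def)
  define z where "z x = (if x \<in> E then \<zeta> x else 1)" for x
  define zs where "zs n x = (if x \<in> E then \<zeta>s n x else 1)" for n x
  have z_close: "\<forall>\<^sub>F n in sequentially. \<forall>x. \<bar>zs n x - z x\<bar> \<le> \<delta>" if "0 < \<delta>" for \<delta>
    using Linf_tendstoD[OF assms(4) that]
  proof eventually_elim
    case (elim n)
    show ?case
    proof
      fix x
      show "\<bar>zs n x - z x\<bar> \<le> \<delta>"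
      proof (cases "x \<in> E")
        case True
        then have "ereal (norm (complex_of_real (\<zeta>s n x - \<zeta> x))) \<le> ?d n"
          unfolding E_def using N(2)[of x] by blast
        then have "ereal (norm (complex_of_real (\<zeta>s n x - \<zeta> x))) < ereal \<delta>"
          using elim by (rule order_le_less_trans)
        then show ?thesis using True unfolding norm_of_real by (simp add: z_def zs_def)
      qed (use that in \<open>simp add: z_def zs_def\<close>)
    qed
  qed
  \<comment> \<open>The exceptional set of frequencies is just {0}; from here on \<omega> is
    fixed.\<close>
  have "K_tendsto (\<lambda>n. g x0 x1 (\<zeta>s n) \<omega>) (g x0 x1 \<zeta> \<omega>)" if \<omega>: "\<omega> \<noteq> 0" for \<omega>
  proof -
    have med: "medium x0 x1 \<omega> \<zeta> z l0 l1 (min \<epsilon> 1) (max B 1)"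
      unfolding z_def using N(2)
      by (intro medium_normalized assms(1,2) \<omega> E b(1) l) (auto simp: E_def)
    have meds: "medium x0 x1 \<omega> (\<zeta>s n) (zs n) (ls0 n) (ls1 n) (min (\<epsilon>s n) 1) (max (Bs n) 1)" for n
      unfolding zs_def using N(2)
      by (intro medium_normalized assms(1,3) \<omega> E bs(1) ls0 ls1) (auto simp: E_def)
    note exists = ode_sol_exists[OF less_imp_le[OF assms(1)]]
    note coeffs = medium.coefficient_measurable medium.coefficient_bounds
    obtain y1 w1 :: "real \<Rightarrow> real" where s1: "ode_sol x0 x1 (\<lambda>t. 1 / z t) (\<lambda>t. \<omega>\<^sup>2 * z t) y1 w1" "y1 x0 = 1" "w1 x0 = 0"
      using exists[OF coeffs[OF med], of 1 0] by blast
    obtain y2 w2 :: "real \<Rightarrow> real" where s2: "ode_sol x0 x1 (\<lambda>t. 1 / z t) (\<lambda>t. \<omega>\<^sup>2 * z t) y2 w2" "y2 x0 = 0" "w2 x0 = 1"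
      using exists[OF coeffs[OF med], of 0 1] by blast
    have "\<exists>y w. ode_sol x0 x1 (\<lambda>t. 1 / zs n t) (\<lambda>t. \<omega>\<^sup>2 * zs n t) y w \<and> y x0 = a \<and> w x0 = c" for n and a c :: real
      using exists[OF coeffs[OF meds[of n]], of a c] by blast
    \<comment> \<open>The last two parameters of \<open>Y\<close> and \<open>V\<close> are the
      initial data: (1, 0) yields the first column of the perturbed propagator, (0, 1) the
      second.\<close>
    then obtain Y V where YV: "\<And>n a c. ode_sol x0 x1 (\<lambda>t. 1 / zs n t) (\<lambda>t. \<omega>\<^sup>2 * zs n t) (Y n a c) (V n a c)"
      "\<And>n a c. Y n a c x0 = (a :: real)" "\<And>n a c. V n a c x0 = (c :: real)"
      by metis
    have close: "\<forall>\<^sub>F n in sequentially. \<forall>t. \<bar>1 / zs n t - 1 / z t\<bar> \<le> \<eta> \<and> \<bar>\<omega>\<^sup>2 * zs n t - \<omega>\<^sup>2 * z t\<bar> \<le> \<eta>"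
      if "0 < \<eta>" for \<eta>
    proof -
      define e where "e = min \<epsilon> 1"
      have e: "0 < e" "\<And>t. e \<le> z t"
        using medium.\<epsilon>[OF med] medium.z_bounds[OF med] by (auto simp: e_def)
      \<comment> \<open>The first bound is required by \<open>inverse_diff_le\<close>; the other two
        bring the errors of \<open>1 / z\<close> and of \<open>\<omega>\<^sup>2 * z\<close> below
        \<eta>.\<close>
      define \<delta> where "\<delta> = min (e / 2) (min (\<eta> * e\<^sup>2 / 2) (\<eta> / \<omega>\<^sup>2))"
      have \<delta>: "0 < \<delta>" "\<delta> \<le> e / 2" "\<delta> \<le> \<eta> * e\<^sup>2 / 2" "\<delta> \<le> \<eta> / \<omega>\<^sup>2"
      proof -
        show "0 < \<delta>" unfolding \<delta>_def min_less_iff_conj using \<open>0 < \<eta>\<close> \<open>0 < e\<close> \<omega> by simp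
      qed (unfold \<delta>_def, linarith+)
      have \<delta>': "2 * \<delta> / e\<^sup>2 \<le> \<eta>" "\<omega>\<^sup>2 * \<delta> \<le> \<eta>"
        using \<delta>(3,4) \<open>0 < e\<close> \<omega> by (simp_all add: field_simps)
      show ?thesis
        using z_close[OF \<delta>(1)]
      proof eventually_elim
        case (elim n)
        show ?case
        proof
          fix t
          have "\<bar>1 / zs n t - 1 / z t\<bar> \<le> \<eta>"
            using inverse_diff_le[OF e(1) e(2)[of t], of "zs n t" \<delta>] elim \<delta>(2) \<delta>'(1) by force
          moreover have "\<bar>\<omega>\<^sup>2 * zs n t - \<omega>\<^sup>2 * z t\<bar> = \<omega>\<^sup>2 * \<bar>zs n t - z t\<bar>"
            by (simp add: abs_mult flip: right_diff_distrib)
          then have "\<bar>\<omega>\<^sup>2 * zs n t - \<omega>\<^sup>2 * z t\<bar> \<le> \<eta>"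
            using mult_left_mono[OF elim[rule_format, of t], of "\<omega>\<^sup>2"] \<delta>'(2) by simp
          ultimately show "\<bar>1 / zs n t - 1 / z t\<bar> \<le> \<eta> \<and> \<bar>\<omega>\<^sup>2 * zs n t - \<omega>\<^sup>2 * z t\<bar> \<le> \<eta>" by blast
        qed
      qed
    qed
    note conv = ode_sol_tendsto[OF _ YV(1) _ _ less_imp_le[OF assms(1)] medium.coefficient_bounds[OF med] close]
    have conv1: "(\<lambda>n. Y n 1 0 x1) \<longlonglongrightarrow> y1 x1" "(\<lambda>n. V n 1 0 x1) \<longlonglongrightarrow> w1 x1"
      by (rule conv[OF s1(1)]; simp add: YV s1)+
    have conv2: "(\<lambda>n. Y n 0 1 x1) \<longlonglongrightarrow> y2 x1" "(\<lambda>n. V n 0 1 x1) \<longlonglongrightarrow> w2 x1"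
      by (rule conv[OF s2(1)]; simp add: YV s2)+
    define A C where "A = transfer_diag \<omega> l0 l1 (y1 x1) (y2 x1) (w1 x1) (w2 x1)"
      and "C = transfer_off \<omega> l0 l1 (y1 x1) (y2 x1) (w1 x1) (w2 x1)"
    define As Cs where "As n = transfer_diag \<omega> (ls0 n) (ls1 n) (Y n 1 0 x1) (Y n 0 1 x1) (V n 1 0 x1) (V n 0 1 x1)"
      and "Cs n = transfer_off \<omega> (ls0 n) (ls1 n) (Y n 1 0 x1) (Y n 0 1 x1) (V n 1 0 x1) (V n 0 1 x1)" for n
    have g: "norm C < norm A" "\<And>\<xi>. \<xi> \<in> ball 0 1 \<Longrightarrow> g x0 x1 \<zeta> \<omega> \<xi> = (\<xi> * A - cnj C) / (cnj A - \<xi> * C)"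
      unfolding A_def C_def using medium.g_eq[OF med s1 s2] by blast+
    have gs: "norm (Cs n) < norm (As n)"
      "\<And>\<xi>. \<xi> \<in> ball 0 1 \<Longrightarrow> g x0 x1 (\<zeta>s n) \<omega> \<xi> = (\<xi> * As n - cnj (Cs n)) / (cnj (As n) - \<xi> * Cs n)" for n
      unfolding As_def Cs_def using medium.g_eq[OF meds YV YV] by blast+
    have "As \<longlonglongrightarrow> A" "Cs \<longlonglongrightarrow> C"
      unfolding As_def Cs_def A_def C_def transfer_diag_def transfer_off_def
      using l \<omega> by (intro tendsto_Complex tendsto_intros conv1 conv2 lims; simp)+
    then have "uniform_limit S (\<lambda>n. g x0 x1 (\<zeta>s n) \<omega>) (g x0 x1 \<zeta> \<omega>) sequentially" if "S \<subseteq> ball 0 1" for S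
      using mobius_uniform_limit[OF _ _ g(1) that, of As Cs] g(2) gs(2) that
      by (subst uniform_limit_cong') (auto simp: subset_iff)
    moreover have "g x0 x1 \<zeta> \<omega> \<in> K" by (rule mobius_in_K[OF g])
    moreover have "g x0 x1 (\<zeta>s n) \<omega> \<in> K" for n by (rule mobius_in_K[OF gs])
    ultimately show ?thesis unfolding K_tendsto_def by blast
  qed
  moreover have "AE \<omega> in lebesgue. \<omega> \<noteq> (0::real)"
    using AE_not_in[of "{0::real}" lebesgue] by (simp add: negligible_iff_null_sets[symmetric])
  ultimately show ?thesis by (auto elim: eventually_mono)
qed

end
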